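(* Suppose $W$ satisfies at least one of the following conditions: (1) $W=U_F$ is the Koopman operator $U_Ff=f\circ F$ on $L^2(\mathcal X,\mu)$, where $\mathcal X$ is a topological space with Borel $\sigma$-algebra and probability measure $\mu$, and $F\in\mathrm{Aut}(\mathcal X,\mu)$ is continuous; (2) $W$ is a linear operator on $L^2(\mathcal X,\mu)$, where $\mathcal X=\mathbb Z_J=\mathbb Z/J\mathbb Z$ and every point has measure $1/J$; (3) $\mathcal X=\mathbb T$, $\mu=dx/2\pi$, and $W\in\mathcal R(\mathbb T)$ is a regular operator. Then the corresponding measure $\mu_W$ on $\mathcal X\times\mathcal X$ (see context; $d\mu_W=\nu(x,a)\,d\mu(x)\,d\mu(a)$) determines a bounded operator $$\mathcal W:L^1(\mathcal X,\mu)\to L^1(\mathcal X,\mu),\qquad f\mapsto\mathcal Wf=\int_{\mathcal X}\nu(\cdot,a)f(a)\,d\mu(a),$$ i.e. $\mathcal Wf$ is the element of $L^1(\mathcal X,\mu)$ such that $\int_{\mathcal X}\varphi\,\mathcal Wf\,d\mu=\int_{\mathcal X^2}\varphi(x)f(a)\,d\mu_W(x,a)$ for every bounded Borel function $\varphi$. In cases (2) and (3) it satisfies $$\|\mathcal W\|_{L^1\to L^1}\le\|W\|_{\mathcal{DT}}^2 .$$ Moreover: (a) $\mathcal W$ is nonnegative: $\mathcal Wf\ge0$ whenever $0\le f\in L^1(\mathcal X,\mu)$. If $W$ is unitary (which is automatic in case (1)), then also: (b) $\mathcal W\mathbf 1_{\mathcal X}=\mathbf 1_{\mathcal X}$, where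 $\mathbf 1_{\mathcal X}$ is the constant function $1$; (c) $\int_{\mathcal X}\mathcal Wf\,d\mu=\int_{\mathcal X}f\,d\mu$ for every $f\in L^1(\mathcal X,\mu)$.
   Context: $\mathrm{Aut}(\mathcal X,\mu)$ is the group of automorphisms (invertible measure preserving maps with measurable inverse) of the probability space. Case (1). $\mu_{U_F}$ is defined by $d\mu_{U_F}(x',x'')=\delta(x',F(x''))\,d\mu(x')\,d\mu(x'')$, where $\delta$ is defined by $\int\delta(x',x'')\Phi(x',x'')\,d\mu(x')d\mu(x'')=\int\Phi(x,x)\,d\mu(x)$. Equivalently, $\int_{\mathcal X^2}\Phi\,d\mu_{U_F}=\int_{\mathcal X}\Phi(F(a),a)\,d\mu(a)$. Case (2). Put $\eta=e^{2\pi i/J}$ and write $f(x)=\sum_{j\in\mathbb Z_J}f_j\eta^{jx}$, $x\in\mathbb Z_J$. The inner product is $\langle f,g\rangle=\frac1J\sum_{k}f(k)\overline{g(k)}$. The matrix $(W_{k,j})$ is defined by $(Wf)_k=\sum_jW_{k,j}f_j$. Put $\omega_{m,n}=\frac1J\sum_{j,l\in\mathbb Z_J}W_{l+m,j}\overline{W_{l,j+n}}$, $\nu(x,a)=\sum_{m,n\in\mathbb Z_J}\omega_{m,n}\eta^{mx}\eta^{na}$, $d\mu_W(x,a)=\nu(x,a)\,d\mu(x)\,d\mu(a)$, and $\|W\|_{\mathcal{DT}}=\sum_{k\in\mathbb Z_J}\max_{j\in\mathbb Z_J}|W_{k+j,j}|$. Case (3). $\mathbb T=\mathbb R/2\pi\mathbb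 Z$, and a bounded operator $W$ on $L^2(\mathbb T,\mu)$ has matrix $(W_{j,k})_{j,k\in\mathbb Z}$: $W\sum_kf_ke^{ikx}=\sum_{j,k}W_{j,k}f_ke^{ijx}$. $W\in\mathcal{DT}(\mathbb T)$ (diagonal type) means $c_k=\sup_j|W_{j+k,j}|<\infty$ for all $k$ and $\|W\|_{\mathcal{DT}}:=\sum_kc_k<\infty$. $W$ is regular ($W\in\mathcal R(\mathbb T)$) if $W\in\mathcal{DT}(\mathbb T)$ and for all $m,n\in\mathbb Z$ the limit $\omega_{m,n}=\lim_{\#I\to\infty}\frac1{\#I}\sum_{j\in\mathbb Z,\,l\in I}W_{l+m,j}\overline{W_{l,j+n}}$ exists, where $I\subset\mathbb Z$ ranges over finite intervals of consecutive integers (the limit is taken over all such intervals, irrespective of their position, as the number of elements $\#I$ tends to infinity). Then $\nu(x,a)=\sum_{m,n\in\mathbb Z}\omega_{m,n}e^{imx+ina}$ (a formal Fourier series), and $d\mu_W=\nu(x,a)\frac{dx\,da}{4\pi^2}$ is the non-negative finite Borel measure on $\mathbb T^2$ with Fourier coefficients $\int_{\mathbb T^2}e^{-imx-ina}\,d\mu_W(x,a)=\omega_{m,n}$. *)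

theory Defs
  imports "HOL-Probability.Probability"
begin

section \<open>Operators on Lebesgue spaces\<close>

text \<open>
  Elements of $L^p(M)$ are represented by complex functions, and an operator on $L^p(M)$ by a map on
  such representatives that is compatible with equality almost everywhere. The functions that
  represent elements of $L^p(M)$ are passed as the set \<open>S\<close>, the norm as \<open>nrm\<close>.
\<close>

definition L1 :: "'a measure \<Rightarrow> ('a \<Rightarrow> complex) set" where
  "L1 M = {f. integrable M f}"

definition L2 :: "'a measure \<Rightarrow> ('a \<Rightarrow> complex) set" where
  "L2 M = {f. f \<in> borel_measurable M \<and> integrable M (\<lambda>x. (cmod (f x))\<^sup>2)}"

definition L1_norm :: "'a measure \<Rightarrow> ('a \<Rightarrow> complex) \<Rightarrow> real" where
  "L1_norm M f = (\<integral>x. cmod (f x) \<partial>M)"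

definition L2_norm :: "'a measure \<Rightarrow> ('a \<Rightarrow> complex) \<Rightarrow> real" where
  "L2_norm M f = sqrt (\<integral>x. (cmod (f x))\<^sup>2 \<partial>M)"

definition L2_inner :: "'a measure \<Rightarrow> ('a \<Rightarrow> complex) \<Rightarrow> ('a \<Rightarrow> complex) \<Rightarrow> complex" where
  "L2_inner M f g = (\<integral>x. f x * cnj (g x) \<partial>M)"

definition linear_operator ::
  "'a measure \<Rightarrow> ('a \<Rightarrow> complex) set \<Rightarrow> (('a \<Rightarrow> complex) \<Rightarrow> ('a \<Rightarrow> complex)) \<Rightarrow> bool" where
  "linear_operator M S T \<longleftrightarrow>
     (\<forall>f\<in>S. T f \<in> S) \<and>
     (\<forall>f\<in>S. \<forall>g\<in>S. (AE x in M. f x = g x) \<longrightarrow> (AE x in M. T f x = T g x)) \<and>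
     (\<forall>f\<in>S. \<forall>g\<in>S. AE x in M. T (\<lambda>y. f y + g y) x = T f x + T g x) \<and>
     (\<forall>c. \<forall>f\<in>S. AE x in M. T (\<lambda>y. c * f y) x = c * T f x)"

definition bounded_operator ::
  "'a measure \<Rightarrow> ('a \<Rightarrow> complex) set \<Rightarrow> (('a \<Rightarrow> complex) \<Rightarrow> real) \<Rightarrow>
   (('a \<Rightarrow> complex) \<Rightarrow> ('a \<Rightarrow> complex)) \<Rightarrow> bool" where
  "bounded_operator M S nrm T \<longleftrightarrow>
     linear_operator M S T \<and> (\<exists>C. \<forall>f\<in>S. nrm (T f) \<le> C * nrm f)"

text \<open>As in \<^const>\<open>onorm\<close>, functions of norm zero contribute the value \<open>0\<close>.\<close>

definition L1_onorm :: "'a measure \<Rightarrow> (('a \<Rightarrow> complex) \<Rightarrow> ('a \<Rightarrow> complex)) \<Rightarrow> real" where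
  "L1_onorm M T = (SUP f\<in>L1 M. L1_norm M (T f) / L1_norm M f)"

definition unitary_operator :: "'a measure \<Rightarrow> (('a \<Rightarrow> complex) \<Rightarrow> ('a \<Rightarrow> complex)) \<Rightarrow> bool" where
  "unitary_operator M W \<longleftrightarrow>
     linear_operator M (L2 M) W \<and>
     (\<forall>f\<in>L2 M. \<forall>g\<in>L2 M. L2_inner M (W f) (W g) = L2_inner M f g) \<and>
     (\<forall>g\<in>L2 M. \<exists>f\<in>L2 M. AE x in M. W f x = g x)"


section \<open>The operator determined by a measure on the square\<close>

text \<open>
  \<open>g\<close> is the image of \<open>f\<close> under the operator determined by the measure \<open>N\<close>. Integrability of
  $\varphi(x) f(a)$ is demanded explicitly because the integral of a non-integrable function is \<open>0\<close>.
\<close>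

definition measure_image ::
  "'a measure \<Rightarrow> ('a \<times> 'a) measure \<Rightarrow> ('a \<Rightarrow> complex) \<Rightarrow> ('a \<Rightarrow> complex) \<Rightarrow> bool" where
  "measure_image M N f g \<longleftrightarrow>
     g \<in> L1 M \<and>
     (\<forall>\<phi> :: 'a \<Rightarrow> complex. \<phi> \<in> borel_measurable M \<and> bounded (\<phi> ` space M) \<longrightarrow>
        integrable N (\<lambda>(x, a). \<phi> x * f a) \<and>
        (\<integral>x. \<phi> x * g x \<partial>M) = (\<integral>(x, a). \<phi> x * f a \<partial>N))"

definition determines_operator ::
  "'a measure \<Rightarrow> ('a \<times> 'a) measure \<Rightarrow> (('a \<Rightarrow> complex) \<Rightarrow> ('a \<Rightarrow> complex)) \<Rightarrow> bool" where
  "determines_operator M N T \<longleftrightarrow>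
     bounded_operator M (L1 M) (L1_norm M) T \<and>
     (\<forall>f\<in>L1 M. measure_image M N f (T f) \<and>
        (\<forall>g. measure_image M N f g \<longrightarrow> (AE x in M. g x = T f x)))"

definition nonneg_operator :: "'a measure \<Rightarrow> (('a \<Rightarrow> complex) \<Rightarrow> ('a \<Rightarrow> complex)) \<Rightarrow> bool" where
  "nonneg_operator M T \<longleftrightarrow>
     (\<forall>f\<in>L1 M. (AE x in M. f x \<in> \<real>\<^sub>\<ge>\<^sub>0) \<longrightarrow> (AE x in M. T f x \<in> \<real>\<^sub>\<ge>\<^sub>0))"

definition fixes_one :: "'a measure \<Rightarrow> (('a \<Rightarrow> complex) \<Rightarrow> ('a \<Rightarrow> complex)) \<Rightarrow> bool" where
  "fixes_one M T \<longleftrightarrow> (AE x in M. T (\<lambda>_. 1) x = 1)"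

definition preserves_integral :: "'a measure \<Rightarrow> (('a \<Rightarrow> complex) \<Rightarrow> ('a \<Rightarrow> complex)) \<Rightarrow> bool" where
  "preserves_integral M T \<longleftrightarrow> (\<forall>f\<in>L1 M. (\<integral>x. T f x \<partial>M) = (\<integral>x. f x \<partial>M))"


section \<open>Koopman operators\<close>

definition automorphisms :: "'a measure \<Rightarrow> ('a \<Rightarrow> 'a) set" where
  "automorphisms M =
     {F. bij_betw F (space M) (space M) \<and> F \<in> M \<rightarrow>\<^sub>M M \<and>
         the_inv_into (space M) F \<in> M \<rightarrow>\<^sub>M M \<and> distr M M F = M}"

definition koopman :: "('a \<Rightarrow> 'a) \<Rightarrow> ('a \<Rightarrow> complex) \<Rightarrow> ('a \<Rightarrow> complex)" where
  "koopman F f = f \<circ> F"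

text \<open>
  The measure with $\int \Phi\, d\mu_{U_F} = \int \Phi(F(a),a)\, d\mu(a)$, on the Borel sets of the
  product space; these may properly contain the product of the Borel $\sigma$-algebras.
\<close>

definition mu_koopman :: "'a::topological_space measure \<Rightarrow> ('a \<Rightarrow> 'a) \<Rightarrow> ('a \<times> 'a) measure" where
  "mu_koopman M F = distr M borel (\<lambda>a. (F a, a))"


section \<open>Operators on the cyclic group\<close>

text \<open>
  The residues modulo \<open>J\<close> are represented by \<open>{0..<int J}\<close>. The character \<open>chr_Z J j\<close>
  and hence the matrix entries of an operator depend on their integer indices only modulo \<open>J\<close>, so
  no reduction is written in expressions such as \<open>mat_Z J W (l + m) j\<close>.
\<close>

definition residues_Z :: "nat \<Rightarrow> int set" where
  "residues_Z J = {0..<int J}"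

definition measure_Z :: "nat \<Rightarrow> int measure" where
  "measure_Z J = uniform_count_measure (residues_Z J)"

definition chr_Z :: "nat \<Rightarrow> int \<Rightarrow> int \<Rightarrow> complex" where
  "chr_Z J j x = cis (2 * pi / real J) powi (j * x)"

text \<open>
  \<open>mat_Z J W k j\<close> is the \<open>k\<close>-th Fourier coefficient of the image of the \<open>j\<close>-th character.
\<close>

definition mat_Z :: "nat \<Rightarrow> ((int \<Rightarrow> complex) \<Rightarrow> (int \<Rightarrow> complex)) \<Rightarrow> int \<Rightarrow> int \<Rightarrow> complex" where
  "mat_Z J W k j = L2_inner (measure_Z J) (W (chr_Z J j)) (chr_Z J k)"

definition omega_Z :: "nat \<Rightarrow> ((int \<Rightarrow> complex) \<Rightarrow> (int \<Rightarrow> complex)) \<Rightarrow> int \<Rightarrow> int \<Rightarrow> complex" where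
  "omega_Z J W m n =
     1 / of_nat J * (\<Sum>j\<in>residues_Z J. \<Sum>l\<in>residues_Z J.
       mat_Z J W (l + m) j * cnj (mat_Z J W l (j + n)))"

definition nu_Z :: "nat \<Rightarrow> ((int \<Rightarrow> complex) \<Rightarrow> (int \<Rightarrow> complex)) \<Rightarrow> int \<Rightarrow> int \<Rightarrow> complex" where
  "nu_Z J W x a =
     (\<Sum>m\<in>residues_Z J. \<Sum>n\<in>residues_Z J. omega_Z J W m n * chr_Z J m x * chr_Z J n a)"

text \<open>
  The values of \<^const>\<open>nu_Z\<close> have to be shown to be nonnegative reals for this to be the measure
  with density \<^const>\<open>nu_Z\<close>: \<^const>\<open>Re\<close> and \<^const>\<open>ennreal\<close> discard everything else.
\<close>

definition mu_Z :: "nat \<Rightarrow> ((int \<Rightarrow> complex) \<Rightarrow> (int \<Rightarrow> complex)) \<Rightarrow> (int \<times> int) measure" where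
  "mu_Z J W = density (measure_Z J \<Otimes>\<^sub>M measure_Z J) (\<lambda>(x, a). ennreal (Re (nu_Z J W x a)))"

definition DT_norm_Z :: "nat \<Rightarrow> ((int \<Rightarrow> complex) \<Rightarrow> (int \<Rightarrow> complex)) \<Rightarrow> real" where
  "DT_norm_Z J W = (\<Sum>k\<in>residues_Z J. MAX j\<in>residues_Z J. cmod (mat_Z J W (k + j) j))"


section \<open>Regular operators on the circle\<close>

text \<open>
  As a measurable space, $\mathbb{R}/2\pi\mathbb{Z}$ is represented by the fundamental domain
  \<open>{0..<2 * pi}\<close> with its Borel sets; its topology is not used otherwise.
\<close>

definition measure_T :: "real measure" where
  "measure_T = scale_measure (ennreal (1 / (2 * pi))) (restrict_space lborel {0..<2 * pi})"

definition chr_T :: "int \<Rightarrow> real \<Rightarrow> complex" where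
  "chr_T k x = cis (of_int k * x)"

definition mat_T :: "((real \<Rightarrow> complex) \<Rightarrow> (real \<Rightarrow> complex)) \<Rightarrow> int \<Rightarrow> int \<Rightarrow> complex" where
  "mat_T W j k = L2_inner measure_T (W (chr_T k)) (chr_T j)"

definition diagonal_type :: "((real \<Rightarrow> complex) \<Rightarrow> (real \<Rightarrow> complex)) \<Rightarrow> bool" where
  "diagonal_type W \<longleftrightarrow>
     bounded_operator measure_T (L2 measure_T) (L2_norm measure_T) W \<and>
     (\<forall>k. bdd_above (range (\<lambda>j. cmod (mat_T W (j + k) j)))) \<and>
     (\<lambda>k. SUP j. cmod (mat_T W (j + k) j)) summable_on UNIV"

definition DT_norm_T :: "((real \<Rightarrow> complex) \<Rightarrow> (real \<Rightarrow> complex)) \<Rightarrow> real" where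
  "DT_norm_T W = (\<Sum>\<^sub>\<infinity>k. SUP j. cmod (mat_T W (j + k) j))"

text \<open>Convergence as the length of a finite interval tends to infinity, uniformly in its position.\<close>

definition long_intervals :: "int set filter" where
  "long_intervals = inf (filtercomap card at_top) (principal {I. \<exists>a b. I = {a..b}})"

definition omega_avg_T ::
  "((real \<Rightarrow> complex) \<Rightarrow> (real \<Rightarrow> complex)) \<Rightarrow> int \<Rightarrow> int \<Rightarrow> int set \<Rightarrow> complex" where
  "omega_avg_T W m n I =
     1 / of_nat (card I) * (\<Sum>\<^sub>\<infinity>(j, l)\<in>UNIV \<times> I. mat_T W (l + m) j * cnj (mat_T W l (j + n)))"

definition regular_operator :: "((real \<Rightarrow> complex) \<Rightarrow> (real \<Rightarrow> complex)) \<Rightarrow> bool" where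
  "regular_operator W \<longleftrightarrow>
     diagonal_type W \<and> (\<forall>m n. \<exists>w. (omega_avg_T W m n \<longlongrightarrow> w) long_intervals)"

definition omega_T :: "((real \<Rightarrow> complex) \<Rightarrow> (real \<Rightarrow> complex)) \<Rightarrow> int \<Rightarrow> int \<Rightarrow> complex" where
  "omega_T W m n = Lim long_intervals (omega_avg_T W m n)"

definition is_mu_T ::
  "((real \<Rightarrow> complex) \<Rightarrow> (real \<Rightarrow> complex)) \<Rightarrow> (real \<times> real) measure \<Rightarrow> bool" where
  "is_mu_T W N \<longleftrightarrow>
     sets N = sets (measure_T \<Otimes>\<^sub>M measure_T) \<and> finite_measure N \<and>
     (\<forall>m n. (\<integral>(x, a). cis (- (of_int m * x) - of_int n * a) \<partial>N) = omega_T W m n)"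

end

theory Submission
  imports Defs
begin

text \<open>
  In all three cases the operator is read off from the two marginals of the measure \<open>N\<close> on the
  square. If the second marginal is at most $C\mu$, then $\varphi(x) f(a)$ is \<open>N\<close>-integrable for $f$ in
  $L^1(\mu)$ and $\varphi$ bounded, and $\int |f(a)|\,dN \le C \|f\|_1$. If moreover the first marginal is
  absolutely continuous, then the measure $A \mapsto \int 1_A(x) f(a)\,dN$ has a Radon--Nikodym
  density with respect to $\mu$, and this density is the image of $f$. Nonnegativity and the norm
  bound \<open>C\<close> follow by testing against suitable $\varphi$. The image of the constant 1 is the density of the first
  marginal, and the integral of the image of $f$ is the integral of $f$ against the second one, so
  the operator fixes 1 as soon as the first marginal is $\mu$, and preserves integrals as soon as the
  second one is. The locale \<open>bounded_marginal\<close> contains this argument; what remains is to study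
  the marginals.

  For a Koopman operator both marginals are $\mu$.

  On the cyclic group $\nu(x,a)$ is a square, $\frac1J |\sum_{p,j} W_{p,j}\eta^{px-ja}|^2$, and the
  densities of the marginals are $\sum_n \omega_{0,n}\eta^{na}$ and $\sum_m \omega_{m,0}\eta^{mx}$. The sum
  of the $|\omega_{0,n}|$ is at most the square of the diagonal norm, because this norm bounds the sum of
  the absolute values in each row of the matrix. If \<open>W\<close> is unitary, then the rows and the columns of
  the matrix are orthonormal, and $\omega_{m,0}$ and $\omega_{0,n}$ are Kronecker deltas.

  On the circle, $|\omega_{m,n}| \le d(m+n)$, where $d$ is the autocorrelation of the suprema $c_k$ of the
  diagonals, and $\sum_s d(s) = (\sum_k c_k)^2$. Hence the Fourier coefficients of both marginals are
  absolutely summable with sum at most the square of the diagonal norm, so that the marginals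
  have bounded densities. In the unitary case the identity for the rows is immediate; the one for
  the columns follows because averages along a fixed diagonal do not depend, in the
  limit, on whether an interval of rows or of columns is used.

  The existence of the measure on the torus uses the same bound: for fixed \<open>x\<close> the series
  $h_x(n) = \sum_m \omega_{m,n}e^{imx}$ converges absolutely, and $h_x$ is positive definite, being a limit of
  averages of squares. A theorem of Herglotz, obtained here from Helly's selection theorem,
  gives a measure $\kappa_x$ on the circle with coefficients $h_x(n)$; it depends measurably on \<open>x\<close>
  because its Fourier coefficients do, and the required measure is $\kappa_x(da)\,\mu(dx)$.
\<close>


section \<open>Operators determined by a measure on the square\<close>

lemma borel_measurable_cnj [measurable (raw)]:
  "g \<in> borel_measurable M \<Longrightarrow> (\<lambda>x. cnj (g x)) \<in> borel_measurable M"
  by (rule measurable_compose[of g M borel cnj])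
     (assumption, intro borel_measurable_continuous_onI continuous_intros)

lemma borel_measurable_complex_of_real [measurable (raw)]:
  "g \<in> borel_measurable M \<Longrightarrow> (\<lambda>x. complex_of_real (g x)) \<in> borel_measurable M"
  by (rule measurable_compose[of g M borel complex_of_real])
     (assumption, intro borel_measurable_continuous_onI continuous_intros)

text \<open>
  The function $\overline{g}/|g|$, which is 0 where $g$ vanishes, is bounded and turns $g$ into $|g|$.
  Used as a test function, it controls the $L^1$ norm of $g$.
\<close>

lemma measurable_unit_phase:
  assumes [measurable]: "g \<in> borel_measurable M"
  shows "(\<lambda>x. cnj (g x) / complex_of_real (cmod (g x))) \<in> borel_measurable M"
  by measurable

lemma cmod_unit_phase: "cmod (cnj z / complex_of_real (cmod z)) \<le> 1"
  by (simp add: norm_divide)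

lemma unit_phase_mult: "cnj z / complex_of_real (cmod z) * z = complex_of_real (cmod z)"
  by (cases "z = 0") (auto simp: field_simps power2_eq_square simp flip: complex_norm_square)

text \<open>
  Test the difference of two images against its own phase.
\<close>

lemma measure_image_unique:
  assumes "measure_image M N f g" "measure_image M N f g'"
  shows "AE x in M. g x = g' x"
proof -
  have g: "integrable M g" "integrable M g'"
    using assms by (auto simp: measure_image_def L1_def)
  define d where "d x = g x - g' x" for x
  have d: "integrable M d" unfolding d_def using g by simp
  then have [measurable]: "d \<in> borel_measurable M" by simp
  define \<phi> where "\<phi> x = cnj (d x) / complex_of_real (cmod (d x))" for x
  have \<phi>: "\<phi> \<in> borel_measurable M" "bounded (\<phi> ` space M)"
    unfolding \<phi>_def using cmod_unit_phase
    by (auto intro!: boundedI[where B=1] measurable_unit_phase)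
  have int: "integrable M (\<lambda>x. \<phi> x * h x)" if "integrable M h" for h
  proof (rule Bochner_Integration.integrable_bound[OF that])
    show "(\<lambda>x. \<phi> x * h x) \<in> borel_measurable M" using \<phi>(1) that by auto
    show "AE x in M. norm (\<phi> x * h x) \<le> norm (h x)"
      unfolding \<phi>_def norm_mult by (intro AE_I2 mult_left_le_one_le cmod_unit_phase) auto
  qed
  have "(\<integral>x. \<phi> x * g x \<partial>M) = (\<integral>x. \<phi> x * g' x \<partial>M)"
    using assms \<phi> by (simp add: measure_image_def)
  then have "(\<integral>x. \<phi> x * d x \<partial>M) = 0"
    unfolding d_def right_diff_distrib using int[OF g(1)] int[OF g(2)] by simp
  then have "(\<integral>x. complex_of_real (cmod (d x)) \<partial>M) = 0"
    unfolding \<phi>_def unit_phase_mult .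
  then have "(\<integral>x. cmod (d x) \<partial>M) = 0" by simp
  then have "AE x in M. cmod (d x) = 0"
    using d by (subst (asm) integral_nonneg_eq_0_iff_AE) auto
  then show ?thesis by (simp add: d_def)
qed

text \<open>
  The measurable sets of \<open>N\<close> are constrained only through the two projections, so that \<open>N\<close> may
  live on a \<open>\<sigma>\<close>-algebra larger than the product, such as the Borel sets of a product of
  topological spaces.
\<close>

locale bounded_marginal = finite_measure M + N: finite_measure N
  for M :: "'a measure" and N :: "('a \<times> 'a) measure" +
  fixes C :: real
  assumes C_nonneg: "0 \<le> C"
    and fst_measurable [measurable]: "fst \<in> N \<rightarrow>\<^sub>M M"
    and snd_measurable [measurable]: "snd \<in> N \<rightarrow>\<^sub>M M"
    and snd_marginal_le: "distr N M snd \<le> scale_measure (ennreal C) M"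
begin

lemma nn_integral_snd_le:
  assumes [measurable]: "f \<in> borel_measurable M"
  shows "(\<integral>\<^sup>+p. f (snd p) \<partial>N) \<le> ennreal C * (\<integral>\<^sup>+a. f a \<partial>M)"
proof -
  have "(\<integral>\<^sup>+p. f (snd p) \<partial>N) = (\<integral>\<^sup>+a. f a \<partial>distr N M snd)"
    by (simp add: nn_integral_distr)
  also have "\<dots> \<le> (\<integral>\<^sup>+a. f a \<partial>scale_measure (ennreal C) M)"
    by (intro nn_integral_mono_measure snd_marginal_le) simp
  finally show ?thesis by (simp add: nn_integral_scale_measure)
qed

lemma integrable_snd:
  fixes f :: "'a \<Rightarrow> complex"
  assumes "f \<in> L1 M"
  shows "integrable N (\<lambda>p. f (snd p))"
proof -
  have f: "integrable M f" using assms by (simp add: L1_def)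
  then have [measurable]: "f \<in> borel_measurable M" by simp
  have "(\<integral>\<^sup>+p. ennreal (norm (f (snd p))) \<partial>N) \<le> ennreal C * (\<integral>\<^sup>+a. ennreal (norm (f a)) \<partial>M)"
    by (intro nn_integral_snd_le) simp
  also have "\<dots> < \<infinity>"
    using f by (auto simp: integrable_iff_bounded ennreal_mult_less_top)
  finally show ?thesis by (simp add: integrable_iff_bounded)
qed

lemma norm_integral_snd_le:
  assumes "f \<in> L1 M"
  shows "(\<integral>p. cmod (f (snd p)) \<partial>N) \<le> C * L1_norm M f"
proof -
  have f: "integrable M f" using assms by (simp add: L1_def)
  then have [measurable]: "f \<in> borel_measurable M" by simp
  have "ennreal (\<integral>p. cmod (f (snd p)) \<partial>N) = (\<integral>\<^sup>+p. ennreal (cmod (f (snd p))) \<partial>N)"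
    using integrable_snd[OF assms] by (intro nn_integral_eq_integral[symmetric]) auto
  also have "\<dots> \<le> ennreal C * (\<integral>\<^sup>+a. ennreal (norm (f a)) \<partial>M)"
    by (intro nn_integral_snd_le) simp
  also have "(\<integral>\<^sup>+a. ennreal (norm (f a)) \<partial>M) = ennreal (L1_norm M f)"
    unfolding L1_norm_def using f by (intro nn_integral_eq_integral) auto
  also have "ennreal C * ennreal (L1_norm M f) = ennreal (C * L1_norm M f)"
    using C_nonneg by (simp add: ennreal_mult L1_norm_def)
  finally show ?thesis
    using C_nonneg by (subst (asm) ennreal_le_iff) (auto simp: L1_norm_def)
qed

lemma AE_snd:
  assumes "AE a in M. P a"
  shows "AE p in N. P (snd p)"
proof -
  obtain A where A: "{a \<in> space M. \<not> P a} \<subseteq> A" "emeasure M A = 0" "A \<in> sets M"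
    using AE_E[OF assms] by blast
  have "(\<integral>\<^sup>+p. indicator A (snd p) \<partial>N) \<le> ennreal C * (\<integral>\<^sup>+a. indicator A a \<partial>M)"
    using A by (intro nn_integral_snd_le) simp
  then have "(\<integral>\<^sup>+p. indicator A (snd p) \<partial>N) = 0" using A by simp
  moreover have [measurable]: "A \<in> sets M" by fact
  ultimately have "AE p in N. (indicator A (snd p)::ennreal) = 0"
    by (subst (asm) nn_integral_0_iff_AE) auto
  then show ?thesis
    using AE_space
  proof eventually_elim
    case (elim p)
    then have "snd p \<in> space M" using measurable_space[OF snd_measurable] by blast
    then show ?case using elim A by (auto simp: indicator_def split: if_splits)
  qed
qed

lemma integrable_test_product:
  fixes \<phi> f :: "'a \<Rightarrow> complex"
  assumes f: "f \<in> L1 M" and [measurable]: "\<phi> \<in> borel_measurable M" and "bounded (\<phi> ` space M)"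
  shows "integrable N (\<lambda>(x, a). \<phi> x * f a)"
proof -
  obtain B where B: "\<And>x. x \<in> space M \<Longrightarrow> cmod (\<phi> x) \<le> B"
    using assms(3) by (auto simp: bounded_iff)
  have [measurable]: "f \<in> borel_measurable M" using f by (simp add: L1_def)
  show ?thesis
    unfolding case_prod_beta
  proof (rule Bochner_Integration.integrable_bound)
    show "integrable N (\<lambda>p. B *\<^sub>R f (snd p))" using integrable_snd[OF f] by simp
    show "AE p in N. norm (\<phi> (fst p) * f (snd p)) \<le> norm (B *\<^sub>R f (snd p))"
    proof (rule AE_I2)
      fix p assume "p \<in> space N"
      then have "cmod (\<phi> (fst p)) \<le> B"
        using measurable_space[OF fst_measurable] B by blast
      then show "norm (\<phi> (fst p) * f (snd p)) \<le> norm (B *\<^sub>R f (snd p))"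
        by (auto simp: norm_mult intro!: mult_right_mono)
    qed
  qed measurable
qed

text \<open>
  Testing against the phase of $g$ gives $\|g\|_1 \le \int |f(a)|\,dN$, which the marginal bound controls.
\<close>

lemma measure_image_norm_le:
  assumes f: "f \<in> L1 M" and im: "measure_image M N f g"
  shows "L1_norm M g \<le> C * L1_norm M f"
proof -
  have g: "integrable M g" using im by (auto simp: measure_image_def L1_def)
  then have [measurable]: "g \<in> borel_measurable M" by simp
  have [measurable]: "f \<in> borel_measurable M" using f by (simp add: L1_def)
  define \<phi> where "\<phi> x = cnj (g x) / complex_of_real (cmod (g x))" for x
  have \<phi>: "\<phi> \<in> borel_measurable M" "bounded (\<phi> ` space M)"
    unfolding \<phi>_def using cmod_unit_phase
    by (auto intro!: boundedI[where B=1] measurable_unit_phase)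
  have "complex_of_real (L1_norm M g) = (\<integral>x. \<phi> x * g x \<partial>M)"
    unfolding \<phi>_def unit_phase_mult by (simp add: L1_norm_def)
  also have "\<dots> = (\<integral>(x, a). \<phi> x * f a \<partial>N)"
    using im \<phi> by (simp add: measure_image_def)
  finally have eq: "complex_of_real (L1_norm M g) = (\<integral>(x, a). \<phi> x * f a \<partial>N)" .
  have "L1_norm M g = cmod (complex_of_real (L1_norm M g))" by (simp add: L1_norm_def)
  also have "\<dots> = cmod (\<integral>(x, a). \<phi> x * f a \<partial>N)" by (simp only: eq)
  also have "\<dots> \<le> (\<integral>p. cmod (case p of (x, a) \<Rightarrow> \<phi> x * f a) \<partial>N)"
    by (rule integral_norm_bound)
  also have "\<dots> \<le> (\<integral>p. cmod (f (snd p)) \<partial>N)"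
  proof (rule integral_mono)
    show "cmod (case p of (x, a) \<Rightarrow> \<phi> x * f a) \<le> cmod (f (snd p))" for p
      unfolding \<phi>_def case_prod_beta norm_mult
      by (intro mult_left_le_one_le cmod_unit_phase) auto
  qed (use integrable_test_product[OF f \<phi>] integrable_snd[OF f] in auto)
  also have "\<dots> \<le> C * L1_norm M f" by (rule norm_integral_snd_le[OF f])
  finally show ?thesis .
qed

text \<open>
  The integral of $g$ over every measurable set is a nonnegative real. The sets on which the real
  part of $g$ is negative, or its imaginary part is not 0, are therefore null.
\<close>

lemma measure_image_nonneg:
  assumes f: "f \<in> L1 M" and im: "measure_image M N f g" and nonneg: "AE a in M. f a \<in> \<real>\<^sub>\<ge>\<^sub>0"
  shows "AE x in M. g x \<in> \<real>\<^sub>\<ge>\<^sub>0"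
proof -
  have g: "integrable M g" using im by (auto simp: measure_image_def L1_def)
  then have [measurable]: "g \<in> borel_measurable M" by simp
  have test: "(\<integral>x. indicator A x * g x \<partial>M) \<in> \<real>\<^sub>\<ge>\<^sub>0" if A: "A \<in> sets M" for A
  proof -
    have \<phi>: "(\<lambda>x. indicator A x :: complex) \<in> borel_measurable M"
      "bounded ((\<lambda>x. indicator A x :: complex) ` space M)"
      using A by (auto intro!: boundedI[where B=1] simp: indicator_def)
    have ae: "AE p in N. (case p of (x, a) \<Rightarrow> indicator A x * f a) \<in> \<real>\<^sub>\<ge>\<^sub>0"
      using AE_snd[OF nonneg] by eventually_elim (auto simp: indicator_def)
    have int: "integrable N (\<lambda>(x, a). indicator A x * f a)"
      by (rule integrable_test_product[OF f \<phi>])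
    have "(\<integral>(x, a). indicator A x * f a \<partial>N) \<in> \<real>\<^sub>\<ge>\<^sub>0"
      unfolding complex_nonneg_Reals_iff
    proof
      show "0 \<le> Re (\<integral>(x, a). indicator A x * f a \<partial>N)"
        unfolding integral_Re[OF int, symmetric]
        by (rule integral_nonneg_AE) (use ae in \<open>auto simp: complex_nonneg_Reals_iff\<close>)
      have "(\<integral>p. Im (case p of (x, a) \<Rightarrow> indicator A x * f a) \<partial>N) = (\<integral>p. 0 \<partial>N)"
        by (rule integral_cong_AE)
           (use ae int in \<open>auto simp: complex_nonneg_Reals_iff\<close>)
      then show "Im (\<integral>(x, a). indicator A x * f a \<partial>N) = 0"
        unfolding integral_Im[OF int, symmetric] by simp
    qed
    moreover have "(\<integral>x. indicator A x * g x \<partial>M) = (\<integral>(x, a). indicator A x * f a \<partial>N)"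
      using im \<phi> unfolding measure_image_def by blast
    ultimately show ?thesis by simp
  qed
  have int: "integrable M (\<lambda>x. indicator A x * g x)" if [measurable]: "A \<in> sets M" for A
    by (rule Bochner_Integration.integrable_bound[OF g]) (auto simp: indicator_def)
  have zero: "AE x in M. h x \<le> 0"
    if h: "integrable M h" and le: "(\<integral>x. indicator {x \<in> space M. h x > 0} x * h x \<partial>M) \<le> 0"
    for h :: "'a \<Rightarrow> real"
  proof -
    have [measurable]: "h \<in> borel_measurable M" using h by simp
    let ?k = "\<lambda>x. indicator {x \<in> space M. h x > 0} x * h x"
    have k: "integrable M ?k"
      by (rule Bochner_Integration.integrable_bound[OF h]) (auto simp: indicator_def)
    have "0 \<le> (\<integral>x. ?k x \<partial>M)" by (rule integral_nonneg_AE) (auto simp: indicator_def)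
    then have "(\<integral>x. ?k x \<partial>M) = 0" using le by simp
    then have "AE x in M. ?k x = 0"
      by (subst (asm) integral_nonneg_eq_0_iff_AE[OF k]) (auto simp: indicator_def)
    then show ?thesis using AE_space by eventually_elim (auto simp: indicator_def split: if_splits)
  qed
  have Re_of_int: "Re (\<integral>x. indicator A x * g x \<partial>M) = (\<integral>x. indicator A x * Re (g x) \<partial>M)"
    "Im (\<integral>x. indicator A x * g x \<partial>M) = (\<integral>x. indicator A x * Im (g x) \<partial>M)"
    if "A \<in> sets M" for A
    unfolding integral_Re[OF int[OF that], symmetric] integral_Im[OF int[OF that], symmetric]
    by (auto simp: indicator_def intro!: Bochner_Integration.integral_cong)
  have "AE x in M. - Re (g x) \<le> 0"
    by (rule zero)
       (use g test[of "{x \<in> space M. - Re (g x) > 0}"] in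
         \<open>auto simp: complex_nonneg_Reals_iff Re_of_int\<close>)
  moreover have "AE x in M. Im (g x) \<le> 0"
    by (rule zero)
       (use g test[of "{x \<in> space M. Im (g x) > 0}"] in
         \<open>auto simp: complex_nonneg_Reals_iff Re_of_int\<close>)
  moreover have "AE x in M. - Im (g x) \<le> 0"
    by (rule zero)
       (use g test[of "{x \<in> space M. - Im (g x) > 0}"] in
         \<open>auto simp: complex_nonneg_Reals_iff Re_of_int\<close>)
  ultimately show ?thesis by eventually_elim (auto simp: complex_nonneg_Reals_iff)
qed

lemma measure_image_add:
  assumes f: "f \<in> L1 M" "f' \<in> L1 M" and im: "measure_image M N f g" "measure_image M N f' g'"
  shows "measure_image M N (\<lambda>a. f a + f' a) (\<lambda>x. g x + g' x)"
  unfolding measure_image_def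
proof (intro conjI allI impI)
  have g: "integrable M g" "integrable M g'" using im by (auto simp: measure_image_def L1_def)
  then show "(\<lambda>x. g x + g' x) \<in> L1 M" by (auto simp: L1_def)
  fix \<phi> :: "'a \<Rightarrow> complex" assume \<phi>: "\<phi> \<in> borel_measurable M \<and> bounded (\<phi> ` space M)"
  then obtain B where B: "\<And>x. x \<in> space M \<Longrightarrow> cmod (\<phi> x) \<le> B" by (auto simp: bounded_iff)
  have int: "integrable M (\<lambda>x. \<phi> x * h x)" if h: "integrable M h" for h
  proof (rule Bochner_Integration.integrable_bound)
    show "integrable M (\<lambda>x. B *\<^sub>R h x)" using h by simp
    show "(\<lambda>x. \<phi> x * h x) \<in> borel_measurable M" using \<phi> h by auto
    show "AE x in M. norm (\<phi> x * h x) \<le> norm (B *\<^sub>R h x)"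
      using B by (intro AE_I2) (auto simp: norm_mult intro!: mult_right_mono order.trans[OF _ abs_ge_self])
  qed
  have i: "integrable N (\<lambda>(x, a). \<phi> x * f a)" "integrable N (\<lambda>(x, a). \<phi> x * f' a)"
    using \<phi> by (intro integrable_test_product f; auto)+
  have eq: "(\<lambda>(x, a). \<phi> x * (f a + f' a)) =
      (\<lambda>p. (case p of (x, a) \<Rightarrow> \<phi> x * f a) + (case p of (x, a) \<Rightarrow> \<phi> x * f' a))"
    by (auto simp: algebra_simps)
  show "integrable N (\<lambda>(x, a). \<phi> x * (f a + f' a))" unfolding eq using i by simp
  have "(\<integral>x. \<phi> x * (g x + g' x) \<partial>M) = (\<integral>x. \<phi> x * g x \<partial>M) + (\<integral>x. \<phi> x * g' x \<partial>M)"
    using int g by (simp add: distrib_left)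
  also have "\<dots> = (\<integral>(x, a). \<phi> x * f a \<partial>N) + (\<integral>(x, a). \<phi> x * f' a \<partial>N)"
    using im \<phi> by (simp add: measure_image_def)
  finally show "(\<integral>x. \<phi> x * (g x + g' x) \<partial>M) = (\<integral>(x, a). \<phi> x * (f a + f' a) \<partial>N)"
    unfolding eq using i by simp
qed

lemma measure_image_scale:
  assumes im: "measure_image M N f g"
  shows "measure_image M N (\<lambda>a. c * f a) (\<lambda>x. c * g x)"
  unfolding measure_image_def
proof (intro conjI allI impI)
  show "(\<lambda>x. c * g x) \<in> L1 M" using im by (auto simp: measure_image_def L1_def)
  fix \<phi> :: "'a \<Rightarrow> complex" assume \<phi>: "\<phi> \<in> borel_measurable M \<and> bounded (\<phi> ` space M)"
  have eq: "(\<lambda>(x, a). \<phi> x * (c * f a)) = (\<lambda>p. c * (case p of (x, a) \<Rightarrow> \<phi> x * f a))"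
    by (auto simp: algebra_simps)
  have eq': "(\<lambda>x. \<phi> x * (c * g x)) = (\<lambda>x. c * (\<phi> x * g x))" by (auto simp: algebra_simps)
  show "integrable N (\<lambda>(x, a). \<phi> x * (c * f a))"
    unfolding eq using im \<phi> by (auto simp: measure_image_def)
  show "(\<integral>x. \<phi> x * (c * g x) \<partial>M) = (\<integral>(x, a). \<phi> x * (c * f a) \<partial>N)"
    unfolding eq eq' using im \<phi> by (simp add: measure_image_def)
qed

lemma measure_image_cong:
  assumes f: "f \<in> L1 M" and f': "f' \<in> L1 M" and ae: "AE a in M. f a = f' a"
    and im: "measure_image M N f g"
  shows "measure_image M N f' g"
  unfolding measure_image_def
proof (intro conjI allI impI)
  show "g \<in> L1 M" using im by (simp add: measure_image_def)
  fix \<phi> :: "'a \<Rightarrow> complex" assume \<phi>: "\<phi> \<in> borel_measurable M \<and> bounded (\<phi> ` space M)"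
  then show i: "integrable N (\<lambda>(x, a). \<phi> x * f' a)" by (intro integrable_test_product f') auto
  have "(\<integral>(x, a). \<phi> x * f a \<partial>N) = (\<integral>(x, a). \<phi> x * f' a \<partial>N)"
  proof (rule integral_cong_AE)
    show "AE p in N. (case p of (x, a) \<Rightarrow> \<phi> x * f a) = (case p of (x, a) \<Rightarrow> \<phi> x * f' a)"
      using AE_snd[OF ae] by eventually_elim auto
  qed (use im \<phi> i in \<open>auto simp: measure_image_def\<close>)
  then show "(\<integral>x. \<phi> x * g x \<partial>M) = (\<integral>(x, a). \<phi> x * f' a \<partial>N)"
    using im \<phi> by (simp add: measure_image_def)
qed

text \<open>
  An arbitrary choice of images is automatically linear and well defined up to null sets, since
  images are unique.
\<close>

lemma determines_operatorI:
  assumes im: "\<And>f. f \<in> L1 M \<Longrightarrow> measure_image M N f (T f)"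
  shows "determines_operator M N T" "nonneg_operator M T" "L1_onorm M T \<le> C"
proof -
  have le: "L1_norm M (T f) \<le> C * L1_norm M f" if "f \<in> L1 M" for f
    by (rule measure_image_norm_le[OF that im[OF that]])
  have uniq: "AE x in M. g x = T f x" if "f \<in> L1 M" "measure_image M N f g" for f g
    by (rule measure_image_unique[OF that(2) im[OF that(1)]])
  have "linear_operator M (L1 M) T"
    unfolding linear_operator_def
  proof (intro conjI ballI allI impI)
    fix f assume "f \<in> L1 M"
    then show "T f \<in> L1 M" using im by (auto simp: measure_image_def)
  next
    fix f g assume "f \<in> L1 M" "g \<in> L1 M" "AE x in M. f x = g x"
    then show "AE x in M. T f x = T g x"
      by (intro uniq measure_image_cong[of f g] im)
  next
    fix f g assume fg: "f \<in> L1 M" "g \<in> L1 M"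
    then have "(\<lambda>y. f y + g y) \<in> L1 M" by (auto simp: L1_def)
    then have "AE x in M. T f x + T g x = T (\<lambda>y. f y + g y) x"
      by (intro uniq measure_image_add fg im)
    then show "AE x in M. T (\<lambda>y. f y + g y) x = T f x + T g x" by eventually_elim (rule sym)
  next
    fix c f assume f: "f \<in> L1 M"
    then have "(\<lambda>y. c * f y) \<in> L1 M" by (auto simp: L1_def)
    then have "AE x in M. c * T f x = T (\<lambda>y. c * f y) x"
      by (intro uniq measure_image_scale f im)
    then show "AE x in M. T (\<lambda>y. c * f y) x = c * T f x" by eventually_elim (rule sym)
  qed
  then show "determines_operator M N T"
    unfolding determines_operator_def bounded_operator_def
    by (intro conjI ballI allI impI exI[of _ C]) (assumption, erule le, erule im, erule (1) uniq)
  show "nonneg_operator M T"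
    unfolding nonneg_operator_def
    by (intro ballI impI) (rule measure_image_nonneg[OF _ im])
  show "L1_onorm M T \<le> C"
    unfolding L1_onorm_def
  proof (rule cSUP_least)
    have "(\<lambda>_. 0) \<in> L1 M" by (simp add: L1_def)
    then show "L1 M \<noteq> {}" by blast
    fix f assume f: "f \<in> L1 M"
    show "L1_norm M (T f) / L1_norm M f \<le> C"
    proof (cases "L1_norm M f = 0")
      case False
      moreover have "0 \<le> L1_norm M f" by (simp add: L1_norm_def)
      ultimately have "0 < L1_norm M f" by linarith
      then show ?thesis using le[OF f] by (simp add: pos_divide_le_eq)
    qed (simp add: C_nonneg)
  qed
qed

lemma fixes_oneI:
  assumes T: "\<And>f. f \<in> L1 M \<Longrightarrow> measure_image M N f (T f)" and marg: "distr N M fst = M"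
  shows "fixes_one M T"
proof -
  have one: "(\<lambda>_. 1) \<in> L1 M" by (simp add: L1_def)
  have "measure_image M N (\<lambda>_. 1) (\<lambda>_. 1)"
    unfolding measure_image_def
  proof (intro conjI allI impI one)
    fix \<phi> :: "'a \<Rightarrow> complex" assume \<phi>: "\<phi> \<in> borel_measurable M \<and> bounded (\<phi> ` space M)"
    then show "integrable N (\<lambda>(x, a). \<phi> x * 1)"
      by (intro integrable_test_product[OF one]) auto
    have "(\<integral>x. \<phi> x \<partial>distr N M fst) = (\<integral>p. \<phi> (fst p) \<partial>N)"
      using \<phi> by (intro integral_distr) auto
    then show "(\<integral>x. \<phi> x * 1 \<partial>M) = (\<integral>(x, a). \<phi> x * 1 \<partial>N)"
      unfolding marg by (simp add: case_prod_unfold)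
  qed
  then show ?thesis
    unfolding fixes_one_def by (rule measure_image_unique[OF T[OF one]])
qed

lemma preserves_integralI:
  assumes T: "\<And>f. f \<in> L1 M \<Longrightarrow> measure_image M N f (T f)" and marg: "distr N M snd = M"
  shows "preserves_integral M T"
  unfolding preserves_integral_def
proof
  fix f assume f: "f \<in> L1 M"
  have "(\<integral>x. 1 * T f x \<partial>M) = (\<integral>(x, a). 1 * f a \<partial>N)"
    using T[OF f] unfolding measure_image_def
    by (elim conjE allE[of _ "\<lambda>_. 1"]) (auto intro: boundedI[where B=1])
  also have "\<dots> = (\<integral>a. f a \<partial>distr N M snd)"
    using f by (subst integral_distr) (auto simp: L1_def case_prod_unfold)
  finally show "(\<integral>x. T f x \<partial>M) = (\<integral>x. f x \<partial>M)" by (simp add: marg)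
qed

text \<open>
  The image of a nonnegative function is the density of the first marginal of $f(a)\,dN(x,a)$.
\<close>

lemma measure_image_exists_nonneg:
  fixes f :: "'a \<Rightarrow> real"
  assumes f: "integrable M f" and nonneg: "\<And>a. 0 \<le> f a"
    and ac: "absolutely_continuous M (distr N M fst)"
  shows "\<exists>g. measure_image M N (\<lambda>a. complex_of_real (f a)) g"
proof -
  have [measurable]: "f \<in> borel_measurable M" using f by simp
  have fL1: "(\<lambda>a. complex_of_real (f a)) \<in> L1 M" using f by (simp add: L1_def)
  define D where "D = distr (density N (\<lambda>p. ennreal (f (snd p)))) M fst"
  have fst_D [measurable]: "fst \<in> density N (\<lambda>p. ennreal (f (snd p))) \<rightarrow>\<^sub>M M" by simp
  have [simp, measurable_cong]: "sets D = sets M" by (simp add: D_def)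
  have "absolutely_continuous M D"
    unfolding absolutely_continuous_def
  proof
    fix A assume A: "A \<in> null_sets M"
    then have "A \<in> null_sets (distr N M fst)" using ac by (auto simp: absolutely_continuous_def)
    then have "fst -` A \<inter> space N \<in> null_sets N"
      using A by (auto simp: null_sets_def emeasure_distr)
    then have ae: "AE p in N. p \<notin> fst -` A \<inter> space N" by (rule AE_not_in)
    have "emeasure D A = (\<integral>\<^sup>+p. ennreal (f (snd p)) * indicator (fst -` A \<inter> space N) p \<partial>N)"
      unfolding D_def using A
      by (subst emeasure_distr) (auto simp: emeasure_density null_sets_def)
    also have "\<dots> = (\<integral>\<^sup>+p. 0 \<partial>N)"
      using ae by (intro nn_integral_cong_AE) (auto simp: indicator_def)
    finally show "A \<in> null_sets D" using A by (auto simp: null_sets_def)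
  qed
  then obtain h where [measurable]: "h \<in> borel_measurable M" and h: "density M h = D"
    using Radon_Nikodym[of D] by auto
  have "(\<integral>\<^sup>+x. h x \<partial>M) = (\<integral>\<^sup>+x. 1 \<partial>density M h)"
    by (subst nn_integral_density) auto
  also have "\<dots> = (\<integral>\<^sup>+p. ennreal (f (snd p)) \<partial>N)"
    unfolding h D_def
    by (subst nn_integral_distr; (subst nn_integral_density)?) auto
  also have "\<dots> < \<infinity>"
    using integrable_snd[OF fL1] nonneg by (simp add: integrable_iff_bounded)
  finally have hlt: "(\<integral>\<^sup>+x. h x \<partial>M) < \<infinity>" .
  then have hfin: "AE x in M. h x \<noteq> \<infinity>" by (intro nn_integral_noteq_infinite) auto
  define g where "g x = enn2real (h x)" for x
  have [measurable]: "g \<in> borel_measurable M" unfolding g_def by simp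
  have g0: "0 \<le> g x" for x by (simp add: g_def)
  have gh: "AE x in M. ennreal (g x) = h x"
    using hfin by eventually_elim (auto simp: g_def less_top)
  from gh have gD: "density M (\<lambda>x. ennreal (g x)) = D"
    unfolding h[symmetric] by (intro density_cong) auto
  have "(\<integral>\<^sup>+x. ennreal (norm (g x)) \<partial>M) = (\<integral>\<^sup>+x. h x \<partial>M)"
    using gh g0 by (intro nn_integral_cong_AE) simp
  with hlt have gint: "integrable M g" by (simp add: integrable_iff_bounded)
  have "measure_image M N (\<lambda>a. complex_of_real (f a)) (\<lambda>x. complex_of_real (g x))"
    unfolding measure_image_def
  proof (intro conjI allI impI)
    show "(\<lambda>x. complex_of_real (g x)) \<in> L1 M" using gint by (simp add: L1_def)
    fix \<phi> :: "'a \<Rightarrow> complex" assume \<phi>: "\<phi> \<in> borel_measurable M \<and> bounded (\<phi> ` space M)"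
    then have [measurable]: "\<phi> \<in> borel_measurable M" by simp
    show "integrable N (\<lambda>(x, a). \<phi> x * complex_of_real (f a))"
      using \<phi> by (intro integrable_test_product fL1) auto
    have "(\<integral>x. \<phi> x * complex_of_real (g x) \<partial>M) = (\<integral>x. g x *\<^sub>R \<phi> x \<partial>M)"
      by (simp add: scaleR_conv_of_real mult.commute)
    also have "\<dots> = (\<integral>x. \<phi> x \<partial>D)"
      unfolding gD[symmetric] using g0 by (subst integral_density) auto
    also have "\<dots> = (\<integral>p. f (snd p) *\<^sub>R \<phi> (fst p) \<partial>N)"
      unfolding D_def using nonneg by (subst integral_distr) (auto simp: integral_density)
    finally show "(\<integral>x. \<phi> x * complex_of_real (g x) \<partial>M) =
        (\<integral>(x, a). \<phi> x * complex_of_real (f a) \<partial>N)"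
      by (simp add: scaleR_conv_of_real mult.commute case_prod_unfold)
  qed
  then show ?thesis by blast
qed

text \<open>
  The positive and negative parts of the real and imaginary parts reduce this to nonnegative functions.
\<close>

lemma measure_image_exists:
  assumes f: "f \<in> L1 M" and ac: "absolutely_continuous M (distr N M fst)"
  shows "\<exists>g. measure_image M N f g"
proof -
  have int: "integrable M f" using f by (simp add: L1_def)
  have ex: "\<exists>g. measure_image M N (\<lambda>a. complex_of_real (h a)) g" if "integrable M h" for h
  proof -
    have pos: "integrable M (\<lambda>a. max 0 (h a))" "integrable M (\<lambda>a. max 0 (- h a))"
      using that by auto
    obtain g g' where
      g: "measure_image M N (\<lambda>a. complex_of_real (max 0 (h a))) g" and
      g': "measure_image M N (\<lambda>a. complex_of_real (max 0 (- h a))) g'"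
      using measure_image_exists_nonneg[OF pos(1) _ ac] measure_image_exists_nonneg[OF pos(2) _ ac]
      by auto
    have "measure_image M N
        (\<lambda>a. complex_of_real (max 0 (h a)) + (- 1) * complex_of_real (max 0 (- h a)))
        (\<lambda>x. g x + (- 1) * g' x)"
      using pos by (intro measure_image_add measure_image_scale g g') (auto simp: L1_def)
    moreover have "(\<lambda>a. complex_of_real (max 0 (h a)) + (- 1) * complex_of_real (max 0 (- h a))) =
        (\<lambda>a. complex_of_real (h a))"
      by (auto simp: max_def)
    ultimately show ?thesis by auto
  qed
  have i: "integrable M (\<lambda>a. Re (f a))" "integrable M (\<lambda>a. Im (f a))" using int by auto
  obtain g g' where
    g: "measure_image M N (\<lambda>a. complex_of_real (Re (f a))) g" and
    g': "measure_image M N (\<lambda>a. complex_of_real (Im (f a))) g'"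
    using ex[OF i(1)] ex[OF i(2)] by auto
  have "measure_image M N (\<lambda>a. complex_of_real (Re (f a)) + \<i> * complex_of_real (Im (f a)))
      (\<lambda>x. g x + \<i> * g' x)"
    using i by (intro measure_image_add measure_image_scale g g') (auto simp: L1_def)
  moreover have "(\<lambda>a. complex_of_real (Re (f a)) + \<i> * complex_of_real (Im (f a))) = f"
    by (auto simp: complex_eq[symmetric])
  ultimately show ?thesis by auto
qed

theorem exists_operator:
  assumes ac: "absolutely_continuous M (distr N M fst)"
  shows "\<exists>T. determines_operator M N T \<and> L1_onorm M T \<le> C \<and> nonneg_operator M T \<and>
    (distr N M fst = M \<longrightarrow> fixes_one M T) \<and> (distr N M snd = M \<longrightarrow> preserves_integral M T)"
proof -
  have "\<exists>T. \<forall>f\<in>L1 M. measure_image M N f (T f)"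
    using measure_image_exists[OF _ ac] by (intro bchoice) blast
  then obtain T where "\<And>f. f \<in> L1 M \<Longrightarrow> measure_image M N f (T f)" by blast
  note T = this
  show ?thesis
    by (intro exI[of _ T] conjI impI determines_operatorI[OF T] fixes_oneI[OF T]
        preserves_integralI[OF T])
qed

end


section \<open>Koopman operators\<close>

text \<open>
  The measure is the image of $\mu$ under $a \mapsto (F(a),a)$, which is Borel measurable by continuity.
  Its marginals are the images of $\mu$ under \<open>F\<close> and under the identity, hence both equal to $\mu$.
\<close>

lemma
  assumes "prob_space (M::'a::topological_space measure)" and sets: "sets M = sets borel"
    and F: "F \<in> automorphisms M" and cont: "continuous_on UNIV F"
  shows unitary_operator_koopman: "unitary_operator M (koopman F)"
    and bounded_marginal_koopman: "bounded_marginal M (mu_koopman M F) 1"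
    and distr_fst_koopman: "distr (mu_koopman M F) M fst = M"
    and distr_snd_koopman: "distr (mu_koopman M F) M snd = M"
proof -
  interpret prob_space M by fact
  have sp: "space M = UNIV" using sets_eq_imp_space_eq[OF sets] by simp
  have [measurable]: "F \<in> M \<rightarrow>\<^sub>M M" and bij: "bij_betw F (space M) (space M)"
    and inv [measurable]: "the_inv_into (space M) F \<in> M \<rightarrow>\<^sub>M M" and dF: "distr M M F = M"
    using F by (auto simp: automorphisms_def)
  have AEF: "AE x in M. P (F x)" if "AE x in M. P x" for P
  proof -
    have "AE x in distr M M F. P x" using that unfolding dF .
    then show ?thesis by (rule AE_distrD[rotated]) simp
  qed
  have intF: "integrable M (\<lambda>x. f (F x)) = integrable M f" if "f \<in> borel_measurable M"
    for f :: "'a \<Rightarrow> 'c::{banach, second_countable_topology}"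
    using integrable_distr_eq[of F M M f] that by (simp add: dF)
  have integralF: "(\<integral>x. f (F x) \<partial>M) = (\<integral>x. f x \<partial>M)" if "f \<in> borel_measurable M"
    for f :: "'a \<Rightarrow> complex"
    using integral_distr[of F M M f] that by (simp add: dF)
  show "unitary_operator M (koopman F)"
    unfolding unitary_operator_def linear_operator_def
  proof (intro conjI ballI allI impI)
    fix f assume f: "f \<in> L2 M"
    then have [measurable]: "f \<in> borel_measurable M" by (simp add: L2_def)
    show "koopman F f \<in> L2 M"
      using f intF[of "\<lambda>x. (cmod (f x))\<^sup>2"] by (auto simp: L2_def koopman_def o_def)
  next
    fix f g :: "'a \<Rightarrow> complex" assume "AE x in M. f x = g x"
    then show "AE x in M. koopman F f x = koopman F g x"
      unfolding koopman_def o_def by (rule AEF)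
  next
    fix f g assume "f \<in> L2 M" "g \<in> L2 M"
    then have [measurable]: "f \<in> borel_measurable M" "g \<in> borel_measurable M"
      by (auto simp: L2_def)
    show "L2_inner M (koopman F f) (koopman F g) = L2_inner M f g"
      unfolding L2_inner_def koopman_def o_def by (rule integralF) simp
  next
    fix g assume g: "g \<in> L2 M"
    then have [measurable]: "g \<in> borel_measurable M" by (simp add: L2_def)
    define f where "f x = g (the_inv_into (space M) F x)" for x
    have [measurable]: "f \<in> borel_measurable M" unfolding f_def by simp
    have fF: "f (F x) = g x" for x
      using bij by (simp add: f_def sp bij_betw_def the_inv_into_f_f)
    have "f \<in> L2 M"
      using g intF[of "\<lambda>x. (cmod (f x))\<^sup>2"] by (simp add: L2_def fF)
    then show "\<exists>f\<in>L2 M. AE x in M. koopman F f x = g x"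
      by (intro bexI[of _ f]) (simp_all add: koopman_def fF)
  qed (simp_all add: koopman_def)
  have graph [measurable]: "(\<lambda>a. (F a, a)) \<in> M \<rightarrow>\<^sub>M borel"
    using cont by (subst measurable_cong_sets[OF sets refl])
      (intro borel_measurable_continuous_onI continuous_intros)
  have f: "fst \<in> (borel :: ('a \<times> 'a) measure) \<rightarrow>\<^sub>M M"
    and s: "snd \<in> (borel :: ('a \<times> 'a) measure) \<rightarrow>\<^sub>M M"
    by (subst measurable_cong_sets[OF refl sets], 
        intro borel_measurable_continuous_onI continuous_intros)+
  have f': "fst \<in> mu_koopman M F \<rightarrow>\<^sub>M M" and s': "snd \<in> mu_koopman M F \<rightarrow>\<^sub>M M"
    using f s by (auto simp: mu_koopman_def)
  show mf: "distr (mu_koopman M F) M fst = M"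
    unfolding mu_koopman_def by (subst distr_distr[OF f graph]) (simp add: o_def dF)
  show ms: "distr (mu_koopman M F) M snd = M"
    unfolding mu_koopman_def by (subst distr_distr[OF s graph]) (simp add: o_def distr_id2)
  show "bounded_marginal M (mu_koopman M F) 1"
  proof (intro bounded_marginal.intro finite_measureI bounded_marginal_axioms.intro)
    show "emeasure (mu_koopman M F) (space (mu_koopman M F)) \<noteq> \<infinity>"
      unfolding mu_koopman_def using graph by (subst emeasure_distr) auto
    show "distr (mu_koopman M F) M snd \<le> scale_measure (ennreal 1) M"
      by (simp add: ms)
  qed (use f' s' emeasure_space_1 in auto)
qed


section \<open>Operators on the cyclic group\<close>

locale cyclic =
  fixes J :: nat
  assumes J_pos: "0 < J"
begin

abbreviation M :: "int measure" where "M \<equiv> measure_Z J"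

abbreviation I :: "int set" where "I \<equiv> residues_Z J"

abbreviation e :: "int \<Rightarrow> int \<Rightarrow> complex" where "e \<equiv> chr_Z J"

lemma finite_I [simp]: "finite I" and card_I [simp]: "card I = J" and I_ne [simp]: "I \<noteq> {}"
  using J_pos by (auto simp: residues_Z_def)

lemma zero_in_I [simp]: "0 \<in> I"
  using J_pos by (simp add: residues_Z_def)

lemma space_M [simp]: "space M = I" and sets_M [simp]: "sets M = Pow I"
  by (auto simp: measure_Z_def space_uniform_count_measure sets_uniform_count_measure)

sublocale prob_space M
  unfolding measure_Z_def by (rule prob_space_uniform_count_measure) auto

lemma measurable_M [measurable]: "f \<in> M \<rightarrow>\<^sub>M borel"
  by (auto simp: measurable_def)

lemma AE_M: "(AE x in M. P x) \<longleftrightarrow> (\<forall>x\<in>I. P x)"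
  unfolding measure_Z_def uniform_count_measure_def
  using J_pos by (simp add: AE_point_measure)

lemma integral_M: "(\<integral>x. f x \<partial>M) = (\<Sum>x\<in>I. f x) / of_nat J" for f :: "int \<Rightarrow> complex"
  unfolding measure_Z_def uniform_count_measure_def
  by (subst lebesgue_integral_point_measure_finite)
     (auto simp: sum_divide_distrib scaleR_conv_of_real)

lemma integrable_M [simp]: "integrable M f" for f :: "int \<Rightarrow> 'b::{banach, second_countable_topology}"
  unfolding measure_Z_def uniform_count_measure_def
  by (rule integrable_point_measure_finite) auto

lemma L1_M [simp]: "L1 M = UNIV" and L2_M [simp]: "L2 M = UNIV"
  by (auto simp: L1_def L2_def)

lemma e_eq_cis: "e j x = cis (2 * pi * of_int (j * x) / of_nat J)"
  unfolding chr_Z_def by (simp add: cis_power_int mult_ac)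

lemma e_add: "e (j + k) x = e j x * e k x"
  by (simp add: e_eq_cis cis_mult algebra_simps add_divide_distrib)

lemma e_commute: "e j x = e x j"
  by (simp add: e_eq_cis mult.commute)

lemma cnj_e: "cnj (e j x) = e (- j) x"
  by (simp add: e_eq_cis cis_cnj)

lemma cmod_e [simp]: "cmod (e j x) = 1"
  by (simp add: e_eq_cis)

lemma e_0 [simp]: "e 0 x = 1"
  by (simp add: e_eq_cis)

lemma e_period: "e (j + int J) x = e j x"
proof -
  have "e (int J) x = cis (2 * pi * of_int x)" using J_pos by (simp add: e_eq_cis mult_ac)
  also have "\<dots> = 1" by (rule cis_multiple_2pi) simp
  finally show ?thesis by (simp add: e_add)
qed

text \<open>
  Indices in expressions such as \<open>w (l + m) j\<close> leave the fundamental domain \<open>I\<close>. This lemma and the next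
  two allow them to be shifted and reflected inside sums over \<open>I\<close> all the same.
\<close>

lemma periodic_mod:
  assumes "\<And>x. f (x + int J) = f x"
  shows "f (y mod int J) = f y"
proof -
  have up: "f (x + int n * int J) = f x" for x n
  proof (induction n)
    case (Suc n)
    have "f (x + int (Suc n) * int J) = f ((x + int n * int J) + int J)" by (simp add: algebra_simps)
    then show ?case using Suc assms by simp
  qed simp
  have "f (x + k * int J) = f x" for x k
  proof (cases "0 \<le> k")
    case True
    then show ?thesis using up[of x "nat k"] by simp
  next
    case False
    then show ?thesis using up[of "x + k * int J" "nat (- k)"] by simp
  qed
  from this[of "y mod int J" "y div int J"] show ?thesis by (simp add: mod_mult_div_eq mult.commute)
qed

lemma sum_periodic_shift:
  fixes f :: "int \<Rightarrow> 'b::comm_monoid_add"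
  assumes f: "\<And>x. f (x + int J) = f x"
  shows "(\<Sum>x\<in>I. f (m + x)) = (\<Sum>x\<in>I. f x)"
proof (rule sum.reindex_bij_witness[where i="\<lambda>y. (y - m) mod int J" and j="\<lambda>x. (m + x) mod int J"])
  fix x assume "x \<in> I"
  then show "((m + x) mod int J - m) mod int J = x" "(m + (x - m) mod int J) mod int J = x"
    by (simp_all add: residues_Z_def mod_diff_left_eq mod_add_right_eq)
  show "(m + x) mod int J \<in> I" "(x - m) mod int J \<in> I" using J_pos by (auto simp: residues_Z_def)
  show "f ((m + x) mod int J) = f (m + x)" by (rule periodic_mod[where f=f, OF f])
qed

lemma sum_periodic_reflect:
  fixes f :: "int \<Rightarrow> 'b::comm_monoid_add"
  assumes f: "\<And>x. f (x + int J) = f x"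
  shows "(\<Sum>x\<in>I. f (m - x)) = (\<Sum>x\<in>I. f x)"
proof (rule sum.reindex_bij_witness[where i="\<lambda>y. (m - y) mod int J" and j="\<lambda>x. (m - x) mod int J"])
  fix x assume "x \<in> I"
  then show "(m - (m - x) mod int J) mod int J = x" "(m - (m - x) mod int J) mod int J = x"
    by (simp_all add: residues_Z_def mod_diff_right_eq)
  show "(m - x) mod int J \<in> I" "(m - x) mod int J \<in> I" using J_pos by (auto simp: residues_Z_def)
  show "f ((m - x) mod int J) = f (m - x)" by (rule periodic_mod[where f=f, OF f])
qed

lemma dvd_residue_difference: "x \<in> I \<Longrightarrow> y \<in> I \<Longrightarrow> int J dvd x - y \<longleftrightarrow> x = y"
  by (auto simp: residues_Z_def mod_eq_dvd_iff[symmetric])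

text \<open>
  For a nontrivial character, translation by 1 multiplies the sum by a number different from 1.
\<close>

lemma sum_e: "(\<Sum>x\<in>I. e j x) = (if int J dvd j then of_nat J else 0)"
proof (cases "int J dvd j")
  case True
  then obtain k where "j = int J * k" by auto
  then have "e j x = 1" for x
    using cis_multiple_2pi[of "of_int (k * x)"] J_pos by (simp add: e_eq_cis mult_ac)
  then show ?thesis using True by simp
next
  case False
  have "e j 1 \<noteq> 1"
  proof
    assume "e j 1 = 1"
    then have "cos (2 * pi * of_int j / of_nat J) = 1" by (simp add: e_eq_cis complex_eq_iff)
    then obtain k :: int where "2 * pi * of_int j / of_nat J = of_int k * 2 * pi"
      by (auto simp: cos_one_2pi_int)
    then have "of_int j = of_int k * (of_nat J :: real)" using J_pos by (simp add: field_simps)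
    then have "j = k * int J" by (metis of_int_eq_iff of_int_mult of_int_of_nat_eq)
    then show False using False by simp
  qed
  have "e j 1 * (\<Sum>x\<in>I. e j x) = (\<Sum>x\<in>I. e j (1 + x))"
    by (simp add: sum_distrib_left e_commute[of j] e_add)
  also have "\<dots> = (\<Sum>x\<in>I. e j x)"
    by (rule sum_periodic_shift) (simp add: e_commute[of j] e_period)
  finally have "(e j 1 - 1) * (\<Sum>x\<in>I. e j x) = 0" by (simp add: left_diff_distrib)
  then show ?thesis using False \<open>e j 1 \<noteq> 1\<close> by simp
qed

lemma inner_e: "L2_inner M (e j) (e k) = (if int J dvd j - k then 1 else 0)"
  using J_pos sum_e[of "j - k"] by (simp add: L2_inner_def integral_M cnj_e flip: e_add)

lemma e_diff: "e k (y - x) = e k y * cnj (e k x)"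
  by (simp add: e_eq_cis cis_cnj cis_mult algebra_simps diff_divide_distrib)

lemma Parseval:
  "(\<Sum>k\<in>I. L2_inner M f (e k) * cnj (L2_inner M g (e k))) = L2_inner M f g"
proof -
  have "L2_inner M f (e k) * cnj (L2_inner M g (e k)) =
      (\<Sum>x\<in>I. \<Sum>y\<in>I. f x * cnj (g y) * e k (y - x)) / (of_nat J)\<^sup>2" for k
  proof -
    have "L2_inner M f (e k) * cnj (L2_inner M g (e k)) =
        (\<Sum>x\<in>I. f x * cnj (e k x)) * (\<Sum>y\<in>I. cnj (g y) * e k y) / (of_nat J)\<^sup>2"
      by (simp add: L2_inner_def integral_M power2_eq_square)
    also have "(\<Sum>x\<in>I. f x * cnj (e k x)) * (\<Sum>y\<in>I. cnj (g y) * e k y) =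
        (\<Sum>x\<in>I. \<Sum>y\<in>I. f x * cnj (g y) * e k (y - x))"
      unfolding sum_product e_diff by (intro sum.cong refl) simp
    finally show ?thesis .
  qed
  then have "(\<Sum>k\<in>I. L2_inner M f (e k) * cnj (L2_inner M g (e k))) =
      (\<Sum>k\<in>I. \<Sum>x\<in>I. \<Sum>y\<in>I. f x * cnj (g y) * e k (y - x)) / (of_nat J)\<^sup>2"
    by (simp flip: sum_divide_distrib)
  also have "(\<Sum>k\<in>I. \<Sum>x\<in>I. \<Sum>y\<in>I. f x * cnj (g y) * e k (y - x)) =
      (\<Sum>x\<in>I. \<Sum>k\<in>I. \<Sum>y\<in>I. f x * cnj (g y) * e k (y - x))" by (rule sum.swap)
  also have "\<dots> = (\<Sum>x\<in>I. \<Sum>y\<in>I. \<Sum>k\<in>I. f x * cnj (g y) * e k (y - x))"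
    by (rule sum.cong[OF refl]) (rule sum.swap)
  also have "\<dots> = (\<Sum>x\<in>I. \<Sum>y\<in>I. if x = y then f x * cnj (g y) * of_nat J else 0)"
  proof (intro sum.cong refl)
    fix x y assume "x \<in> I" "y \<in> I"
    moreover have "(\<Sum>k\<in>I. f x * cnj (g y) * e k (y - x)) = f x * cnj (g y) * (\<Sum>k\<in>I. e (y - x) k)"
      by (simp add: sum_distrib_left e_commute[of _ "y - x"])
    ultimately show "(\<Sum>k\<in>I. f x * cnj (g y) * e k (y - x)) =
        (if x = y then f x * cnj (g y) * of_nat J else 0)"
      using dvd_residue_difference[of y x] by (auto simp: sum_e)
  qed
  also have "\<dots> = (\<Sum>x\<in>I. f x * cnj (g x)) * of_nat J" by (simp add: sum_distrib_right)
  finally show ?thesis using J_pos by (simp add: L2_inner_def integral_M power2_eq_square)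
qed

end

locale cyclic_operator = cyclic +
  fixes W :: "(int \<Rightarrow> complex) \<Rightarrow> (int \<Rightarrow> complex)"
begin

abbreviation w :: "int \<Rightarrow> int \<Rightarrow> complex" where "w \<equiv> mat_Z J W"
abbreviation \<omega> :: "int \<Rightarrow> int \<Rightarrow> complex" where "\<omega> \<equiv> omega_Z J W"
abbreviation \<nu> :: "int \<Rightarrow> int \<Rightarrow> complex" where "\<nu> \<equiv> nu_Z J W"
abbreviation N :: "(int \<times> int) measure" where "N \<equiv> mu_Z J W"

lemma w_period: "w (k + int J) j = w k j" "w k (j + int J) = w k j"
proof -
  have "e (j + int J) = e j" for j by (rule ext) (rule e_period)
  then show "w (k + int J) j = w k j" "w k (j + int J) = w k j" by (simp_all add: mat_Z_def)
qed

text \<open>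
  Substituting $p = l + m$ and $q = j + n$ separates the fourfold sum into a product of two conjugate
  double sums. In particular the density is nonnegative for every operator.
\<close>

lemma nu_square:
  "\<nu> x a = complex_of_real ((cmod (\<Sum>p\<in>I. \<Sum>j\<in>I. w p j * (e p x * e (- j) a)))\<^sup>2) / of_nat J"
proof -
  define z where "z p j = w p j * (e p x * e (- j) a)" for p j
  have zp: "z (p + int J) j = z p j" for p j by (simp add: z_def w_period e_period)
  have zj: "z p (j + int J) = z p j" for p j
    using e_period[of "- j - int J" a] by (simp add: z_def w_period)
  have term_eq: "w (l + m) j * cnj (w l (j + n)) * e m x * e n a = z (m + l) j * cnj (z l (n + j))"
    for m n j l
  proof -
    have "e (l + m) x * e (- l) x = e m x" "e (- j) a * e (j + n) a = e n a"
      by (simp_all flip: e_add)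
    then show ?thesis by (simp add: z_def cnj_e mult_ac add.commute) (metis mult.assoc mult.commute)
  qed
  have "\<omega> m n * e m x * e n a = (\<Sum>j\<in>I. \<Sum>l\<in>I. z (m + l) j * cnj (z l (n + j))) / of_nat J" for m n
    unfolding omega_Z_def term_eq[symmetric] by (simp flip: sum_distrib_right)
  then have "\<nu> x a = (\<Sum>m\<in>I. \<Sum>n\<in>I. \<Sum>j\<in>I. \<Sum>l\<in>I. z (m + l) j * cnj (z l (n + j))) / of_nat J"
    unfolding nu_Z_def by (simp flip: sum_divide_distrib)
  also have "(\<Sum>m\<in>I. \<Sum>n\<in>I. \<Sum>j\<in>I. \<Sum>l\<in>I. z (m + l) j * cnj (z l (n + j))) =
      (\<Sum>j\<in>I. \<Sum>l\<in>I. \<Sum>m\<in>I. \<Sum>n\<in>I. z (m + l) j * cnj (z l (n + j)))"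
  proof -
    let ?f = "\<lambda>m n j l. z (m + l) j * cnj (z l (n + j))"
    have "(\<Sum>m\<in>I. \<Sum>n\<in>I. \<Sum>j\<in>I. \<Sum>l\<in>I. ?f m n j l) = (\<Sum>m\<in>I. \<Sum>j\<in>I. \<Sum>n\<in>I. \<Sum>l\<in>I. ?f m n j l)"
      by (rule sum.cong[OF refl], rule sum.swap)
    also have "\<dots> = (\<Sum>j\<in>I. \<Sum>m\<in>I. \<Sum>n\<in>I. \<Sum>l\<in>I. ?f m n j l)" by (rule sum.swap)
    also have "\<dots> = (\<Sum>j\<in>I. \<Sum>m\<in>I. \<Sum>l\<in>I. \<Sum>n\<in>I. ?f m n j l)"
      by (rule sum.cong[OF refl], rule sum.cong[OF refl], rule sum.swap)
    also have "\<dots> = (\<Sum>j\<in>I. \<Sum>l\<in>I. \<Sum>m\<in>I. \<Sum>n\<in>I. ?f m n j l)"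
      by (rule sum.cong[OF refl], rule sum.swap)
    finally show ?thesis .
  qed
  also have "\<dots> = (\<Sum>j\<in>I. \<Sum>l\<in>I. (\<Sum>p\<in>I. z p j) * (\<Sum>q\<in>I. cnj (z l q)))"
  proof (intro sum.cong refl)
    fix j l
    have "(\<Sum>m\<in>I. z (m + l) j) = (\<Sum>p\<in>I. z p j)"
      using sum_periodic_shift[of "\<lambda>p. z p j" l] zp by (simp add: add.commute)
    moreover have "(\<Sum>n\<in>I. cnj (z l (n + j))) = (\<Sum>q\<in>I. cnj (z l q))"
      using sum_periodic_shift[of "\<lambda>q. cnj (z l q)" j] zj by (simp add: add.commute)
    ultimately show "(\<Sum>m\<in>I. \<Sum>n\<in>I. z (m + l) j * cnj (z l (n + j))) =
        (\<Sum>p\<in>I. z p j) * (\<Sum>q\<in>I. cnj (z l q))"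
      by (simp flip: sum_product)
  qed
  also have "\<dots> = (\<Sum>j\<in>I. \<Sum>p\<in>I. z p j) * (\<Sum>l\<in>I. \<Sum>q\<in>I. cnj (z l q))"
    by (simp flip: sum_product)
  also have "(\<Sum>j\<in>I. \<Sum>p\<in>I. z p j) = (\<Sum>p\<in>I. \<Sum>j\<in>I. z p j)" by (rule sum.swap)
  also have "(\<Sum>l\<in>I. \<Sum>q\<in>I. cnj (z l q)) = cnj (\<Sum>p\<in>I. \<Sum>j\<in>I. z p j)" by simp
  also have "(\<Sum>p\<in>I. \<Sum>j\<in>I. z p j) * cnj (\<Sum>p\<in>I. \<Sum>j\<in>I. z p j) =
      complex_of_real ((cmod (\<Sum>p\<in>I. \<Sum>j\<in>I. z p j))\<^sup>2)" by (simp only: complex_norm_square)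
  finally show ?thesis by (simp only: z_def)
qed

lemma nu_nonneg: "\<nu> x a \<in> \<real>\<^sub>\<ge>\<^sub>0"
  unfolding nu_square by (simp add: complex_nonneg_Reals_iff Re_divide_of_nat Im_divide_of_nat)

lemma nu_Re: "complex_of_real (Re (\<nu> x a)) = \<nu> x a" and Re_nu_nonneg: "0 \<le> Re (\<nu> x a)"
  using nu_nonneg[of x a] by (auto simp: complex_nonneg_Reals_iff complex_eq_iff)

lemma mean_e: "m \<in> I \<Longrightarrow> (\<Sum>x\<in>I. e m x) / of_nat J = (if m = 0 then 1 else 0)"
  using dvd_residue_difference[of m 0] J_pos by (auto simp: sum_e)

text \<open>
  Averaging over one variable keeps only the terms of zero frequency in that variable. This computes
  the densities of the marginals.
\<close>

lemma mean_nu_fst: "(\<integral>x. \<nu> x a \<partial>M) = (\<Sum>n\<in>I. \<omega> 0 n * e n a)"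
proof -
  have "(\<integral>x. \<nu> x a \<partial>M) = (\<Sum>m\<in>I. \<Sum>n\<in>I. \<omega> m n * (\<integral>x. e m x \<partial>M) * e n a)"
    unfolding nu_Z_def by (simp add: Bochner_Integration.integral_sum mult_ac)
  also have "\<dots> = (\<Sum>m\<in>I. if m = 0 then \<Sum>n\<in>I. \<omega> 0 n * e n a else 0)"
    by (intro sum.cong refl) (simp add: integral_M mean_e)
  also have "\<dots> = (\<Sum>n\<in>I. \<omega> 0 n * e n a)" using J_pos by (simp add: residues_Z_def)
  finally show ?thesis .
qed

lemma mean_nu_snd: "(\<integral>a. \<nu> x a \<partial>M) = (\<Sum>m\<in>I. \<omega> m 0 * e m x)"
proof -
  have "(\<integral>a. \<nu> x a \<partial>M) = (\<Sum>m\<in>I. \<Sum>n\<in>I. \<omega> m n * e m x * (\<integral>a. e n a \<partial>M))"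
    unfolding nu_Z_def by (simp add: Bochner_Integration.integral_sum mult_ac)
  also have "\<dots> = (\<Sum>m\<in>I. \<Sum>n\<in>I. if n = 0 then \<omega> m 0 * e m x else 0)"
    by (intro sum.cong refl) (simp add: integral_M mean_e)
  also have "\<dots> = (\<Sum>m\<in>I. \<omega> m 0 * e m x)" using J_pos by (simp add: residues_Z_def)
  finally show ?thesis .
qed

text \<open>
  Each row meets each diagonal exactly once.
\<close>

lemma row_sum_le: "(\<Sum>j\<in>I. cmod (w l j)) \<le> DT_norm_Z J W"
proof -
  have "(\<Sum>j\<in>I. cmod (w l j)) = (\<Sum>k\<in>I. cmod (w l (l - k)))"
    by (rule sum_periodic_reflect[symmetric]) (simp add: w_period)
  also have "\<dots> \<le> DT_norm_Z J W"
    unfolding DT_norm_Z_def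
  proof (rule sum_mono)
    fix k
    define f where "f j = cmod (w (k + j) j)" for j
    have "f (j + int J) = f j" for j
      using w_period(1)[of "k + j" "j + int J"] w_period(2)[of "k + j" j] by (simp add: f_def add.assoc)
    then have "f (l - k) = f ((l - k) mod int J)" by (rule periodic_mod[symmetric])
    moreover have "(l - k) mod int J \<in> I" using J_pos by (simp add: residues_Z_def)
    ultimately have "f (l - k) \<le> (MAX j\<in>I. f j)" by (simp add: Max_ge)
    then show "cmod (w l (l - k)) \<le> (MAX j\<in>I. cmod (w (k + j) j))" by (simp add: f_def)
  qed
  finally show ?thesis .
qed

lemma omega_sum_le: "(\<Sum>n\<in>I. cmod (\<omega> 0 n)) \<le> (DT_norm_Z J W)\<^sup>2"
proof -
  have "(\<Sum>n\<in>I. cmod (\<omega> 0 n)) \<le> (\<Sum>n\<in>I. (\<Sum>j\<in>I. \<Sum>l\<in>I. cmod (w l j) * cmod (w l (n + j))) / of_nat J)"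
  proof (rule sum_mono)
    fix n
    have "cmod (\<Sum>j\<in>I. \<Sum>l\<in>I. w l j * cnj (w l (j + n))) \<le>
        (\<Sum>j\<in>I. \<Sum>l\<in>I. cmod (w l j) * cmod (w l (n + j)))"
      by (intro order_trans[OF norm_sum] sum_mono) (simp add: norm_mult add.commute)
    then show "cmod (\<omega> 0 n) \<le> (\<Sum>j\<in>I. \<Sum>l\<in>I. cmod (w l j) * cmod (w l (n + j))) / of_nat J"
      by (simp add: omega_Z_def norm_divide norm_mult divide_right_mono)
  qed
  also have "\<dots> = (\<Sum>l\<in>I. \<Sum>j\<in>I. \<Sum>n\<in>I. cmod (w l j) * cmod (w l (n + j))) / of_nat J"
  proof -
    let ?f = "\<lambda>n j l. cmod (w l j) * cmod (w l (n + j))"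
    have "(\<Sum>n\<in>I. \<Sum>j\<in>I. \<Sum>l\<in>I. ?f n j l) = (\<Sum>n\<in>I. \<Sum>l\<in>I. \<Sum>j\<in>I. ?f n j l)"
      by (rule sum.cong[OF refl], rule sum.swap)
    also have "\<dots> = (\<Sum>l\<in>I. \<Sum>n\<in>I. \<Sum>j\<in>I. ?f n j l)" by (rule sum.swap)
    also have "\<dots> = (\<Sum>l\<in>I. \<Sum>j\<in>I. \<Sum>n\<in>I. ?f n j l)"
      by (rule sum.cong[OF refl], rule sum.swap)
    finally have eq: "(\<Sum>n\<in>I. \<Sum>j\<in>I. \<Sum>l\<in>I. ?f n j l) = (\<Sum>l\<in>I. \<Sum>j\<in>I. \<Sum>n\<in>I. ?f n j l)" .
    show ?thesis unfolding sum_divide_distrib[symmetric] eq ..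
  qed
  also have "\<dots> = (\<Sum>l\<in>I. (\<Sum>j\<in>I. cmod (w l j))\<^sup>2) / of_nat J"
  proof (intro arg_cong2[where f="(/)"] sum.cong refl)
    fix l
    have "(\<Sum>n\<in>I. cmod (w l (n + j))) = (\<Sum>n\<in>I. cmod (w l n))" for j
      using sum_periodic_shift[of "\<lambda>n. cmod (w l n)" j] by (simp add: w_period add.commute)
    then show "(\<Sum>j\<in>I. \<Sum>n\<in>I. cmod (w l j) * cmod (w l (n + j))) = (\<Sum>j\<in>I. cmod (w l j))\<^sup>2"
      by (simp add: power2_eq_square sum_distrib_right flip: sum_distrib_left)
  qed
  also have "\<dots> \<le> (\<Sum>l\<in>I. (DT_norm_Z J W)\<^sup>2) / of_nat J"
    by (intro divide_right_mono sum_mono power_mono row_sum_le sum_nonneg) auto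
  also have "\<dots> = (DT_norm_Z J W)\<^sup>2" using J_pos by simp
  finally show ?thesis .
qed

lemma nu_measurable [measurable]: "(\<lambda>(x, a). \<nu> x a) \<in> borel_measurable (M \<Otimes>\<^sub>M M)"
  unfolding nu_Z_def by measurable

lemma sets_N [simp, measurable_cong]: "sets N = sets (M \<Otimes>\<^sub>M M)"
  by (simp add: mu_Z_def)

sublocale pair: pair_prob_space M M ..

lemma distr_snd: "distr N M snd = density M (\<lambda>a. ennreal (Re (\<integral>x. \<nu> x a \<partial>M)))"
proof (rule measure_eqI)
  fix A assume "A \<in> sets (distr N M snd)"
  then have A: "A \<in> sets M" by simp
  then have sA: "snd -` A \<inter> space (M \<Otimes>\<^sub>M M) \<in> sets (M \<Otimes>\<^sub>M M)"
    by (intro measurable_sets[OF measurable_snd])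
  have "emeasure (distr N M snd) A = emeasure N (snd -` A \<inter> space (M \<Otimes>\<^sub>M M))"
    using A by (subst emeasure_distr) (auto simp: mu_Z_def)
  also have "\<dots> = (\<integral>\<^sup>+p. ennreal (Re (\<nu> (fst p) (snd p))) * indicator A (snd p) \<partial>(M \<Otimes>\<^sub>M M))"
    unfolding mu_Z_def using sA
    by (subst emeasure_density) (auto simp: case_prod_unfold indicator_def intro!: nn_integral_cong)
  also have "\<dots> = (\<integral>\<^sup>+a. (\<integral>\<^sup>+x. ennreal (Re (\<nu> x a)) * indicator A a \<partial>M) \<partial>M)"
    by (subst pair.nn_integral_snd[symmetric]) (auto simp: case_prod_unfold)
  also have "\<dots> = (\<integral>\<^sup>+a. ennreal (Re (\<integral>x. \<nu> x a \<partial>M)) * indicator A a \<partial>M)"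
  proof (rule nn_integral_cong)
    fix a
    have "(\<integral>\<^sup>+x. ennreal (Re (\<nu> x a)) \<partial>M) = ennreal (\<integral>x. Re (\<nu> x a) \<partial>M)"
      using Re_nu_nonneg by (intro nn_integral_eq_integral) auto
    then show "(\<integral>\<^sup>+x. ennreal (Re (\<nu> x a)) * indicator A a \<partial>M) =
        ennreal (Re (\<integral>x. \<nu> x a \<partial>M)) * indicator A a"
      by (simp add: nn_integral_multc)
  qed
  also have "\<dots> = emeasure (density M (\<lambda>a. ennreal (Re (\<integral>x. \<nu> x a \<partial>M)))) A"
    using A by (subst emeasure_density) auto
  finally show "emeasure (distr N M snd) A =
      emeasure (density M (\<lambda>a. ennreal (Re (\<integral>x. \<nu> x a \<partial>M)))) A" .
qed simp

lemma distr_fst: "distr N M fst = density M (\<lambda>x. ennreal (Re (\<integral>a. \<nu> x a \<partial>M)))"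
proof (rule measure_eqI)
  fix A assume "A \<in> sets (distr N M fst)"
  then have A: "A \<in> sets M" by simp
  then have sA: "fst -` A \<inter> space (M \<Otimes>\<^sub>M M) \<in> sets (M \<Otimes>\<^sub>M M)"
    by (intro measurable_sets[OF measurable_fst])
  have "emeasure (distr N M fst) A = emeasure N (fst -` A \<inter> space (M \<Otimes>\<^sub>M M))"
    using A by (subst emeasure_distr) (auto simp: mu_Z_def)
  also have "\<dots> = (\<integral>\<^sup>+p. ennreal (Re (\<nu> (fst p) (snd p))) * indicator A (fst p) \<partial>(M \<Otimes>\<^sub>M M))"
    unfolding mu_Z_def using sA
    by (subst emeasure_density) (auto simp: case_prod_unfold indicator_def intro!: nn_integral_cong)
  also have "\<dots> = (\<integral>\<^sup>+x. (\<integral>\<^sup>+a. ennreal (Re (\<nu> x a)) * indicator A x \<partial>M) \<partial>M)"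
    by (subst nn_integral_fst[symmetric]) (auto simp: case_prod_unfold)
  also have "\<dots> = (\<integral>\<^sup>+x. ennreal (Re (\<integral>a. \<nu> x a \<partial>M)) * indicator A x \<partial>M)"
  proof (rule nn_integral_cong)
    fix x
    have "(\<integral>\<^sup>+a. ennreal (Re (\<nu> x a)) \<partial>M) = ennreal (\<integral>a. Re (\<nu> x a) \<partial>M)"
      using Re_nu_nonneg by (intro nn_integral_eq_integral) auto
    then show "(\<integral>\<^sup>+a. ennreal (Re (\<nu> x a)) * indicator A x \<partial>M) =
        ennreal (Re (\<integral>a. \<nu> x a \<partial>M)) * indicator A x"
      by (simp add: nn_integral_multc)
  qed
  also have "\<dots> = emeasure (density M (\<lambda>x. ennreal (Re (\<integral>a. \<nu> x a \<partial>M)))) A"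
    using A by (subst emeasure_density) auto
  finally show "emeasure (distr N M fst) A =
      emeasure (density M (\<lambda>x. ennreal (Re (\<integral>a. \<nu> x a \<partial>M)))) A" .
qed simp

lemma mean_nu_fst_le: "Re (\<integral>x. \<nu> x a \<partial>M) \<le> (DT_norm_Z J W)\<^sup>2"
proof -
  have "Re (\<integral>x. \<nu> x a \<partial>M) \<le> cmod (\<Sum>n\<in>I. \<omega> 0 n * e n a)"
    unfolding mean_nu_fst by (rule complex_Re_le_cmod)
  also have "\<dots> \<le> (\<Sum>n\<in>I. cmod (\<omega> 0 n))"
    by (rule order_trans[OF norm_sum]) (simp add: norm_mult)
  also have "\<dots> \<le> (DT_norm_Z J W)\<^sup>2" by (rule omega_sum_le)
  finally show ?thesis .
qed

sublocale bounded_marginal M N "(DT_norm_Z J W)\<^sup>2"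
proof (intro bounded_marginal.intro finite_measureI bounded_marginal_axioms.intro)
  show "fst \<in> N \<rightarrow>\<^sub>M M" "snd \<in> N \<rightarrow>\<^sub>M M" by measurable
  have le: "emeasure (distr N M snd) A \<le> ennreal ((DT_norm_Z J W)\<^sup>2) * emeasure M A" if A: "A \<in> sets M" for A
  proof -
    have "emeasure (distr N M snd) A = (\<integral>\<^sup>+a. ennreal (Re (\<integral>x. \<nu> x a \<partial>M)) * indicator A a \<partial>M)"
      unfolding distr_snd using A by (subst emeasure_density) auto
    also have "\<dots> \<le> (\<integral>\<^sup>+a. ennreal ((DT_norm_Z J W)\<^sup>2) * indicator A a \<partial>M)"
      by (intro nn_integral_mono mult_right_mono ennreal_leI mean_nu_fst_le) auto
    also have "\<dots> = ennreal ((DT_norm_Z J W)\<^sup>2) * emeasure M A"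
      using A by (simp add: nn_integral_cmult_indicator)
    finally show ?thesis .
  qed
  then show "distr N M snd \<le> scale_measure (ennreal ((DT_norm_Z J W)\<^sup>2)) M"
    by (subst le_measure) auto
  have "snd -` I \<inter> space N = space N"
    using sets_eq_imp_space_eq[OF sets_N] by (auto simp: space_pair_measure)
  then have "emeasure N (space N) = emeasure (distr N M snd) (space M)"
    by (subst emeasure_distr) auto
  also have "\<dots> \<le> ennreal ((DT_norm_Z J W)\<^sup>2) * emeasure M (space M)" by (rule le) auto
  also have "\<dots> < \<infinity>" by (simp only: emeasure_space_1) simp
  finally show "emeasure N (space N) \<noteq> \<infinity>" by simp
  show "emeasure M (space M) \<noteq> \<infinity>" by (simp only: emeasure_space_1) simp
qed simp

text \<open>
  By Fubini the integral formula itself gives an image. Taking it as the operator makes the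
  formula hold at every point rather than almost everywhere.
\<close>

lemma kernel_image: "measure_image M N f (\<lambda>x. \<integral>a. \<nu> x a * f a \<partial>M)"
  unfolding measure_image_def
proof (intro conjI allI impI)
  fix \<phi> :: "int \<Rightarrow> complex" assume \<phi>: "\<phi> \<in> borel_measurable M \<and> bounded (\<phi> ` space M)"
  show int: "integrable N (\<lambda>(x, a). \<phi> x * f a)"
    using \<phi> by (intro integrable_test_product) auto
  then have "integrable (M \<Otimes>\<^sub>M M) (\<lambda>p. Re (\<nu> (fst p) (snd p)) *\<^sub>R (\<phi> (fst p) * f (snd p)))"
    unfolding mu_Z_def case_prod_unfold using Re_nu_nonneg
    by (subst (asm) integrable_density) (auto simp: case_prod_unfold)
  then have prod: "(\<integral>x. (\<integral>a. Re (\<nu> x a) *\<^sub>R (\<phi> x * f a) \<partial>M) \<partial>M) =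
      (\<integral>p. Re (\<nu> (fst p) (snd p)) *\<^sub>R (\<phi> (fst p) * f (snd p)) \<partial>(M \<Otimes>\<^sub>M M))"
    by (subst pair.integral_fst'[symmetric]) auto
  have "(\<integral>x. \<phi> x * (\<integral>a. \<nu> x a * f a \<partial>M) \<partial>M) = (\<integral>x. (\<integral>a. Re (\<nu> x a) *\<^sub>R (\<phi> x * f a) \<partial>M) \<partial>M)"
    by (simp add: scaleR_conv_of_real nu_Re mult.left_commute)
  also have "\<dots> = (\<integral>(x, a). \<phi> x * f a \<partial>N)"
    unfolding prod mu_Z_def case_prod_unfold using Re_nu_nonneg
    by (subst integral_density) (auto simp: case_prod_unfold)
  finally show "(\<integral>x. \<phi> x * (\<integral>a. \<nu> x a * f a \<partial>M) \<partial>M) = (\<integral>(x, a). \<phi> x * f a \<partial>N)" .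
qed simp

context
  assumes unitary: "unitary_operator M W"
begin

lemma column_orthonormal: "(\<Sum>l\<in>I. w l j * cnj (w l k)) = (if int J dvd j - k then 1 else 0)"
  unfolding mat_Z_def Parseval using unitary by (simp add: unitary_operator_def inner_e)

text \<open>
  The orthonormality of the rows is that of the columns of the adjoint. The adjoint enters through
  preimages $f_k$ of the characters: $W_{k,j} = \langle We_j, Wf_k\rangle = \langle e_j, f_k\rangle$.
\<close>

lemma row_orthonormal: "(\<Sum>j\<in>I. w k j * cnj (w l j)) = (if int J dvd k - l then 1 else 0)"
proof -
  have ex: "\<exists>f. \<forall>x\<in>I. W f x = e k x" for k
    using unitary by (auto simp: unitary_operator_def AE_M)
  obtain f where f_all: "\<forall>k. \<forall>x\<in>I. W (f k) x = e k x"
    by (rule exE[OF choice[OF allI[OF ex]]])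
  then have f: "W (f k) x = e k x" if "x \<in> I" for k x using that by simp
  have cong: "L2_inner M g h = L2_inner M g' h'"
    if "\<And>x. x \<in> I \<Longrightarrow> g x = g' x" "\<And>x. x \<in> I \<Longrightarrow> h x = h' x" for g g' h h'
    using that by (simp add: L2_inner_def integral_M)
  have iso: "L2_inner M (W g) (W h) = L2_inner M g h" for g h
    using unitary by (simp add: unitary_operator_def)
  have "w k j = cnj (L2_inner M (f k) (e j))" for k j
  proof -
    have "w k j = L2_inner M (W (e j)) (W (f k))"
      unfolding mat_Z_def by (rule cong) (simp_all add: f)
    also have "\<dots> = L2_inner M (e j) (f k)" by (rule iso)
    also have "\<dots> = cnj (L2_inner M (f k) (e j))"
      by (simp add: L2_inner_def integral_M mult.commute)
    finally show ?thesis .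
  qed
  then have "(\<Sum>j\<in>I. w k j * cnj (w l j)) = cnj (\<Sum>j\<in>I. L2_inner M (f k) (e j) * cnj (L2_inner M (f l) (e j)))"
    by simp
  also have "\<dots> = cnj (L2_inner M (W (f k)) (W (f l)))" unfolding Parseval iso ..
  also have "L2_inner M (W (f k)) (W (f l)) = L2_inner M (e k) (e l)" by (rule cong) (simp_all add: f)
  finally show ?thesis by (simp add: inner_e)
qed

lemma omega_0_snd: "n \<in> I \<Longrightarrow> \<omega> 0 n = (if n = 0 then 1 else 0)"
  using J_pos dvd_residue_difference[of n 0]
  by (auto simp: omega_Z_def column_orthonormal)

lemma omega_0_fst: "m \<in> I \<Longrightarrow> \<omega> m 0 = (if m = 0 then 1 else 0)"
  using J_pos dvd_residue_difference[of m 0]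
  unfolding omega_Z_def by (subst sum.swap) (auto simp: row_orthonormal)

lemma distr_snd_unitary: "distr N M snd = M"
proof -
  have "(\<integral>x. \<nu> x a \<partial>M) = 1" for a
    unfolding mean_nu_fst using J_pos
    by (subst sum.cong[OF refl, of _ _ "\<lambda>n. if n = 0 then 1 else 0"])
       (auto simp: omega_0_snd residues_Z_def)
  then show ?thesis by (simp add: distr_snd density_1)
qed

lemma distr_fst_unitary: "distr N M fst = M"
proof -
  have "(\<integral>a. \<nu> x a \<partial>M) = 1" for x
    unfolding mean_nu_snd using J_pos
    by (subst sum.cong[OF refl, of _ _ "\<lambda>n. if n = 0 then 1 else 0"])
       (auto simp: omega_0_fst residues_Z_def)
  then show ?thesis by (simp add: distr_fst density_1)
qed

end

theorem cyclic_case: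
  "\<exists>T. determines_operator M N T \<and> (\<forall>f\<in>L1 M. \<forall>x\<in>I. T f x = (\<integral>a. \<nu> x a * f a \<partial>M)) \<and>
     L1_onorm M T \<le> (DT_norm_Z J W)\<^sup>2 \<and> nonneg_operator M T \<and>
     (unitary_operator M W \<longrightarrow> fixes_one M T \<and> preserves_integral M T)"
proof (intro exI[of _ "\<lambda>f x. \<integral>a. \<nu> x a * f a \<partial>M"] conjI impI ballI refl)
  note im = kernel_image
  show "determines_operator M N (\<lambda>f x. \<integral>a. \<nu> x a * f a \<partial>M)"
    "L1_onorm M (\<lambda>f x. \<integral>a. \<nu> x a * f a \<partial>M) \<le> (DT_norm_Z J W)\<^sup>2"
    "nonneg_operator M (\<lambda>f x. \<integral>a. \<nu> x a * f a \<partial>M)"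
    by (rule determines_operatorI, rule im)+
  assume u: "unitary_operator M W"
  show "fixes_one M (\<lambda>f x. \<integral>a. \<nu> x a * f a \<partial>M)"
    by (rule fixes_oneI[OF im distr_fst_unitary[OF u]])
  show "preserves_integral M (\<lambda>f x. \<integral>a. \<nu> x a * f a \<partial>M)"
    by (rule preserves_integralI[OF im distr_snd_unitary[OF u]])
qed

end


section \<open>Fourier coefficients of measures on the circle\<close>

lemma chr_T_0 [simp]: "chr_T 0 t = 1"
  by (simp add: chr_T_def)

lemma chr_T_add: "chr_T (m + n) t = chr_T m t * chr_T n t"
  by (simp add: chr_T_def cis_mult algebra_simps)

lemma cnj_chr_T: "cnj (chr_T n t) = chr_T (- n) t"
  by (simp add: chr_T_def cis_cnj)

lemma cmod_chr_T [simp]: "cmod (chr_T n t) = 1"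
  by (simp add: chr_T_def)

lemma chr_T_periodic: "chr_T n (t - 2 * pi * of_int k) = chr_T n t"
proof -
  have "chr_T n (t - 2 * pi * of_int k) = cis (of_int n * t) * cis (2 * pi * of_int (- (n * k)))"
    unfolding chr_T_def cis_mult by (simp add: algebra_simps)
  also have "cis (2 * pi * of_int (- (n * k))) = 1" by (rule cis_multiple_2pi) simp
  finally show ?thesis by (simp add: chr_T_def)
qed

lemma continuous_on_chr_T: "continuous_on S (chr_T n)"
  unfolding chr_T_def cis_conv_exp by (intro continuous_intros)

lemma borel_measurable_cis [measurable]: "cis \<in> borel_measurable borel"
  unfolding cis_conv_exp by (intro borel_measurable_continuous_onI continuous_intros)

lemma borel_measurable_chr_T [measurable]: "chr_T n \<in> borel_measurable borel"
  by (intro borel_measurable_continuous_onI continuous_on_chr_T)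

lemma space_measure_T [simp]: "space measure_T = {0..<2 * pi}"
  by (simp add: measure_T_def space_scale_measure space_restrict_space)

lemma sets_measure_T [measurable_cong]:
  "sets measure_T = sets (restrict_space borel {0..<2 * pi})"
  by (simp add: measure_T_def sets_restrict_space)

lemma measurable_measure_T: "f \<in> borel \<rightarrow>\<^sub>M N \<Longrightarrow> f \<in> measure_T \<rightarrow>\<^sub>M N"
  by (subst measurable_cong_sets[OF sets_measure_T refl]) (rule measurable_restrict_space1)

lemma measurable_sets_T: "sets N = sets measure_T \<Longrightarrow> f \<in> borel \<rightarrow>\<^sub>M L \<Longrightarrow> f \<in> N \<rightarrow>\<^sub>M L"
  using measurable_measure_T by (simp cong: measurable_cong_sets)

lemma integral_measure_T:
  fixes f :: "real \<Rightarrow> complex"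
  assumes "f \<in> borel_measurable borel"
  shows "(\<integral>t. f t \<partial>measure_T) =
    (\<integral>t. indicator {0..2 * pi} t *\<^sub>R ((1 / (2 * pi)) *\<^sub>R f t) \<partial>lborel)"
proof -
  have T_eq: "measure_T = density (restrict_space lborel {0..<2 * pi}) (\<lambda>_. ennreal (1 / (2 * pi)))"
    by (rule measure_eqI)
       (auto simp: measure_T_def emeasure_density_const sets_restrict_space)
  have "(\<integral>t. f t \<partial>measure_T) =
      (\<integral>t. (1 / (2 * pi)) *\<^sub>R f t \<partial>restrict_space lborel {0..<2 * pi})"
    unfolding T_eq
    by (subst integral_density) (use assms in \<open>auto intro!: measurable_restrict_space1\<close>)
  also have "\<dots> = (\<integral>t. indicator {0..<2 * pi} t *\<^sub>R ((1 / (2 * pi)) *\<^sub>R f t) \<partial>lborel)"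
    by (rule integral_restrict_space) simp
  also have "\<dots> = (\<integral>t. indicator {0..2 * pi} t *\<^sub>R ((1 / (2 * pi)) *\<^sub>R f t) \<partial>lborel)"
  proof (rule integral_cong_AE)
    show "AE t in lborel. indicator {0..<2 * pi} t *\<^sub>R ((1 / (2 * pi)) *\<^sub>R f t) =
        indicator {0..2 * pi} t *\<^sub>R ((1 / (2 * pi)) *\<^sub>R f t)"
      using AE_lborel_singleton[of "2 * pi"]
      by eventually_elim (auto simp: indicator_def)
  qed (use assms in measurable)
  finally show ?thesis .
qed

lemma integral_chr_T: "(\<integral>t. chr_T n t \<partial>measure_T) = (if n = 0 then 1 else 0)"
proof -
  have "(\<integral>t. chr_T n t \<partial>measure_T) =
      (\<integral>t. indicator {0..2 * pi} t *\<^sub>R ((1 / (2 * pi)) *\<^sub>R chr_T n t) \<partial>lborel)"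
    by (rule integral_measure_T) simp
  also have "\<dots> = (if n = 0 then 1 else 0)"
  proof (cases "n = 0")
    case True
    then show ?thesis
      using integral_FTC_atLeastAtMost[of 0 "2 * pi" "\<lambda>t. (t / (2 * pi)) *\<^sub>R (1::complex)"
          "\<lambda>t. (1 / (2 * pi)) *\<^sub>R 1"]
      by (auto intro!: derivative_eq_intros continuous_intros)
  next
    case False
    define F where "F t = (1 / (2 * pi)) *\<^sub>R (chr_T n t / (\<i> * of_int n))" for t
    have "(\<integral>t. indicator {0..2 * pi} t *\<^sub>R ((1 / (2 * pi)) *\<^sub>R chr_T n t) \<partial>lborel) =
        F (2 * pi) - F 0"
    proof (rule integral_FTC_atLeastAtMost)
      fix t
      have "((\<lambda>t. exp (\<i> * (of_int n * t))) has_field_derivative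
          exp (\<i> * (of_int n * z)) * (\<i> * of_int n)) (at z)" for z :: complex
        by (auto intro!: derivative_eq_intros)
      then have "((\<lambda>t. exp (\<i> * (of_int n * complex_of_real t))) has_vector_derivative
          exp (\<i> * (of_int n * complex_of_real t)) * (\<i> * of_int n)) (at t within {0..2 * pi})"
        by (rule has_vector_derivative_real_field)
      from has_vector_derivative_scaleR[OF DERIV_const
          has_vector_derivative_mult_left[OF this, of "1 / (\<i> * of_int n)"], of "1 / (2 * pi)"]
      show "(F has_vector_derivative (1 / (2 * pi)) *\<^sub>R chr_T n t) (at t within {0..2 * pi})"
        using False unfolding F_def chr_T_def cis_conv_exp by (simp add: field_simps)
    qed (auto intro!: continuous_intros continuous_on_chr_T)
    also have "F (2 * pi) = F 0"
      using chr_T_periodic[of n "2 * pi" 1] by (simp add: F_def)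
    finally show ?thesis using False by simp
  qed
  finally show ?thesis .
qed

lemma prob_space_measure_T: "prob_space measure_T"
proof
  have "emeasure measure_T {0..<2 * pi} = ennreal (1 / (2 * pi)) * ennreal (2 * pi)"
    by (simp add: measure_T_def emeasure_restrict_space)
  also have "\<dots> = 1" by (simp flip: ennreal_mult)
  finally show "emeasure measure_T (space measure_T) = 1" by simp
qed

interpretation T: prob_space measure_T by (rule prob_space_measure_T)

text \<open>
  Trigonometric polynomials as an inductive predicate: closure under products and the integral
  against a family of measures are then two short inductions.
\<close>

inductive trig_poly :: "(real \<Rightarrow> complex) \<Rightarrow> bool" where
  chr: "trig_poly (\<lambda>t. c * chr_T n t)"
| add: "trig_poly f \<Longrightarrow> trig_poly g \<Longrightarrow> trig_poly (\<lambda>t. f t + g t)"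

lemma trig_poly_const: "trig_poly (\<lambda>_. c)"
  using trig_poly.chr[of c 0] by simp

lemma trig_poly_mult_chr: "trig_poly f \<Longrightarrow> trig_poly (\<lambda>t. c * chr_T n t * f t)"
proof (induction rule: trig_poly.induct)
  case (chr d m)
  show ?case using trig_poly.chr[of "c * d" "n + m"] by (simp add: chr_T_add mult_ac)
next
  case (add f g)
  then show ?case using trig_poly.add by (simp add: distrib_left)
qed

lemma trig_poly_mult: "trig_poly f \<Longrightarrow> trig_poly g \<Longrightarrow> trig_poly (\<lambda>t. f t * g t)"
proof (induction rule: trig_poly.induct)
  case (chr c n)
  then show ?case by (rule trig_poly_mult_chr)
next
  case (add f f')
  then show ?case using trig_poly.add by (simp add: distrib_right)
qed

lemma trig_poly_real_polynomial:
  "real_polynomial_function g \<Longrightarrow> trig_poly (\<lambda>t. complex_of_real (g (cis t)))"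
proof (induction rule: real_polynomial_function.induct)
  case (linear g)
  interpret g: bounded_linear g by fact
  have cs: "complex_of_real (cos t) = (chr_T 1 t + chr_T (-1) t) / 2"
    "complex_of_real (sin t) = (chr_T 1 t - chr_T (-1) t) / (2 * \<i>)" for t
    by (auto simp: chr_T_def complex_eq_iff)
  have "complex_of_real (g (cis t)) =
      (of_real (g 1) / 2 + of_real (g \<i>) / (2 * \<i>)) * chr_T 1 t +
      (of_real (g 1) / 2 - of_real (g \<i>) / (2 * \<i>)) * chr_T (-1) t" for t
  proof -
    have "cis t = cos t *\<^sub>R 1 + sin t *\<^sub>R \<i>" by (simp add: complex_eq_iff)
    then have "g (cis t) = cos t * g 1 + sin t * g \<i>" by (simp add: g.add g.scaleR)
    then show ?thesis by (simp add: cs field_simps)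
  qed
  then show ?case using trig_poly.add[OF trig_poly.chr trig_poly.chr] by simp
next
  case (const c)
  show ?case by (rule trig_poly_const)
next
  case (add f g)
  then show ?case using trig_poly.add by simp
next
  case (mult f g)
  then show ?case using trig_poly_mult by simp
qed

text \<open>
  A Borel measurable inverse of the parametrisation \<open>cis\<close> of the unit circle; it transfers sets
  of angles to sets of complex numbers. The truncation keeps \<open>arccos\<close> within its domain of continuity.
\<close>

definition angle :: "complex \<Rightarrow> real" where
  "angle z = (let s = arccos (max (-1) (min 1 (Re z))) in if 0 \<le> Im z then s else 2 * pi - s)"

lemma angle_measurable [measurable]: "angle \<in> borel_measurable borel"
proof -
  have [measurable]: "(\<lambda>z. arccos (max (-1) (min 1 (Re z)))) \<in> borel_measurable borel"
    by (intro borel_measurable_continuous_onI continuous_on_arccos continuous_intros) auto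
  show ?thesis unfolding angle_def Let_def by measurable
qed

lemma angle_cis:
  assumes "0 \<le> t" "t < 2 * pi"
  shows "angle (cis t) = t"
proof (cases "t \<le> pi")
  case True
  then show ?thesis using assms by (auto simp: angle_def arccos_cos sin_ge_zero)
next
  case False
  then have "sin t < 0" using assms by (intro sin_lt_zero) auto
  moreover have "arccos (cos t) = 2 * pi - t"
    using arccos_cos[of "2 * pi - t"] assms False by (simp add: cos_diff)
  ultimately show ?thesis by (simp add: angle_def)
qed

text \<open>
  Integrals of trigonometric polynomials are finite linear combinations of Fourier coefficients, so
  they depend measurably on the parameter. This passes to continuous functions on the
  unit circle by the Stone--Weierstrass theorem, to closed sets by approximation of their
  indicators, and to Borel sets because the closed sets form a generator stable under intersection.
\<close>

lemma kernel_measurable: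
  assumes fin: "\<And>x. x \<in> space X \<Longrightarrow> finite_measure (K x)"
    and sets_K: "\<And>x. x \<in> space X \<Longrightarrow> sets (K x) = sets measure_T"
    and coeff: "\<And>n. (\<lambda>x. \<integral>t. chr_T n t \<partial>K x) \<in> borel_measurable X"
    and A: "A \<in> sets measure_T"
  shows "(\<lambda>x. measure (K x) A) \<in> borel_measurable X"
proof -
  have space_K: "space (K x) = {0..<2 * pi}" if "x \<in> space X" for x
    using sets_eq_imp_space_eq[OF sets_K[OF that]] by simp
  have cont_int: "integrable (K x) (\<lambda>t. g (cis t))" if "x \<in> space X" "continuous_on UNIV g"
    for g :: "complex \<Rightarrow> 'b::{banach, second_countable_topology}" and x
  proof -
    interpret finite_measure "K x" by (rule fin[OF that(1)])
    have "compact (g ` sphere 0 1)"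
      by (intro compact_continuous_image continuous_on_subset[OF that(2)]) auto
    then obtain B where "\<forall>y\<in>g ` sphere 0 1. norm y \<le> B"
      using compact_imp_bounded[of "g ` sphere 0 1"] unfolding bounded_iff by blast
    then have B: "norm (g z) \<le> B" if "cmod z = 1" for z using that by auto
    show ?thesis
    proof (rule integrable_const_bound[where B=B])
      show "(\<lambda>t. g (cis t)) \<in> borel_measurable (K x)"
        by (rule measurable_sets_T[OF sets_K[OF that(1)]])
           (rule measurable_compose[OF borel_measurable_cis borel_measurable_continuous_onI[OF that(2)]])
    qed (use B in auto)
  qed
  have trig: "(\<forall>x\<in>space X. integrable (K x) f) \<and> (\<lambda>x. \<integral>t. f t \<partial>K x) \<in> borel_measurable X"
    if "trig_poly f" for f
    using that
  proof (induction rule: trig_poly.induct)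
    case (chr c n)
    have "integrable (K x) (chr_T n)" if "x \<in> space X" for x
    proof -
      interpret finite_measure "K x" by (rule fin[OF that])
      show ?thesis
        by (rule integrable_const_bound[where B=1])
           (simp_all add: measurable_sets_T[OF sets_K[OF that] borel_measurable_chr_T])
    qed
    then show ?case using coeff by auto
  next
    case (add f g)
    then have "(\<lambda>x. (\<integral>t. f t \<partial>K x) + (\<integral>t. g t \<partial>K x)) \<in> borel_measurable X" by auto
    moreover have "(\<integral>t. f t + g t \<partial>K x) = (\<integral>t. f t \<partial>K x) + (\<integral>t. g t \<partial>K x)"
      if "x \<in> space X" for x
      using add that by (intro Bochner_Integration.integral_add) auto
    ultimately show ?case using add by (auto cong: measurable_cong)
  qed
  have poly: "(\<lambda>x. \<integral>t. g (cis t) \<partial>K x) \<in> borel_measurable X" if "real_polynomial_function g" for g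
  proof -
    have "(\<lambda>x. complex_of_real (\<integral>t. g (cis t) \<partial>K x)) \<in> borel_measurable X"
      using trig[OF trig_poly_real_polynomial[OF that]] by simp
    then have "(\<lambda>x. Re (complex_of_real (\<integral>t. g (cis t) \<partial>K x))) \<in> borel_measurable X"
      by measurable
    then show ?thesis by (simp only: Re_complex_of_real)
  qed
  have cont: "(\<lambda>x. \<integral>t. g (cis t) \<partial>K x) \<in> borel_measurable X"
    if g: "continuous_on UNIV g" for g :: "complex \<Rightarrow> real"
  proof -
    have ex: "\<exists>p. real_polynomial_function p \<and> (\<forall>z\<in>sphere 0 1. \<bar>g z - p z\<bar> < 1 / Suc i)" for i
    proof -
      have "continuous_on (sphere 0 1) g" using g by (rule continuous_on_subset) simp
      moreover have "0 < 1 / real (Suc i)" by simp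
      ultimately obtain p where p: "real_polynomial_function p"
        "\<And>z. z \<in> sphere 0 1 \<Longrightarrow> \<bar>g z - p z\<bar> < 1 / real (Suc i)"
        using Stone_Weierstrass_real_polynomial_function[OF compact_sphere] by blast
      show ?thesis by (intro exI[of _ p] conjI ballI p)
    qed
    obtain p where p': "\<forall>i. real_polynomial_function (p i) \<and>
        (\<forall>z\<in>sphere 0 1. \<bar>g z - p i z\<bar> < 1 / Suc i)"
      by (rule exE[OF choice[OF allI[OF ex]]])
    have p: "real_polynomial_function (p i)" for i by (rule p'[rule_format, THEN conjunct1])
    have approx: "\<bar>g z - p i z\<bar> < 1 / Suc i" if "cmod z = 1" for i z
      using p'[rule_format, THEN conjunct2, rule_format, of z i] that by simp
    have contp: "continuous_on UNIV (p i)" for i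
      by (rule continuous_on_polymonial_function) (simp add: p flip: real_polynomial_function_eq)
    show ?thesis
    proof (rule borel_measurable_LIMSEQ_real)
      show "(\<lambda>x. \<integral>t. p i (cis t) \<partial>K x) \<in> borel_measurable X" for i by (rule poly[OF p])
      fix x assume x: "x \<in> space X"
      interpret finite_measure "K x" by (rule fin[OF x])
      have le: "\<bar>(\<integral>t. p i (cis t) \<partial>K x) - (\<integral>t. g (cis t) \<partial>K x)\<bar> \<le>
          measure (K x) (space (K x)) * (1 / Suc i)" for i
      proof -
        have "\<bar>(\<integral>t. p i (cis t) \<partial>K x) - (\<integral>t. g (cis t) \<partial>K x)\<bar> =
            \<bar>\<integral>t. p i (cis t) - g (cis t) \<partial>K x\<bar>"
          using cont_int[OF x contp] cont_int[OF x g] by simp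
        also have "\<dots> \<le> (\<integral>t. \<bar>p i (cis t) - g (cis t)\<bar> \<partial>K x)" by (rule integral_abs_bound)
        also have "\<dots> \<le> (\<integral>t. 1 / Suc i \<partial>K x)"
          using cont_int[OF x contp] cont_int[OF x g] approx[of "cis _" i]
          by (intro integral_mono) (auto simp: abs_minus_commute less_imp_le)
        finally show ?thesis by simp
      qed
      have "(\<lambda>i. measure (K x) (space (K x)) * (1 / Suc i)) \<longlonglongrightarrow> measure (K x) (space (K x)) * 0"
        by (intro tendsto_intros LIMSEQ_inverse_real_of_nat[unfolded inverse_eq_divide])
      then have lim0: "(\<lambda>i. measure (K x) (space (K x)) * (1 / Suc i)) \<longlonglongrightarrow> 0" by simp
      have "(\<lambda>i. (\<integral>t. p i (cis t) \<partial>K x) - (\<integral>t. g (cis t) \<partial>K x)) \<longlonglongrightarrow> 0"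
      proof (rule Lim_null_comparison[OF _ lim0])
        show "eventually (\<lambda>i. norm ((\<integral>t. p i (cis t) \<partial>K x) - (\<integral>t. g (cis t) \<partial>K x)) \<le>
            measure (K x) (space (K x)) * (1 / Suc i)) sequentially"
          unfolding real_norm_def by (rule always_eventually[OF allI[OF le]])
      qed
      then show "(\<lambda>i. \<integral>t. p i (cis t) \<partial>K x) \<longlonglongrightarrow> (\<integral>t. g (cis t) \<partial>K x)"
        by (rule LIM_zero_cancel)
    qed
  qed
  have closed: "(\<lambda>x. measure (K x) (cis -` C \<inter> {0..<2 * pi})) \<in> borel_measurable X"
    if C: "closed C" for C
  proof (cases "C = {}")
    case False
    \<comment> \<open>Continuous functions that decrease to the indicator of \<open>C\<close>.\<close>
    define g where "g k z = max 0 (1 - real k * infdist z C)" for k z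
    have contg: "continuous_on UNIV (g k)" for k
      unfolding g_def by (intro continuous_intros)
    have lim: "(\<lambda>k. g k z) \<longlonglongrightarrow> indicator C z" for z
    proof (cases "z \<in> C")
      case True
      then show ?thesis by (simp add: g_def)
    next
      case z: False
      have pos: "0 < infdist z C" by (rule infdist_pos_not_in_closed[OF C False z])
      obtain k0 where k0: "1 / infdist z C < real k0" using reals_Archimedean2 by blast
      have "g k z = 0" if "k0 \<le> k" for k
      proof -
        have "1 < real k0 * infdist z C" using k0 pos by (simp add: divide_less_eq)
        also have "\<dots> \<le> real k * infdist z C" using that pos by (intro mult_right_mono) auto
        finally show ?thesis by (simp add: g_def)
      qed
      then have "eventually (\<lambda>k. g k z = indicator C z) sequentially"
        using z by (auto simp: eventually_sequentially)
      then show ?thesis by (rule tendsto_eventually)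
    qed
    show ?thesis
    proof (rule borel_measurable_LIMSEQ_real)
      show "(\<lambda>x. \<integral>t. g k (cis t) \<partial>K x) \<in> borel_measurable X" for k by (rule cont[OF contg])
      fix x assume x: "x \<in> space X"
      interpret finite_measure "K x" by (rule fin[OF x])
      have cis_meas: "cis \<in> K x \<rightarrow>\<^sub>M borel"
        by (rule measurable_sets_T[OF sets_K[OF x] borel_measurable_cis])
      have "(\<lambda>k. \<integral>t. g k (cis t) \<partial>K x) \<longlonglongrightarrow> (\<integral>t. indicator C (cis t) \<partial>K x)"
      proof (rule integral_dominated_convergence[where w="\<lambda>_. 1"])
        show "(\<lambda>t. indicator C (cis t) :: real) \<in> borel_measurable (K x)"
          using C by (intro measurable_compose[OF cis_meas]) auto
        show "AE t in K x. norm (g k (cis t)) \<le> 1" for k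
          by (auto simp: g_def infdist_nonneg)
      qed (use lim cont_int[OF x contg] in auto)
      moreover have "(\<integral>t. indicator C (cis t) \<partial>K x) = measure (K x) (cis -` C \<inter> {0..<2 * pi})"
      proof -
        have "(\<integral>t. indicator C (cis t) \<partial>K x) = (\<integral>t. indicator (cis -` C \<inter> {0..<2 * pi}) t \<partial>K x)"
          by (rule Bochner_Integration.integral_cong) (auto simp: indicator_def space_K[OF x])
        also have "\<dots> = measure (K x) (cis -` C \<inter> {0..<2 * pi})"
          by (simp add: space_K[OF x] Int_assoc)
        finally show ?thesis .
      qed
      ultimately show "(\<lambda>k. \<integral>t. g k (cis t) \<partial>K x) \<longlonglongrightarrow> measure (K x) (cis -` C \<inter> {0..<2 * pi})"
        by simp
    qed
  qed simp
  have borel: "(\<lambda>x. measure (K x) (cis -` B \<inter> {0..<2 * pi})) \<in> borel_measurable X"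
    if "B \<in> sets borel" for B
  proof -
    have gen: "B \<in> sigma_sets UNIV (Collect closed)"
      using that by (simp add: borel_eq_closed)
    have stable: "Int_stable (Collect closed :: complex set set)" by (auto simp: Int_stable_def)
    have "Collect closed \<subseteq> Pow (UNIV :: complex set)" by simp
    from stable this gen show ?thesis
    proof (induction rule: sigma_sets_induct_disjoint)
      case (basic C)
      then show ?case using closed by simp
    next
      case empty
      show ?case by simp
    next
      case (compl B)
      have "measure (K x) (cis -` (UNIV - B) \<inter> {0..<2 * pi}) =
          measure (K x) (space (K x)) - measure (K x) (cis -` B \<inter> {0..<2 * pi})"
        if x: "x \<in> space X" for x
      proof -
        interpret finite_measure "K x" by (rule fin[OF x])
        have "cis \<in> K x \<rightarrow>\<^sub>M borel"
          by (rule measurable_sets_T[OF sets_K[OF x] borel_measurable_cis])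
        moreover have "B \<in> sets borel" using compl by (simp add: borel_eq_closed)
        ultimately have "cis -` B \<inter> {0..<2 * pi} \<in> sets (K x)"
          using measurable_sets[of cis "K x" borel B] by (simp add: space_K[OF x])
        from finite_measure_compl[OF this]
        have "measure (K x) (space (K x) - (cis -` B \<inter> {0..<2 * pi})) =
            measure (K x) (space (K x)) - measure (K x) (cis -` B \<inter> {0..<2 * pi})" .
        moreover have "space (K x) - (cis -` B \<inter> {0..<2 * pi}) =
            cis -` (UNIV - B) \<inter> {0..<2 * pi}" by (auto simp: space_K[OF x])
        ultimately show ?thesis by simp
      qed
      moreover have "(\<lambda>x. measure (K x) (space (K x)) - measure (K x) (cis -` B \<inter> {0..<2 * pi}))
          \<in> borel_measurable X"
      proof -
        have "(\<lambda>x. measure (K x) (cis -` UNIV \<inter> {0..<2 * pi})) \<in> borel_measurable X"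
          by (rule closed) simp
        then have "(\<lambda>x. measure (K x) (space (K x))) \<in> borel_measurable X"
          using space_K by (simp cong: measurable_cong)
        then show ?thesis using compl by simp
      qed
      ultimately show ?case by (simp cong: measurable_cong)
    next
      case (union B)
      have "measure (K x) (cis -` (\<Union>i. B i) \<inter> {0..<2 * pi}) =
          (\<Sum>i. measure (K x) (cis -` B i \<inter> {0..<2 * pi}))" if x: "x \<in> space X" for x
      proof -
        interpret finite_measure "K x" by (rule fin[OF x])
        have "cis \<in> K x \<rightarrow>\<^sub>M borel"
          by (rule measurable_sets_T[OF sets_K[OF x] borel_measurable_cis])
        moreover have "B i \<in> sets borel" for i using union by (auto simp: borel_eq_closed)
        ultimately have "range (\<lambda>i. cis -` B i \<inter> {0..<2 * pi}) \<subseteq> sets (K x)"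
          using measurable_sets[of cis "K x" borel] by (auto simp: space_K[OF x])
        moreover have "disjoint_family (\<lambda>i. cis -` B i \<inter> {0..<2 * pi})"
          using union(1) by (auto simp: disjoint_family_on_def)
        ultimately have "(\<lambda>i. measure (K x) (cis -` B i \<inter> {0..<2 * pi})) sums
            measure (K x) (\<Union>i. cis -` B i \<inter> {0..<2 * pi})"
          by (rule finite_measure_UNION)
        moreover have "(\<Union>i. cis -` B i \<inter> {0..<2 * pi}) = cis -` (\<Union>i. B i) \<inter> {0..<2 * pi}" by auto
        ultimately show ?thesis by (simp add: sums_iff)
      qed
      moreover have "(\<lambda>x. \<Sum>i. measure (K x) (cis -` B i \<inter> {0..<2 * pi})) \<in> borel_measurable X"
        using union by (intro borel_measurable_suminf) auto
      ultimately show ?case by (simp cong: measurable_cong)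
    qed
  qed
  obtain A' where A': "A' \<in> sets borel" "A = A' \<inter> {0..<2 * pi}"
    using A by (auto simp: sets_measure_T sets_restrict_space)
  have "A = cis -` (angle -` A') \<inter> {0..<2 * pi}"
    unfolding A'(2) by (auto simp: angle_cis)
  moreover have "angle -` A' \<in> sets borel" using measurable_sets[OF angle_measurable A'(1)] by simp
  ultimately show ?thesis using borel by metis
qed

text \<open>
  Uniqueness is a special case of measurability: index the two measures by a two-point space with the
  trivial \<open>\<sigma>\<close>-algebra. Equal coefficients are measurable there, so the measure of every set is
  measurable too, that is, constant.
\<close>

lemma measure_eqI_Fourier:
  assumes N: "finite_measure N" "sets N = sets measure_T"
    and N': "finite_measure N'" "sets N' = sets measure_T"
    and eq: "\<And>n. (\<integral>t. chr_T n t \<partial>N) = (\<integral>t. chr_T n t \<partial>N')"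
  shows "N = N'"
proof (rule measure_eqI)
  show "sets N = sets N'" using N N' by simp
  fix A assume A: "A \<in> sets N"
  define X :: "bool measure" where "X = sigma UNIV {}"
  have sX: "space X = UNIV" "sets X = {{}, UNIV}"
    by (auto simp: X_def sigma_sets_empty_eq)
  have "(\<lambda>b. measure (if b then N else N') A) \<in> borel_measurable X"
  proof (rule kernel_measurable)
    have "(\<lambda>b. \<integral>t. chr_T n t \<partial>(if b then N else N')) = (\<lambda>_. \<integral>t. chr_T n t \<partial>N)" for n
      using eq by auto
    then show "(\<lambda>b. \<integral>t. chr_T n t \<partial>(if b then N else N')) \<in> borel_measurable X" for n
      by simp
  qed (use N N' A in auto)
  then have "(\<lambda>b. measure (if b then N else N') A) -` {measure N A} \<inter> space X \<in> sets X"
    by (rule measurable_sets) simp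
  then have "(\<lambda>b. measure (if b then N else N') A) -` {measure N A} \<in> {{}, UNIV}"
    unfolding sX by simp
  moreover have "True \<in> (\<lambda>b. measure (if b then N else N') A) -` {measure N A}" by simp
  ultimately have "False \<in> (\<lambda>b. measure (if b then N else N') A) -` {measure N A}" by blast
  then have "measure N' A = measure N A" by simp
  then show "emeasure N A = emeasure N' A"
    using finite_measure.emeasure_eq_measure N(1) N'(1) by metis
qed


section \<open>Series over the integers and Fejer means\<close>

lemma emeasure_density_space:
  "f \<in> borel_measurable M \<Longrightarrow> emeasure (density M f) (space M) = (\<integral>\<^sup>+x. f x \<partial>M)"
  by (subst emeasure_density) (auto intro!: nn_integral_cong simp: indicator_def)

lemma filterlim_symmetric_intervals:
  "filterlim (\<lambda>n. {- int n..int n}) (finite_subsets_at_top UNIV) sequentially"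
  unfolding filterlim_finite_subsets_at_top
proof (intro allI impI)
  fix X :: "int set" assume X: "finite X \<and> X \<subseteq> UNIV"
  define N where "N = nat (Max ((\<lambda>x. \<bar>x\<bar>) ` insert 0 X))"
  have "\<bar>x\<bar> \<le> int N" if "x \<in> X" for x
  proof -
    have "\<bar>x\<bar> \<le> Max ((\<lambda>x. \<bar>x\<bar>) ` insert 0 X)" using X that by (intro Max_ge) auto
    moreover have "Max ((\<lambda>x. \<bar>x\<bar>) ` insert 0 X) \<le> int N" unfolding N_def by simp
    ultimately show ?thesis by linarith
  qed
  then have "X \<subseteq> {- int n..int n}" if "N \<le> n" for n
    using that by force
  then show "eventually (\<lambda>n. finite {- int n..int n} \<and> X \<subseteq> {- int n..int n} \<and>
      {- int n..int n} \<subseteq> UNIV) sequentially"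
    unfolding eventually_sequentially by blast
qed

lemma tendsto_symmetric_partial_sums:
  fixes f :: "int \<Rightarrow> 'b::{comm_monoid_add, t2_space}"
  assumes "f summable_on UNIV"
  shows "(\<lambda>n. \<Sum>k\<in>{- int n..int n}. f k) \<longlonglongrightarrow> infsum f UNIV"
  using has_sum_infsum[OF assms] filterlim_symmetric_intervals
  unfolding has_sum_def by (rule filterlim_compose)

lemma summable_on_norm_bound:
  fixes f :: "'k \<Rightarrow> complex"
  assumes "D summable_on A" "\<And>k. k \<in> A \<Longrightarrow> cmod (f k) \<le> D k"
  shows "(\<lambda>k. cmod (f k)) summable_on A" "f summable_on A" "cmod (infsum f A) \<le> infsum D A"
proof -
  show n: "(\<lambda>k. cmod (f k)) summable_on A"
    using assms by (intro summable_on_comparison_test[OF assms(1)]) auto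
  then show "f summable_on A" by (rule abs_summable_summable)
  have "cmod (infsum f A) \<le> (\<Sum>\<^sub>\<infinity>k\<in>A. cmod (f k))" by (rule norm_infsum_bound[OF n])
  also have "\<dots> \<le> infsum D A" using assms by (intro infsum_mono n) auto
  finally show "cmod (infsum f A) \<le> infsum D A" .
qed

text \<open>
  Dominated convergence for the counting measure.
\<close>

lemma tendsto_infsum_dominated:
  fixes a :: "nat \<Rightarrow> 'k \<Rightarrow> complex"
  assumes lim: "\<And>k. (\<lambda>n. a n k) \<longlonglongrightarrow> b k"
    and le: "\<And>n k. cmod (a n k) \<le> D k" and D: "D summable_on UNIV"
  shows "(\<lambda>n. \<Sum>\<^sub>\<infinity>k. a n k) \<longlonglongrightarrow> (\<Sum>\<^sub>\<infinity>k. b k)"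
proof -
  have le_b: "cmod (b k) \<le> D k" for k
    using lim le by (intro LIMSEQ_le_const2[OF tendsto_norm[OF lim]]) auto
  have D0: "0 \<le> D k" for k using le[of 0 k] norm_ge_zero order_trans by blast
  have "Infinite_Set_Sum.abs_summable_on D UNIV"
    using D D0 by (simp add: abs_summable_equivalent[symmetric])
  then have intD: "integrable (count_space UNIV) D" by (simp add: Infinite_Set_Sum.abs_summable_on_def)
  have eq: "infsum f UNIV = (\<integral>k. f k \<partial>count_space UNIV)" if "\<And>k. cmod (f k) \<le> D k"
    for f :: "'k \<Rightarrow> complex"
  proof -
    have "Infinite_Set_Sum.abs_summable_on f UNIV"
      using summable_on_norm_bound(1)[OF D that] by (simp add: abs_summable_equivalent)
    from infsetsum_infsum[OF this] show ?thesis by (simp add: infsetsum_def)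
  qed
  have "(\<lambda>n. \<integral>k. a n k \<partial>count_space UNIV) \<longlonglongrightarrow> (\<integral>k. b k \<partial>count_space UNIV)"
    by (rule integral_dominated_convergence[where w=D]) (use lim le intD in auto)
  then show ?thesis using eq le le_b by simp
qed

text \<open>
  An absolutely convergent function series is the limit of its symmetric partial sums, which
  are uniformly bounded; dominated convergence then permits integration term by term.
\<close>

lemma integral_infsum_mult:
  fixes u :: "int \<Rightarrow> complex" and e :: "int \<Rightarrow> 'a \<Rightarrow> complex" and g :: "'a \<Rightarrow> complex"
  assumes u: "(\<lambda>k. cmod (u k)) summable_on UNIV" and e: "\<And>k. e k \<in> borel_measurable M"
    and e_le: "\<And>k x. cmod (e k x) \<le> 1" and g: "integrable M g"
  shows "integrable M (\<lambda>x. (\<Sum>\<^sub>\<infinity>k. u k * e k x) * g x)"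
    and "(\<integral>x. (\<Sum>\<^sub>\<infinity>k. u k * e k x) * g x \<partial>M) = (\<Sum>\<^sub>\<infinity>k. u k * (\<integral>x. e k x * g x \<partial>M))"
    and "(\<lambda>x. \<Sum>\<^sub>\<infinity>k. u k * e k x) \<in> borel_measurable M"
proof -
  define U where "U = (\<Sum>\<^sub>\<infinity>k. cmod (u k))"
  define S where "S x = (\<Sum>\<^sub>\<infinity>k. u k * e k x)" for x
  define s where "s n x = (\<Sum>k\<in>{- int n..int n}. u k * e k x)" for n x
  have term_le: "cmod (u k * e k x) \<le> cmod (u k)" for k x
    using e_le[of k x] by (simp add: norm_mult mult_left_le)
  have lim: "(\<lambda>n. s n x) \<longlonglongrightarrow> S x" for x
    unfolding s_def S_def
    by (intro tendsto_symmetric_partial_sums summable_on_norm_bound(2)[OF u] term_le)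
  have s_le: "cmod (s n x) \<le> U" for n x
  proof -
    have "cmod (s n x) \<le> (\<Sum>k\<in>{- int n..int n}. cmod (u k))"
      unfolding s_def by (intro order_trans[OF norm_sum] sum_mono term_le)
    also have "\<dots> \<le> U" unfolding U_def by (intro finite_sum_le_infsum u) auto
    finally show ?thesis .
  qed
  have s_meas: "s n \<in> borel_measurable M" for n
    unfolding s_def using e by (intro borel_measurable_sum borel_measurable_times) auto
  show S_meas: "(\<lambda>x. \<Sum>\<^sub>\<infinity>k. u k * e k x) \<in> borel_measurable M"
    unfolding S_def[symmetric] by (rule borel_measurable_LIMSEQ_metric[OF s_meas lim])
  have conv: "integrable M (\<lambda>x. S x * g x)"
    "(\<lambda>n. \<integral>x. s n x * g x \<partial>M) \<longlonglongrightarrow> (\<integral>x. S x * g x \<partial>M)"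
  proof -
    have le: "AE x in M. norm (s n x * g x) \<le> U * cmod (g x)" for n
      unfolding norm_mult by (intro AE_I2 mult_right_mono s_le norm_ge_zero)
    have ms: "(\<lambda>x. S x * g x) \<in> borel_measurable M" "(\<lambda>x. s n x * g x) \<in> borel_measurable M" for n
      using S_meas s_meas g unfolding S_def by (intro borel_measurable_times; simp)+
    have l: "AE x in M. (\<lambda>n. s n x * g x) \<longlonglongrightarrow> S x * g x"
      by (intro AE_I2 tendsto_mult lim tendsto_const)
    have w: "integrable M (\<lambda>x. U * cmod (g x))" using g by auto
    show "integrable M (\<lambda>x. S x * g x)"
      by (rule integrable_dominated_convergence[OF ms w l le])
    show "(\<lambda>n. \<integral>x. s n x * g x \<partial>M) \<longlonglongrightarrow> (\<integral>x. S x * g x \<partial>M)"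
      by (rule integral_dominated_convergence[OF ms w l le])
  qed
  show "integrable M (\<lambda>x. (\<Sum>\<^sub>\<infinity>k. u k * e k x) * g x)" using conv(1) by (simp add: S_def)
  have int_e: "integrable M (\<lambda>x. e k x * g x)" for k
  proof (rule Bochner_Integration.integrable_bound[OF g])
    show "(\<lambda>x. e k x * g x) \<in> borel_measurable M"
      using e[of k] g by (intro borel_measurable_times) simp_all
    show "AE x in M. norm (e k x * g x) \<le> norm (g x)"
      unfolding norm_mult by (intro AE_I2 mult_left_le_one_le e_le norm_ge_zero)
  qed
  have "(\<integral>x. s n x * g x \<partial>M) = (\<Sum>k\<in>{- int n..int n}. u k * (\<integral>x. e k x * g x \<partial>M))" for n
    unfolding s_def sum_distrib_right mult.assoc using int_e by simp
  moreover have "(\<lambda>n. \<Sum>k\<in>{- int n..int n}. u k * (\<integral>x. e k x * g x \<partial>M)) \<longlonglongrightarrow>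
      (\<Sum>\<^sub>\<infinity>k. u k * (\<integral>x. e k x * g x \<partial>M))"
  proof (rule tendsto_symmetric_partial_sums)
    have "cmod (u k * (\<integral>x. e k x * g x \<partial>M)) \<le> cmod (u k) * (\<integral>x. cmod (g x) \<partial>M)" for k
    proof -
      have "cmod (\<integral>x. e k x * g x \<partial>M) \<le> (\<integral>x. cmod (e k x * g x) \<partial>M)" by (rule integral_norm_bound)
      also have "\<dots> \<le> (\<integral>x. cmod (g x) \<partial>M)"
        using int_e g unfolding norm_mult
        by (intro integral_mono mult_left_le_one_le e_le norm_ge_zero)
           (simp_all flip: norm_mult)
      finally show ?thesis by (simp add: norm_mult mult_left_mono)
    qed
    moreover have "(\<lambda>k. cmod (u k) * (\<integral>x. cmod (g x) \<partial>M)) summable_on UNIV"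
      using u by (rule summable_on_cmult_left)
    ultimately show "(\<lambda>k. u k * (\<integral>x. e k x * g x \<partial>M)) summable_on UNIV"
      by (rule summable_on_norm_bound(2)[rotated])
  qed
  ultimately show "(\<integral>x. (\<Sum>\<^sub>\<infinity>k. u k * e k x) * g x \<partial>M) = (\<Sum>\<^sub>\<infinity>k. u k * (\<integral>x. e k x * g x \<partial>M))"
    using conv(2) LIMSEQ_unique unfolding S_def by simp
qed

text \<open>
  The Fejer weight $\max(0, 1 - |n|/K)$, with value 0 for $K = 0$ by division by zero.
\<close>

definition fejer_weight :: "nat \<Rightarrow> int \<Rightarrow> complex" where
  "fejer_weight K n = of_nat (nat (int K - \<bar>n\<bar>)) / of_nat K"

text \<open>
  The difference $n$ occurs for exactly $K - |n|$ of the pairs in the square.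
\<close>

lemma sum_differences:
  fixes f :: "int \<Rightarrow> complex"
  shows "(\<Sum>j=0..<int K. \<Sum>k=0..<int K. f (j - k)) =
    (\<Sum>n\<in>{- int K..int K}. of_nat (nat (int K - \<bar>n\<bar>)) * f n)"
proof -
  let ?P = "{0..<int K} \<times> {0..<int K}"
  have "(\<Sum>j=0..<int K. \<Sum>k=0..<int K. f (j - k)) = (\<Sum>p\<in>?P. f (fst p - snd p))"
    by (simp add: sum.cartesian_product case_prod_beta)
  also have "\<dots> = (\<Sum>n\<in>{- int K..int K}. \<Sum>p\<in>{p\<in>?P. fst p - snd p = n}. f (fst p - snd p))"
    by (rule sum.group[symmetric]) auto
  also have "\<dots> = (\<Sum>n\<in>{- int K..int K}. of_nat (nat (int K - \<bar>n\<bar>)) * f n)"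
  proof (rule sum.cong[OF refl])
    fix n assume "n \<in> {- int K..int K}"
    have "{p\<in>?P. fst p - snd p = n} = (\<lambda>j. (j, j - n)) ` {max 0 n..<min (int K) (int K + n)}"
      by (auto simp: image_iff)
    moreover have "inj_on (\<lambda>j. (j, j - n)) {max 0 n..<min (int K) (int K + n)}"
      by (auto simp: inj_on_def)
    ultimately have "card {p\<in>?P. fst p - snd p = n} = nat (int K - \<bar>n\<bar>)"
      by (simp add: card_image)
    moreover have "(\<Sum>p\<in>{p\<in>?P. fst p - snd p = n}. f (fst p - snd p)) =
        (\<Sum>p\<in>{p\<in>?P. fst p - snd p = n}. f n)"
      by (rule sum.cong) auto
    ultimately show "(\<Sum>p\<in>{p\<in>?P. fst p - snd p = n}. f (fst p - snd p)) =
        of_nat (nat (int K - \<bar>n\<bar>)) * f n" by simp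
  qed
  finally show ?thesis .
qed

lemma fejer_weight_le: "cmod (fejer_weight K n) \<le> 1"
  by (cases "K = 0") (auto simp: fejer_weight_def norm_divide divide_le_eq)

lemma fejer_weight_tendsto: "(\<lambda>K. fejer_weight K n) \<longlonglongrightarrow> 1"
proof -
  have "(\<lambda>K. complex_of_real (1 - \<bar>of_int n\<bar> / real K)) \<longlonglongrightarrow> complex_of_real (1 - 0)"
    by (intro tendsto_intros real_tendsto_divide_at_top[of _ "\<bar>of_int n\<bar>"] filterlim_real_sequentially)
  moreover have "eventually (\<lambda>K. complex_of_real (1 - \<bar>of_int n\<bar> / real K) = fejer_weight K n)
      sequentially"
    using eventually_ge_at_top[of "nat \<bar>n\<bar> + 1"]
  proof eventually_elim
    case (elim K)
    then have "real (nat (int K - \<bar>n\<bar>)) = real K - \<bar>of_int n\<bar>" by simp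
    then have "fejer_weight K n = complex_of_real ((real K - \<bar>of_int n\<bar>) / real K)"
      unfolding fejer_weight_def by (metis of_real_divide of_real_of_nat_eq)
    also have "(real K - \<bar>of_int n\<bar>) / real K = 1 - \<bar>of_int n\<bar> / real K"
      using elim by (simp add: diff_divide_distrib)
    finally show ?case by simp
  qed
  ultimately show ?thesis by (simp add: Lim_transform_eventually)
qed

lemma fejer_sum:
  fixes f :: "int \<Rightarrow> complex"
  shows "(\<Sum>j=0..<int K. \<Sum>k=0..<int K. f (j - k)) / of_nat K =
    (\<Sum>\<^sub>\<infinity>n. fejer_weight K n * f n)"
proof -
  have "(\<Sum>\<^sub>\<infinity>n. fejer_weight K n * f n) = (\<Sum>\<^sub>\<infinity>n\<in>{- int K..int K}. fejer_weight K n * f n)"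
    by (rule infsum_cong_neutral) (auto simp: fejer_weight_def)
  also have "\<dots> = (\<Sum>n\<in>{- int K..int K}. fejer_weight K n * f n)" by simp
  also have "\<dots> = (\<Sum>j=0..<int K. \<Sum>k=0..<int K. f (j - k)) / of_nat K"
    unfolding sum_differences fejer_weight_def sum_divide_distrib by (intro sum.cong) auto
  finally show ?thesis by simp
qed


section \<open>Positive definite sequences\<close>

text \<open>
  Only quadratic forms on the vectors $(e^{ijt})_j$, $0 \le j < K$, are tested: these forms are,
  up to the factor $K$, the Fejer means of the formal series $\sum_n h(n) e^{int}$.
\<close>

definition positive_definite :: "(int \<Rightarrow> complex) \<Rightarrow> bool" where
  "positive_definite h \<longleftrightarrow> (\<forall>K t.
     (\<Sum>j=0..<int K. \<Sum>k=0..<int K. h (j - k) * chr_T (j - k) t) \<in> \<real>\<^sub>\<ge>\<^sub>0)"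

lemma sum_chr_square:
  assumes "finite I"
  shows "(\<Sum>j\<in>I. \<Sum>k\<in>I. z j * cnj (z k)) = complex_of_real ((cmod (\<Sum>j\<in>I. z j))\<^sup>2)"
proof -
  have "(\<Sum>j\<in>I. \<Sum>k\<in>I. z j * cnj (z k)) = (\<Sum>j\<in>I. z j) * cnj (\<Sum>j\<in>I. z j)"
    by (simp add: sum_product)
  then show ?thesis by (simp only: complex_norm_square)
qed

lemma finite_measure_integrable_chr:
  assumes "finite_measure N" "sets N = sets measure_T"
  shows "integrable N (chr_T n)"
proof -
  interpret finite_measure N by fact
  show ?thesis
    by (rule integrable_const_bound[where B=1]) (simp_all add: measurable_sets_T[OF assms(2) borel_measurable_chr_T])
qed

text \<open>
  The quadratic form is the integral of $|\sum_j e^{ij(s-t)}|^2$.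
\<close>

lemma positive_definite_Fourier:
  assumes N: "finite_measure N" "sets N = sets measure_T"
  shows "positive_definite (\<lambda>n. \<integral>t. chr_T (- n) t \<partial>N)"
  unfolding positive_definite_def
proof (intro allI)
  fix K s
  have int: "integrable N (\<lambda>t. chr_T (- n) t * chr_T n s)" for n :: int
    using finite_measure_integrable_chr[OF N] by simp
  have square: "chr_T (- (j - k)) t * chr_T (j - k) s =
      (chr_T (- j) t * chr_T j s) * cnj (chr_T (- k) t * chr_T k s)" for j k t
    using chr_T_add[of "- j" k t] chr_T_add[of j "- k" s] by (simp add: cnj_chr_T)
  have "(\<Sum>j=0..<int K. \<Sum>k=0..<int K. (\<integral>t. chr_T (- (j - k)) t \<partial>N) * chr_T (j - k) s) =
      (\<Sum>j=0..<int K. \<Sum>k=0..<int K. \<integral>t. chr_T (- (j - k)) t * chr_T (j - k) s \<partial>N)"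
    by simp
  also have "\<dots> =
      (\<integral>t. (\<Sum>j=0..<int K. \<Sum>k=0..<int K. chr_T (- (j - k)) t * chr_T (j - k) s) \<partial>N)"
    by (simp only: Bochner_Integration.integral_sum[OF Bochner_Integration.integrable_sum[OF int]]
        Bochner_Integration.integral_sum[OF int])
  also have "\<dots> = (\<integral>t. complex_of_real ((cmod (\<Sum>j=0..<int K. chr_T (- j) t * chr_T j s))\<^sup>2) \<partial>N)"
    unfolding square by (simp only: sum_chr_square[OF finite_atLeastLessThan_int])
  finally show "(\<Sum>j=0..<int K. \<Sum>k=0..<int K. (\<integral>t. chr_T (- (j - k)) t \<partial>N) *
      chr_T (j - k) s) \<in> \<real>\<^sub>\<ge>\<^sub>0"
    by (simp only: integral_complex_of_real nonneg_Reals_of_real_iff) simp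
qed

text \<open>
  The sum of the series is the limit of its Fejer means, which are nonnegative.
\<close>

lemma positive_definite_series_nonneg:
  assumes h: "positive_definite h" and sum: "(\<lambda>n. cmod (h n)) summable_on UNIV"
  shows "(\<Sum>\<^sub>\<infinity>n. h n * chr_T n t) \<in> \<real>\<^sub>\<ge>\<^sub>0"
proof -
  have "(\<lambda>K. \<Sum>\<^sub>\<infinity>n. fejer_weight K n * (h n * chr_T n t)) \<longlonglongrightarrow> (\<Sum>\<^sub>\<infinity>n. h n * chr_T n t)"
  proof (rule tendsto_infsum_dominated[OF _ _ sum])
    show "(\<lambda>K. fejer_weight K n * (h n * chr_T n t)) \<longlonglongrightarrow> h n * chr_T n t" for n
      using tendsto_mult_right[OF fejer_weight_tendsto, of n "h n * chr_T n t"] by simp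
    show "cmod (fejer_weight K n * (h n * chr_T n t)) \<le> cmod (h n)" for K n
      using fejer_weight_le[of K n] by (simp add: norm_mult mult_left_le_one_le)
  qed
  moreover have "(\<Sum>\<^sub>\<infinity>n. fejer_weight K n * (h n * chr_T n t)) \<in> \<real>\<^sub>\<ge>\<^sub>0" for K
    unfolding fejer_sum[symmetric] using h
    by (auto simp: positive_definite_def complex_nonneg_Reals_iff Re_divide_of_nat Im_divide_of_nat)
  ultimately show ?thesis
    using closed_sequentially[OF closed_nonneg_Reals_complex] by fast
qed

definition fejer_poly :: "(int \<Rightarrow> complex) \<Rightarrow> nat \<Rightarrow> real \<Rightarrow> complex" where
  "fejer_poly h K t = (\<Sum>j=0..<int K. \<Sum>k=0..<int K. h (j - k) * chr_T (j - k) t) / of_nat K"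

lemma integrable_chr_T: "integrable measure_T (chr_T n)"
  by (rule finite_measure_integrable_chr) (auto simp: T.finite_measure_axioms)

lemma integrable_fejer_poly: "integrable measure_T (fejer_poly h K)"
  unfolding fejer_poly_def[abs_def] using integrable_chr_T
  by (intro integrable_divide Bochner_Integration.integrable_sum integrable_mult_right) auto

lemma fejer_poly_coeff:
  "(\<integral>t. chr_T (- n) t * fejer_poly h K t \<partial>measure_T) = fejer_weight K n * h n"
proof -
  have "(\<integral>t. chr_T (- n) t * fejer_poly h K t \<partial>measure_T) =
      (\<integral>t. (\<Sum>j=0..<int K. \<Sum>k=0..<int K. h (j - k) * chr_T (- n + (j - k)) t) / of_nat K \<partial>measure_T)"
    unfolding fejer_poly_def
    by (simp only: times_divide_eq_right sum_distrib_left chr_T_add[of "- n"] mult.left_commute)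
  also have "\<dots> = (\<Sum>j=0..<int K. \<Sum>k=0..<int K. h (j - k) * (\<integral>t. chr_T (- n + (j - k)) t \<partial>measure_T))
      / of_nat K"
    using integrable_chr_T by (simp add: Bochner_Integration.integral_sum)
  also have "\<dots> = (\<Sum>\<^sub>\<infinity>m. fejer_weight K m * (h m * (\<integral>t. chr_T (- n + m) t \<partial>measure_T)))"
    by (rule fejer_sum)
  also have "\<dots> = (\<Sum>\<^sub>\<infinity>m\<in>{n}. fejer_weight K m * (h m * (\<integral>t. chr_T (- n + m) t \<partial>measure_T)))"
    by (rule infsum_cong_neutral) (auto simp: integral_chr_T)
  finally show ?thesis by (simp add: integral_chr_T)
qed

lemma fejer_poly_nonneg:
  assumes "positive_definite h"
  shows "fejer_poly h K t \<in> \<real>\<^sub>\<ge>\<^sub>0"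
  using assms unfolding positive_definite_def fejer_poly_def
  by (auto simp: complex_nonneg_Reals_iff Re_divide_of_nat Im_divide_of_nat)

lemma positive_definite_0:
  assumes "positive_definite h"
  shows "h 0 \<in> \<real>\<^sub>\<ge>\<^sub>0"
proof -
  have "{0..<int 1} = {0}" by auto
  then show ?thesis using fejer_poly_nonneg[OF assms, of 1 0] by (simp add: fejer_poly_def)
qed

text \<open>
  The Fejer polynomials are nonnegative with mean \<open>h 0\<close>. If this is 0, then they vanish almost
  everywhere, and so do all their coefficients.
\<close>

lemma positive_definite_zero:
  assumes h: "positive_definite h" and h0: "h 0 = 0"
  shows "h n = 0"
proof -
  have "fejer_weight K n * h n = 0" for K
  proof -
    have P: "fejer_poly h K t = complex_of_real (cmod (fejer_poly h K t))" for t
      using fejer_poly_nonneg[OF h, of K t]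
      by (auto simp: complex_nonneg_Reals_iff complex_eq_iff cmod_eq_Re)
    have "(\<integral>t. chr_T (- 0) t * fejer_poly h K t \<partial>measure_T) = 0"
      unfolding fejer_poly_coeff by (simp add: h0)
    then have "complex_of_real (\<integral>t. cmod (fejer_poly h K t) \<partial>measure_T) = 0"
      by (simp add: P[symmetric] flip: integral_complex_of_real)
    then have mean: "(\<integral>t. cmod (fejer_poly h K t) \<partial>measure_T) = 0" by (simp only: of_real_eq_0_iff)
    have "cmod (\<integral>t. chr_T (- n) t * fejer_poly h K t \<partial>measure_T) \<le>
        (\<integral>t. cmod (chr_T (- n) t * fejer_poly h K t) \<partial>measure_T)" by (rule integral_norm_bound)
    also have "\<dots> = 0" by (simp add: norm_mult mean)
    finally show ?thesis by (simp only: fejer_poly_coeff norm_le_zero_iff)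
  qed
  moreover have "(\<lambda>K. fejer_weight K n * h n) \<longlonglongrightarrow> 1 * h n"
    by (intro tendsto_mult fejer_weight_tendsto tendsto_const)
  ultimately have "(\<lambda>K. 0) \<longlonglongrightarrow> 1 * h n" by (simp only:)
  then show ?thesis by (simp add: LIMSEQ_const_iff)
qed

text \<open>
  The Fejer polynomials are probability densities whose Fourier coefficients converge to \<open>h\<close>. Viewed
  on the real line the measures are supported in a common bounded interval, so a subsequence
  converges weakly. The values of the characteristic function of the limit at the integers are
  then given by \<open>h\<close>, and winding the real line around the circle does not change them.
\<close>

lemma Herglotz:
  assumes h: "positive_definite h" and h0: "h 0 = 1"
  shows "\<exists>N. prob_space N \<and> sets N = sets measure_T \<and> (\<forall>n. (\<integral>t. chr_T (- n) t \<partial>N) = h n)"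
proof -
  define p where "p K t = Re (fejer_poly h K t)" for K t
  have p_nn: "0 \<le> p K t" and Pp: "fejer_poly h K t = complex_of_real (p K t)" for K t
    using fejer_poly_nonneg[OF h, of K t] by (auto simp: p_def complex_nonneg_Reals_iff complex_eq_iff)
  have int_p: "integrable measure_T (p K)" for K
    unfolding p_def using integrable_fejer_poly by simp
  then have p_meas [measurable]: "p K \<in> borel_measurable measure_T" for K by simp
  define D where "D K = density measure_T (\<lambda>t. ennreal (p K t))" for K
  have id_D: "(\<lambda>t. t) \<in> D K \<rightarrow>\<^sub>M borel" for K
    unfolding D_def by (simp add: measurable_measure_T)
  have coeff_D: "(\<integral>t. chr_T (- n) t \<partial>D K) = fejer_weight K n * h n" for n K
  proof -
    have "(\<integral>t. chr_T (- n) t \<partial>D K) = (\<integral>t. p K t *\<^sub>R chr_T (- n) t \<partial>measure_T)"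
      unfolding D_def using p_nn by (intro integral_density) (simp_all add: measurable_measure_T)
    also have "\<dots> = (\<integral>t. chr_T (- n) t * fejer_poly h K t \<partial>measure_T)"
      by (simp add: Pp scaleR_conv_of_real mult.commute)
    finally show ?thesis by (simp add: fejer_poly_coeff)
  qed
  \<comment> \<open>The index is shifted because the Fejer polynomial for \<open>K = 0\<close> is 0.\<close>
  define R where "R K = distr (D (Suc K)) borel (\<lambda>t. t)" for K
  have "prob_space (D (Suc K))" for K
  proof
    have "(\<integral>t. fejer_poly h (Suc K) t \<partial>measure_T) = 1"
      using fejer_poly_coeff[of 0 h "Suc K"] h0 by (simp add: fejer_weight_def del: of_nat_Suc)
    then have "complex_of_real (\<integral>t. p (Suc K) t \<partial>measure_T) = 1"
      by (simp only: Pp integral_complex_of_real)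
    then have "(\<integral>t. p (Suc K) t \<partial>measure_T) = 1" by (simp only: of_real_eq_1_iff)
    moreover have "emeasure (D (Suc K)) (space (D (Suc K))) = (\<integral>\<^sup>+t. ennreal (p (Suc K) t) \<partial>measure_T)"
      unfolding D_def by (simp add: emeasure_density_space del: space_measure_T)
    moreover have "\<dots> = ennreal (\<integral>t. p (Suc K) t \<partial>measure_T)"
      using int_p p_nn by (intro nn_integral_eq_integral) auto
    ultimately show "emeasure (D (Suc K)) (space (D (Suc K))) = 1" by simp
  qed
  then have rd: "real_distribution (R K)" for K
    unfolding R_def by (intro real_distribution.intro real_distribution_axioms.intro
        prob_space.prob_space_distr id_D) auto
  have char_R: "char (R K) (- of_int n) = fejer_weight (Suc K) n * h n" for K n
  proof -
    have "char (R K) (- of_int n) = (\<integral>t. chr_T (- n) t \<partial>R K)"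
      unfolding char_def chr_T_def cis_conv_exp by simp
    also have "\<dots> = (\<integral>t. chr_T (- n) t \<partial>D (Suc K))"
      unfolding R_def by (rule integral_distr[OF id_D]) simp
    finally show ?thesis using coeff_D by simp
  qed
  have "tight R"
    unfolding tight_def
  proof (intro conjI allI impI)
    show "real_distribution (R K)" for K by (rule rd)
    fix \<epsilon> :: real assume "0 < \<epsilon>"
    \<comment> \<open>Tightness uses intervals open on the left, so the left end must lie below 0.\<close>
    have "measure (R K) {-1<..2 * pi} = 1" for K
    proof -
      interpret DK: prob_space "D (Suc K)" by fact
      have "measure (R K) {-1<..2 * pi} = measure (D (Suc K)) ((\<lambda>t. t) -` {-1<..2 * pi} \<inter> space (D (Suc K)))"
        unfolding R_def by (rule measure_distr[OF id_D]) simp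
      also have "(\<lambda>t. t) -` {-1<..2 * pi} \<inter> space (D (Suc K)) = space (D (Suc K))"
        unfolding D_def by auto
      finally show ?thesis by (simp add: DK.prob_space)
    qed
    moreover have "(-1::real) < 2 * pi" using pi_gt_zero by linarith
    ultimately show "\<exists>a b. a < b \<and> (\<forall>n. 1 - \<epsilon> < measure (R n) {a<..b})"
      using \<open>0 < \<epsilon>\<close> by (intro exI[of _ "-1"] exI[of _ "2 * pi"]) simp
  qed
  from tight_imp_convergent_subsubsequence[OF this strict_mono_id]
  obtain r Q where r: "strict_mono r" and Q: "real_distribution Q"
    and weak: "weak_conv_m (R \<circ> id \<circ> r) Q" by (auto simp: id_def strict_mono_def)
  interpret Q: real_distribution Q by fact
  have char_Q: "char Q (- of_int n) = h n" for n
  proof -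
    have "(\<lambda>i. char ((R \<circ> id \<circ> r) i) (- of_int n)) \<longlonglongrightarrow> char Q (- of_int n)"
      by (rule levy_continuity1[OF _ Q weak]) (simp add: rd)
    moreover have "(\<lambda>i. fejer_weight (Suc (r i)) n * h n) \<longlonglongrightarrow> 1 * h n"
    proof (intro tendsto_mult tendsto_const)
      have "filterlim (\<lambda>i. Suc (r i)) at_top sequentially"
        using filterlim_compose[OF filterlim_Suc filterlim_subseq[OF r]] .
      then show "(\<lambda>i. fejer_weight (Suc (r i)) n) \<longlonglongrightarrow> 1"
        by (rule filterlim_compose[OF fejer_weight_tendsto])
    qed
    ultimately show ?thesis using LIMSEQ_unique by (auto simp: char_R)
  qed
  define wrap where "wrap x = x - 2 * pi * of_int \<lfloor>x / (2 * pi)\<rfloor>" for x :: real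
  have wrap_meas: "wrap \<in> Q \<rightarrow>\<^sub>M measure_T"
  proof -
    have "wrap \<in> borel_measurable borel" unfolding wrap_def by measurable
    moreover have "wrap x \<in> {0..<2 * pi}" for x
    proof -
      have "of_int \<lfloor>x / (2 * pi)\<rfloor> * (2 * pi) \<le> x" "x < (of_int \<lfloor>x / (2 * pi)\<rfloor> + 1) * (2 * pi)"
        by (simp_all flip: pos_le_divide_eq pos_divide_less_eq)
      then show ?thesis by (simp add: wrap_def algebra_simps)
    qed
    ultimately have "wrap \<in> borel \<rightarrow>\<^sub>M restrict_space borel {0..<2 * pi}"
      by (intro measurable_restrict_space2) auto
    then show ?thesis
      by (subst measurable_cong_sets[OF Q.events_eq_borel sets_measure_T])
  qed
  define N where "N = distr Q measure_T wrap"
  have "prob_space N" unfolding N_def by (rule Q.prob_space_distr[OF wrap_meas])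
  moreover have "sets N = sets measure_T" by (simp add: N_def)
  moreover have "(\<integral>t. chr_T (- n) t \<partial>N) = h n" for n
  proof -
    have "(\<integral>t. chr_T (- n) t \<partial>N) = (\<integral>x. chr_T (- n) (wrap x) \<partial>Q)"
      unfolding N_def by (rule integral_distr[OF wrap_meas]) (simp add: measurable_measure_T)
    also have "\<dots> = (\<integral>x. chr_T (- n) x \<partial>Q)" by (simp add: wrap_def chr_T_periodic)
    also have "\<dots> = char Q (- of_int n)"
      unfolding char_def chr_T_def cis_conv_exp by simp
    finally show ?thesis by (simp add: char_Q)
  qed
  ultimately show ?thesis by blast
qed

text \<open>
  The sum of the Fourier series is nonnegative because the coefficients of a measure are positive
  definite. It is therefore the density of a measure, which has the right coefficients.
\<close>

lemma density_Fourier_series: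
  assumes N: "finite_measure N" "sets N = sets measure_T"
    and sum: "(\<lambda>n. cmod (\<integral>t. chr_T (- n) t \<partial>N)) summable_on UNIV"
  shows "N = density measure_T (\<lambda>t. ennreal (Re (\<Sum>\<^sub>\<infinity>n. (\<integral>s. chr_T (- n) s \<partial>N) * chr_T n t)))"
proof -
  define u where "u n = (\<integral>s. chr_T (- n) s \<partial>N)" for n
  define S where "S t = (\<Sum>\<^sub>\<infinity>n. u n * chr_T n t)" for t
  have u: "(\<lambda>n. cmod (u n)) summable_on UNIV" using sum by (simp add: u_def)
  have S_nn: "S t \<in> \<real>\<^sub>\<ge>\<^sub>0" for t
    unfolding S_def using positive_definite_series_nonneg[OF _ u] positive_definite_Fourier[OF N]
    by (simp add: u_def)
  then have S_Re: "S t = complex_of_real (Re (S t))" "0 \<le> Re (S t)" for t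
    by (auto simp: complex_nonneg_Reals_iff complex_eq_iff)
  note int_chr = integrable_chr_T
  note series = integral_infsum_mult[where e=chr_T and M=measure_T,
      OF u measurable_measure_T[OF borel_measurable_chr_T] eq_refl[OF cmod_chr_T],
      folded S_def]
  have S_meas [measurable]: "S \<in> borel_measurable measure_T"
    using series(3)[OF int_chr] unfolding S_def .
  have int_S: "integrable measure_T S"
    using series(1)[OF int_chr, of 0] unfolding S_def by simp
  define D where "D = density measure_T (\<lambda>t. ennreal (Re (S t)))"
  have "N = D"
  proof (rule measure_eqI_Fourier[OF N])
    show "sets D = sets measure_T" by (simp add: D_def)
    show "finite_measure D"
    proof (rule finite_measureI)
      have "emeasure D (space D) = (\<integral>\<^sup>+t. ennreal (Re (S t)) \<partial>measure_T)"
        unfolding D_def by (simp add: emeasure_density_space del: space_measure_T)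
      also have "\<dots> = ennreal (\<integral>t. Re (S t) \<partial>measure_T)"
        using int_S S_Re by (intro nn_integral_eq_integral) auto
      finally show "emeasure D (space D) \<noteq> \<infinity>" by simp
    qed
    fix n
    have "(\<integral>t. chr_T n t \<partial>D) = (\<integral>t. Re (S t) *\<^sub>R chr_T n t \<partial>measure_T)"
      unfolding D_def using S_Re by (intro integral_density) (simp_all add: measurable_measure_T)
    also have "\<dots> = (\<integral>t. S t * chr_T n t \<partial>measure_T)"
      by (subst (2) S_Re) (simp add: scaleR_conv_of_real)
    also have "\<dots> = (\<Sum>\<^sub>\<infinity>k. u k * (\<integral>t. chr_T k t * chr_T n t \<partial>measure_T))"
      using series(2)[OF int_chr] unfolding S_def .
    also have "\<dots> = (\<Sum>\<^sub>\<infinity>k\<in>{- n}. u k * (\<integral>t. chr_T k t * chr_T n t \<partial>measure_T))"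
      by (rule infsum_cong_neutral) (auto simp: integral_chr_T simp flip: chr_T_add)
    also have "\<dots> = (\<integral>t. chr_T n t \<partial>N)"
      by (simp add: integral_chr_T u_def flip: chr_T_add)
    finally show "(\<integral>t. chr_T n t \<partial>N) = (\<integral>t. chr_T n t \<partial>D)" by simp
  qed
  then show ?thesis unfolding D_def S_def u_def .
qed

lemma le_scale_measure_T:
  assumes N: "finite_measure N" "sets N = sets measure_T"
    and sum: "(\<lambda>n. cmod (\<integral>t. chr_T (- n) t \<partial>N)) summable_on UNIV"
    and le: "(\<Sum>\<^sub>\<infinity>n. cmod (\<integral>t. chr_T (- n) t \<partial>N)) \<le> B"
  shows "N \<le> scale_measure (ennreal B) measure_T"
proof (subst le_measure)
  show "sets N = sets (scale_measure (ennreal B) measure_T)" using N by simp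
  define \<rho> where "\<rho> t = Re (\<Sum>\<^sub>\<infinity>n. (\<integral>s. chr_T (- n) s \<partial>N) * chr_T n t)" for t
  have N_eq: "N = density measure_T (\<lambda>t. ennreal (\<rho> t))"
    unfolding \<rho>_def by (rule density_Fourier_series[OF N sum])
  have \<rho>_le: "\<rho> t \<le> B" for t
  proof -
    have "\<rho> t \<le> cmod (\<Sum>\<^sub>\<infinity>n. (\<integral>s. chr_T (- n) s \<partial>N) * chr_T n t)"
      unfolding \<rho>_def by (rule complex_Re_le_cmod)
    also have "\<dots> \<le> B"
      using summable_on_norm_bound(3)[OF sum, of "\<lambda>n. (\<integral>s. chr_T (- n) s \<partial>N) * chr_T n t"] le
      by (simp add: norm_mult)
    finally show ?thesis .
  qed
  have \<rho>_meas: "(\<lambda>t. ennreal (\<rho> t)) \<in> borel_measurable measure_T"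
  proof -
    have "(\<lambda>t. \<Sum>\<^sub>\<infinity>n. (\<integral>s. chr_T (- n) s \<partial>N) * chr_T n t) \<in> borel_measurable measure_T"
      by (rule integral_infsum_mult(3)[OF sum measurable_measure_T[OF borel_measurable_chr_T], of _ "\<lambda>_. 1"])
         auto
    then show ?thesis unfolding \<rho>_def by measurable
  qed
  show "\<forall>A\<in>sets N. emeasure N A \<le> emeasure (scale_measure (ennreal B) measure_T) A"
  proof
    fix A assume "A \<in> sets N"
    then have A: "A \<in> sets measure_T" using N by simp
    have "emeasure N A = (\<integral>\<^sup>+t. ennreal (\<rho> t) * indicator A t \<partial>measure_T)"
      by (subst N_eq) (rule emeasure_density[OF \<rho>_meas A])
    also have "\<dots> \<le> (\<integral>\<^sup>+t. ennreal B * indicator A t \<partial>measure_T)"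
      using \<rho>_le by (intro nn_integral_mono mult_right_mono ennreal_leI) auto
    also have "\<dots> = ennreal B * emeasure measure_T A" using A by (simp add: nn_integral_cmult_indicator)
    finally show "emeasure N A \<le> emeasure (scale_measure (ennreal B) measure_T) A" by simp
  qed
qed


section \<open>Averages over the rows of a matrix with summable diagonals\<close>

lemma bij_int_shift: "bij (\<lambda>j. j + n :: int)"
  by (rule bij_betw_byWitness[where f'="\<lambda>j. j - n"]) auto

lemma bij_int_reflect: "bij (\<lambda>j. n - j :: int)"
  by (rule bij_betw_byWitness[where f'="\<lambda>j. n - j"]) auto

lemmas infsum_int_shift = infsum_reindex_bij_betw[OF bij_int_shift]
lemmas infsum_int_reflect = infsum_reindex_bij_betw[OF bij_int_reflect]
lemmas summable_on_int_shift = summable_on_reindex_bij_betw[OF bij_int_shift]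
lemmas summable_on_int_reflect = summable_on_reindex_bij_betw[OF bij_int_reflect]

lemma infsum_finite_sum:
  fixes f :: "'i \<Rightarrow> 'k \<Rightarrow> complex"
  assumes "finite I" "\<And>i. i \<in> I \<Longrightarrow> f i summable_on A"
  shows "(\<lambda>k. \<Sum>i\<in>I. f i k) summable_on A"
    and "(\<Sum>\<^sub>\<infinity>k\<in>A. \<Sum>i\<in>I. f i k) = (\<Sum>i\<in>I. \<Sum>\<^sub>\<infinity>k\<in>A. f i k)"
proof -
  have "(\<lambda>k. \<Sum>i\<in>I. f i k) summable_on A \<and>
    (\<Sum>\<^sub>\<infinity>k\<in>A. \<Sum>i\<in>I. f i k) = (\<Sum>i\<in>I. \<Sum>\<^sub>\<infinity>k\<in>A. f i k)"
    using assms
  proof (induction I rule: finite_induct)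
    case (insert i I)
    then show ?case by (simp add: summable_on_add infsum_add)
  qed simp
  then show "(\<lambda>k. \<Sum>i\<in>I. f i k) summable_on A"
    "(\<Sum>\<^sub>\<infinity>k\<in>A. \<Sum>i\<in>I. f i k) = (\<Sum>i\<in>I. \<Sum>\<^sub>\<infinity>k\<in>A. f i k)" by auto
qed

lemma infsum_of_real_nonneg:
  assumes "\<And>k. k \<in> I \<Longrightarrow> 0 \<le> r k"
  shows "(\<Sum>\<^sub>\<infinity>k\<in>I. complex_of_real (r k)) \<in> \<real>\<^sub>\<ge>\<^sub>0"
proof (cases "(\<lambda>k. complex_of_real (r k)) summable_on I")
  case True
  then have "0 \<le> (\<Sum>\<^sub>\<infinity>k\<in>I. complex_of_real (r k))"
    using assms by (intro infsum_nonneg_complex) (auto simp: less_eq_complex_def)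
  then show ?thesis by (auto simp: complex_nonneg_Reals_iff less_eq_complex_def)
qed (simp add: infsum_not_exists)

text \<open>
  Shifting an interval by $k$ exchanges at most $|k|$ of its elements. For bounded summands the effect on
  an average over a long interval is negligible.
\<close>

lemma sum_shift_difference_le:
  fixes g :: "int \<Rightarrow> complex"
  assumes "\<And>l. cmod (g l) \<le> D"
  shows "cmod ((\<Sum>l=0..<int M. g l) - (\<Sum>l=0..<int M. g (l + k))) \<le> 2 * \<bar>of_int k\<bar> * D"
proof -
  let ?I = "{0..<int M}" and ?J = "{k..<int M + k}"
  have D: "0 \<le> D" using assms[of 0] norm_ge_zero order_trans by blast
  have "(\<Sum>l\<in>?I. g (l + k)) = (\<Sum>l\<in>?J. g l)"
    by (rule sum.reindex_bij_witness[where i="\<lambda>l. l - k" and j="\<lambda>l. l + k"]) auto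
  moreover have "(\<Sum>l\<in>?I. g l) = (\<Sum>l\<in>?I \<inter> ?J. g l) + (\<Sum>l\<in>?I - ?J. g l)"
    "(\<Sum>l\<in>?J. g l) = (\<Sum>l\<in>?I \<inter> ?J. g l) + (\<Sum>l\<in>?J - ?I. g l)"
    using sum.Int_Diff[of ?I g ?J] sum.Int_Diff[of ?J g ?I] by (simp_all add: Int_commute)
  ultimately have "(\<Sum>l\<in>?I. g l) - (\<Sum>l\<in>?I. g (l + k)) =
      (\<Sum>l\<in>?I - ?J. g l) - (\<Sum>l\<in>?J - ?I. g l)" by simp
  then have "cmod ((\<Sum>l\<in>?I. g l) - (\<Sum>l\<in>?I. g (l + k))) \<le>
      cmod (\<Sum>l\<in>?I - ?J. g l) + cmod (\<Sum>l\<in>?J - ?I. g l)"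
    by (simp add: norm_triangle_ineq4)
  also have "\<dots> \<le> of_nat (card (?I - ?J)) * D + of_nat (card (?J - ?I)) * D"
    using assms by (intro add_mono sum_norm_bound)
  also have "\<dots> \<le> \<bar>of_int k\<bar> * D + \<bar>of_int k\<bar> * D"
  proof (intro add_mono mult_right_mono D)
    have "card (?I - ?J) \<le> card (if 0 \<le> k then {0..<k} else {int M + k..<int M})"
      by (intro card_mono) auto
    then show "real (card (?I - ?J)) \<le> \<bar>of_int k\<bar>" by (auto split: if_splits)
    have "card (?J - ?I) \<le> card (if 0 \<le> k then {int M..<int M + k} else {k..<0})"
      by (intro card_mono) auto
    then show "real (card (?J - ?I)) \<le> \<bar>of_int k\<bar>" by (auto split: if_splits)
  qed
  finally show ?thesis by (simp add: mult_ac)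
qed

lemma sum_boundary_le:
  fixes g :: "int \<Rightarrow> complex"
  assumes "\<And>l. cmod (g l) \<le> D"
  shows "cmod (\<Sum>l=0..<int M. if l + k \<in> {0..<int M} then 0 else g l) \<le> \<bar>of_int k\<bar> * D"
proof -
  let ?B = "{l\<in>{0..<int M}. l + k \<notin> {0..<int M}}"
  have D: "0 \<le> D" using assms[of 0] norm_ge_zero order_trans by blast
  have "(\<Sum>l=0..<int M. if l + k \<in> {0..<int M} then 0 else g l) = (\<Sum>l\<in>?B. g l)"
    by (rule sum.mono_neutral_cong_right) auto
  then have "cmod (\<Sum>l=0..<int M. if l + k \<in> {0..<int M} then 0 else g l) \<le> of_nat (card ?B) * D"
    using assms by (simp add: sum_norm_bound)
  also have "\<dots> \<le> \<bar>of_int k\<bar> * D"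
  proof (intro mult_right_mono D)
    have "card ?B \<le> card (if 0 \<le> k then {int M - k..<int M} else {0..<- k})"
      by (intro card_mono) auto
    then show "real (card ?B) \<le> \<bar>of_int k\<bar>" by (auto split: if_splits)
  qed
  finally show ?thesis .
qed

text \<open>
  Operators of diagonal type enter the averages only through a summable sequence of bounds for the
  diagonals of their matrix.
\<close>

locale dominated_diagonals =
  fixes A :: "int \<Rightarrow> int \<Rightarrow> complex" and c :: "int \<Rightarrow> real"
  assumes diag_le: "cmod (A (j + k) j) \<le> c k"
    and c_summable: "c summable_on UNIV"
begin

definition diag_sum :: real where "diag_sum = infsum c UNIV"

definition autocorr :: "int \<Rightarrow> real" where "autocorr s = (\<Sum>\<^sub>\<infinity>k. c (k + s) * c k)"

definition row_product :: "int \<Rightarrow> int \<Rightarrow> int \<Rightarrow> complex" where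
  "row_product l l' n = (\<Sum>\<^sub>\<infinity>j. A l j * cnj (A l' (j + n)))"

definition row_avg :: "nat \<Rightarrow> int \<Rightarrow> int \<Rightarrow> complex" where
  "row_avg M m n = (\<Sum>l=0..<int M. row_product (l + m) l n) / of_nat M"

lemma c_nonneg: "0 \<le> c k"
  using diag_le[of 0 k] norm_ge_zero order_trans by blast

lemma entry_le: "cmod (A l j) \<le> c (l - j)"
  using diag_le[of j "l - j"] by simp

lemma c_le_diag_sum: "c k \<le> diag_sum"
  using finite_sum_le_infsum[OF c_summable, of "{k}"] c_nonneg by (simp add: diag_sum_def)

lemma entries_row_summable: "(\<lambda>j. cmod (A l j)) summable_on UNIV"
  using summable_on_norm_bound(1)[of "\<lambda>j. c (l - j)" UNIV "A l"] entry_le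
    summable_on_int_reflect[of c l] c_summable by simp

lemma entries_column_summable: "(\<lambda>l. cmod (A l j)) summable_on UNIV"
  using summable_on_norm_bound(1)[of "\<lambda>l. c (l + - j)" UNIV "\<lambda>l. A l j"] entry_le[of _ j]
    summable_on_int_shift[of c "- j"] c_summable by simp

lemma c_products_summable: "(\<lambda>(k, s). c k * c s) summable_on UNIV"
proof -
  have "(\<lambda>(k, s). c k * c s) summable_on (SIGMA k:UNIV. UNIV)"
  proof (rule summable_on_SigmaI)
    show "((\<lambda>y. case (x, y) of (k, s) \<Rightarrow> c k * c s) has_sum c x * diag_sum) UNIV" for x
      using has_sum_cmult_right[OF has_sum_infsum[OF c_summable], of "c x"] by (simp add: diag_sum_def)
    show "(\<lambda>x. c x * diag_sum) summable_on UNIV" by (rule summable_on_cmult_left[OF c_summable])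
  qed (auto simp: c_nonneg)
  then show ?thesis by simp
qed

text \<open>
  The shear $(s,k) \mapsto (k+s,k)$ turns the double series for the sum of the autocorrelation into the
  product of the series of \<open>c\<close> with itself.
\<close>

lemma bij_pair_shift: "bij (\<lambda>(s, k). (k + s :: int, k :: int))"
  by (rule bij_betw_byWitness[where f'="\<lambda>(p, k). (p - k, k)"]) auto

lemma shifted_products_summable: "(\<lambda>(s, k). c (k + s) * c k) summable_on UNIV"
  using summable_on_reindex_bij_betw[OF bij_pair_shift, of "\<lambda>(k, s). c k * c s"] c_products_summable
  by (simp add: case_prod_unfold)

lemma autocorr_term_summable: "(\<lambda>k. c (k + s) * c k) summable_on UNIV"
proof (rule summable_on_comparison_test)
  show "(\<lambda>k. diag_sum * c k) summable_on UNIV" by (rule summable_on_cmult_right[OF c_summable])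
qed (auto intro!: mult_right_mono c_le_diag_sum c_nonneg mult_nonneg_nonneg)

lemma autocorr_summable: "autocorr summable_on UNIV"
  using summable_on_Sigma_banach[of "\<lambda>s k. c (k + s) * c k" UNIV "\<lambda>_. UNIV"] shifted_products_summable
  unfolding autocorr_def by simp

lemma infsum_autocorr: "infsum autocorr UNIV = diag_sum\<^sup>2"
proof -
  have "infsum autocorr UNIV = (\<Sum>\<^sub>\<infinity>k. \<Sum>\<^sub>\<infinity>s. c (k + s) * c k)"
    unfolding autocorr_def
    using infsum_swap_banach[of "\<lambda>s k. c (k + s) * c k" UNIV UNIV] shifted_products_summable by simp
  also have "\<dots> = (\<Sum>\<^sub>\<infinity>k. diag_sum * c k)"
  proof (rule infsum_cong)
    fix k
    have "(\<Sum>\<^sub>\<infinity>s. c (k + s) * c k) = (\<Sum>\<^sub>\<infinity>s. c (s + k)) * c k"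
      by (simp add: infsum_cmult_left' add.commute)
    then show "(\<Sum>\<^sub>\<infinity>s. c (k + s) * c k) = diag_sum * c k" by (simp add: infsum_int_shift diag_sum_def)
  qed
  also have "\<dots> = diag_sum\<^sup>2" by (simp add: infsum_cmult_right' diag_sum_def power2_eq_square)
  finally show ?thesis .
qed

lemma autocorr_nonneg: "0 \<le> autocorr s"
  unfolding autocorr_def by (intro infsum_nonneg mult_nonneg_nonneg c_nonneg)

lemma product_le: "cmod (A l j * cnj (A l' (j + n))) \<le> c (l - j) * c (l' - j - n)"
  unfolding norm_mult complex_mod_cnj
  using entry_le[of l' "j + n"] by (intro mult_mono entry_le c_nonneg) (auto simp: algebra_simps)

lemma products_bound:
  "(\<lambda>j. c (l - j) * c (l' - j - n)) summable_on UNIV"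
  "(\<Sum>\<^sub>\<infinity>j. c (l - j) * c (l' - j - n)) = autocorr (l - l' + n)"
proof -
  define f where "f k = c (k + (l - l' + n)) * c k" for k
  have eq: "(\<lambda>j. c (l - j) * c (l' - j - n)) = (\<lambda>j. f (l' - n - j))"
    by (auto simp: f_def algebra_simps)
  show "(\<lambda>j. c (l - j) * c (l' - j - n)) summable_on UNIV"
    unfolding eq summable_on_int_reflect unfolding f_def by (rule autocorr_term_summable)
  show "(\<Sum>\<^sub>\<infinity>j. c (l - j) * c (l' - j - n)) = autocorr (l - l' + n)"
    unfolding eq infsum_int_reflect unfolding f_def autocorr_def ..
qed

lemma row_product_summable: "(\<lambda>j. A l j * cnj (A l' (j + n))) summable_on UNIV"
  using summable_on_norm_bound(2)[OF products_bound(1) product_le] .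

text \<open>
  The product of the entries $(l,j)$ and $(l',j+n)$ is at most $c_{l-j}\,c_{l'-j-n}$, and the two
  indices of \<open>c\<close> differ by $l-l'+n$.
\<close>

lemma row_product_le: "cmod (row_product l l' n) \<le> autocorr (l - l' + n)"
  unfolding row_product_def products_bound(2)[symmetric]
  by (rule summable_on_norm_bound(3)[OF products_bound(1) product_le])

lemma row_product_shift: "(\<lambda>j. A l (j - k) * cnj (A l' (j - k'))) summable_on UNIV"
    "(\<Sum>\<^sub>\<infinity>j. A l (j - k) * cnj (A l' (j - k'))) = row_product l l' (k - k')"
proof -
  define f where "f i = A l i * cnj (A l' (i + (k - k')))" for i
  have eq: "(\<lambda>j. A l (j - k) * cnj (A l' (j - k'))) = (\<lambda>j. f (j + - k))"
    by (auto simp: f_def)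
  show "(\<lambda>j. A l (j - k) * cnj (A l' (j - k'))) summable_on UNIV"
    unfolding eq summable_on_int_shift unfolding f_def by (rule row_product_summable)
  show "(\<Sum>\<^sub>\<infinity>j. A l (j - k) * cnj (A l' (j - k'))) = row_product l l' (k - k')"
    unfolding eq infsum_int_shift unfolding f_def row_product_def ..
qed

lemma row_product_diagonal_le: "cmod (row_product (l + m) l n) \<le> autocorr (m + n)"
  using row_product_le[of "l + m" l n] by simp

lemma row_avg_le: "cmod (row_avg M m n) \<le> autocorr (m + n)"
proof (cases "M = 0")
  case False
  have "cmod (\<Sum>l=0..<int M. row_product (l + m) l n) \<le> of_nat (card {0..<int M}) * autocorr (m + n)"
    by (intro sum_norm_bound row_product_diagonal_le)
  then show ?thesis
    using False by (simp add: row_avg_def norm_divide divide_le_eq mult.commute)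
qed (simp add: row_avg_def autocorr_nonneg)

text \<open>
  Unlike \<open>row_avg\<close>, this average restricts both row indices to the interval. It is the one that arises
  from squares of sums over the rows of an interval, and the two have the same limits.
\<close>

definition square_avg :: "nat \<Rightarrow> int \<Rightarrow> int \<Rightarrow> complex" where
  "square_avg M m n = (\<Sum>l=0..<int M. if l + m \<in> {0..<int M} then row_product (l + m) l n else 0) / of_nat M"

lemma square_avg_le: "cmod (square_avg M m n) \<le> autocorr (m + n)"
proof (cases "M = 0")
  case False
  have "cmod (\<Sum>l=0..<int M. if l + m \<in> {0..<int M} then row_product (l + m) l n else 0)
      \<le> of_nat (card {0..<int M}) * autocorr (m + n)"
    by (intro sum_norm_bound) (simp add: row_product_diagonal_le autocorr_nonneg)
  then show ?thesis
    using False by (simp add: square_avg_def norm_divide divide_le_eq mult.commute)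
qed (simp add: square_avg_def autocorr_nonneg)

lemma const_over_M_tendsto_0: "(\<lambda>M. a / real M) \<longlonglongrightarrow> 0"
  by (rule real_tendsto_divide_at_top[OF tendsto_const filterlim_real_sequentially])

lemma square_avg_tendsto:
  assumes "(\<lambda>M. row_avg M m n) \<longlonglongrightarrow> w"
  shows "(\<lambda>M. square_avg M m n) \<longlonglongrightarrow> w"
proof -
  have "cmod (row_avg M m n - square_avg M m n) \<le> \<bar>of_int m\<bar> * autocorr (m + n) / real M" for M
  proof -
    have "row_avg M m n - square_avg M m n =
        (\<Sum>l=0..<int M. if l + m \<in> {0..<int M} then 0 else row_product (l + m) l n) / of_nat M"
      unfolding row_avg_def square_avg_def diff_divide_distrib[symmetric] sum_subtractf[symmetric]
      by (intro arg_cong2[where f="(/)"] sum.cong refl) auto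
    moreover have "cmod (\<Sum>l=0..<int M. if l + m \<in> {0..<int M} then 0 else row_product (l + m) l n)
        \<le> \<bar>of_int m\<bar> * autocorr (m + n)"
      by (intro sum_boundary_le row_product_diagonal_le)
    ultimately show ?thesis by (simp add: norm_divide divide_right_mono)
  qed
  then have "(\<lambda>M. row_avg M m n - square_avg M m n) \<longlonglongrightarrow> 0"
    by (intro Lim_null_comparison[OF always_eventually const_over_M_tendsto_0]) auto
  from tendsto_diff[OF assms this] show ?thesis by simp
qed

text \<open>
  Collect the pairs of rows by their difference.
\<close>

lemma square_sum:
  "(\<Sum>l=0..<int M. \<Sum>l'=0..<int M. chr_T (l - l') x * row_product l l' n) / of_nat M =
    (\<Sum>\<^sub>\<infinity>m. square_avg M m n * chr_T m x)"
proof -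
  let ?I = "{0..<int M}"
  have "(\<Sum>\<^sub>\<infinity>m. square_avg M m n * chr_T m x) =
      (\<Sum>\<^sub>\<infinity>m\<in>{- int M..int M}. square_avg M m n * chr_T m x)"
  proof (rule infsum_cong_neutral)
    fix m assume "m \<in> UNIV - {- int M..int M}"
    then have "square_avg M m n = 0"
      unfolding square_avg_def by (intro divide_eq_0_iff[THEN iffD2] disjI1 sum.neutral) auto
    then show "square_avg M m n * chr_T m x = 0" by simp
  qed auto
  also have "\<dots> = (\<Sum>m\<in>{- int M..int M}. \<Sum>l\<in>?I.
      if l + m \<in> ?I then chr_T m x * row_product (l + m) l n else 0) / of_nat M"
    unfolding square_avg_def sum_divide_distrib[of _ "{- int M..int M}"]
    by (auto simp: sum_distrib_left sum_distrib_right mult.commute intro!: sum.cong arg_cong2[where f="(/)"])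
  also have "\<dots> = (\<Sum>l'\<in>?I. \<Sum>m\<in>{- int M..int M}.
      if l' + m \<in> ?I then chr_T m x * row_product (l' + m) l' n else 0) / of_nat M"
    by (subst sum.swap) simp
  also have "\<dots> = (\<Sum>l'\<in>?I. \<Sum>l\<in>?I. chr_T (l - l') x * row_product l l' n) / of_nat M"
  proof (rule arg_cong2[where f="(/)", OF sum.cong[OF refl] refl])
    fix l' assume l': "l' \<in> ?I"
    have "(\<Sum>m\<in>{- int M..int M}. if l' + m \<in> ?I then chr_T m x * row_product (l' + m) l' n else 0) =
        (\<Sum>m\<in>{- l'..<int M - l'}. chr_T m x * row_product (l' + m) l' n)"
      using l' by (intro sum.mono_neutral_cong_right) auto
    also have "\<dots> = (\<Sum>l\<in>?I. chr_T (l - l') x * row_product l l' n)"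
      by (rule sum.reindex_bij_witness[where i="\<lambda>l. l - l'" and j="\<lambda>m. m + l'"])
         (auto simp: add.commute)
    finally show "(\<Sum>m\<in>{- int M..int M}. if l' + m \<in> ?I then chr_T m x * row_product (l' + m) l' n else 0) =
        (\<Sum>l\<in>?I. chr_T (l - l') x * row_product l l' n)" .
  qed
  also have "\<dots> = (\<Sum>l\<in>?I. \<Sum>l'\<in>?I. chr_T (l - l') x * row_product l l' n) / of_nat M"
    by (subst sum.swap) simp
  finally show ?thesis by simp
qed

text \<open>
  The form is the sum over the columns $j$ of
  $\frac1M \bigl|\sum_{l<M,\,k<K} A_{l,j-k}\,e^{ilx+ikt}\bigr|^2$.
\<close>

lemma square_form_nonneg:
  "(\<Sum>k=0..<int K. \<Sum>k'=0..<int K.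
      (\<Sum>\<^sub>\<infinity>m. square_avg M m (k - k') * chr_T m x) * chr_T (k - k') t) \<in> \<real>\<^sub>\<ge>\<^sub>0"
proof -
  let ?I = "{0..<int M}" and ?K = "{0..<int K}"
  \<comment> \<open>For each column \<open>j\<close>, the summands of the sum whose squared modulus appears.\<close>
  define z where "z j p = A (fst p) (j - snd p) * (chr_T (fst p) x * chr_T (snd p) t)" for j p
  have z_mult: "z j (l, k) * cnj (z j (l', k')) =
      (chr_T (l - l') x * chr_T (k - k') t) * (A l (j - k) * cnj (A l' (j - k')))" for j l k l' k'
    using chr_T_add[of l "- l'" x] chr_T_add[of k "- k'" t] by (simp add: z_def cnj_chr_T)
  have term_sum: "(\<lambda>j. z j (l, k) * cnj (z j (l', k'))) summable_on UNIV"
    "(\<Sum>\<^sub>\<infinity>j. z j (l, k) * cnj (z j (l', k'))) = chr_T (l - l') x * chr_T (k - k') t * row_product l l' (k - k')"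
    for l k l' k'
    unfolding z_mult by (intro summable_on_cmult_right row_product_shift) (simp add: infsum_cmult_right' row_product_shift)
  have "(\<Sum>k\<in>?K. \<Sum>k'\<in>?K. (\<Sum>\<^sub>\<infinity>m. square_avg M m (k - k') * chr_T m x) * chr_T (k - k') t) =
      (\<Sum>k\<in>?K. \<Sum>k'\<in>?K. \<Sum>l\<in>?I. \<Sum>l'\<in>?I. chr_T (l - l') x * chr_T (k - k') t * row_product l l' (k - k')) / of_nat M"
    unfolding square_sum[symmetric]
    by (simp add: sum_divide_distrib sum_distrib_left sum_distrib_right mult_ac)
  also have "(\<Sum>k\<in>?K. \<Sum>k'\<in>?K. \<Sum>l\<in>?I. \<Sum>l'\<in>?I. chr_T (l - l') x * chr_T (k - k') t * row_product l l' (k - k')) =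
      (\<Sum>l\<in>?I. \<Sum>k\<in>?K. \<Sum>l'\<in>?I. \<Sum>k'\<in>?K. chr_T (l - l') x * chr_T (k - k') t * row_product l l' (k - k'))"
  proof -
    let ?f = "\<lambda>k k' l l'. chr_T (l - l') x * chr_T (k - k') t * row_product l l' (k - k')"
    have "(\<Sum>k\<in>?K. \<Sum>k'\<in>?K. \<Sum>l\<in>?I. \<Sum>l'\<in>?I. ?f k k' l l') =
        (\<Sum>k\<in>?K. \<Sum>l\<in>?I. \<Sum>k'\<in>?K. \<Sum>l'\<in>?I. ?f k k' l l')"
      by (rule sum.cong[OF refl]) (rule sum.swap)
    also have "\<dots> = (\<Sum>l\<in>?I. \<Sum>k\<in>?K. \<Sum>k'\<in>?K. \<Sum>l'\<in>?I. ?f k k' l l')" by (rule sum.swap)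
    also have "\<dots> = (\<Sum>l\<in>?I. \<Sum>k\<in>?K. \<Sum>l'\<in>?I. \<Sum>k'\<in>?K. ?f k k' l l')"
      by (intro sum.cong[OF refl]) (rule sum.swap)
    finally show ?thesis .
  qed
  also have "\<dots> = (\<Sum>p\<in>?I \<times> ?K. \<Sum>q\<in>?I \<times> ?K. \<Sum>\<^sub>\<infinity>j. z j p * cnj (z j q))"
    by (simp only: sum.cartesian_product' term_sum(2))
  also have "\<dots> = (\<Sum>\<^sub>\<infinity>j. \<Sum>p\<in>?I \<times> ?K. \<Sum>q\<in>?I \<times> ?K. z j p * cnj (z j q))"
    using term_sum by (simp add: infsum_finite_sum case_prod_unfold split_paired_all)
  also have "\<dots> = (\<Sum>\<^sub>\<infinity>j. complex_of_real ((cmod (\<Sum>p\<in>?I \<times> ?K. z j p))\<^sup>2))"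
    by (simp only: sum_chr_square[OF finite_cartesian_product[OF finite_atLeastLessThan_int finite_atLeastLessThan_int]])
  finally have "(\<Sum>k\<in>?K. \<Sum>k'\<in>?K. (\<Sum>\<^sub>\<infinity>m. square_avg M m (k - k') * chr_T m x) * chr_T (k - k') t) =
      (\<Sum>\<^sub>\<infinity>j. complex_of_real ((cmod (\<Sum>p\<in>?I \<times> ?K. z j p))\<^sup>2)) / of_nat M" .
  moreover have "(\<Sum>\<^sub>\<infinity>j. complex_of_real ((cmod (\<Sum>p\<in>?I \<times> ?K. z j p))\<^sup>2)) \<in> \<real>\<^sub>\<ge>\<^sub>0"
    by (rule infsum_of_real_nonneg) simp
  ultimately show ?thesis
    by (simp add: complex_nonneg_Reals_iff Re_divide_of_nat Im_divide_of_nat)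
qed

end

locale averaged_matrix = dominated_diagonals +
  fixes \<omega> :: "int \<Rightarrow> int \<Rightarrow> complex"
  assumes row_avg_tendsto: "(\<lambda>M. row_avg M m n) \<longlonglongrightarrow> \<omega> m n"
begin

lemma omega_le: "cmod (\<omega> m n) \<le> autocorr (m + n)"
  by (rule LIMSEQ_le_const2[OF tendsto_norm[OF row_avg_tendsto]]) (simp add: row_avg_le)

lemma omega_row_summable: "(\<lambda>m. cmod (\<omega> m n)) summable_on UNIV"
  and omega_row_le: "(\<Sum>\<^sub>\<infinity>m. cmod (\<omega> m n)) \<le> diag_sum\<^sup>2"
proof -
  have D: "(\<lambda>m. autocorr (m + n)) summable_on UNIV" unfolding summable_on_int_shift by (rule autocorr_summable)
  show s: "(\<lambda>m. cmod (\<omega> m n)) summable_on UNIV" by (rule summable_on_norm_bound(1)[OF D omega_le])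
  have "(\<Sum>\<^sub>\<infinity>m. cmod (\<omega> m n)) \<le> (\<Sum>\<^sub>\<infinity>m. autocorr (m + n))" by (rule infsum_mono[OF s D omega_le])
  then show "(\<Sum>\<^sub>\<infinity>m. cmod (\<omega> m n)) \<le> diag_sum\<^sup>2" by (simp add: infsum_int_shift infsum_autocorr)
qed

lemma omega_column_summable: "(\<lambda>n. cmod (\<omega> m n)) summable_on UNIV"
  and omega_column_le: "(\<Sum>\<^sub>\<infinity>n. cmod (\<omega> m n)) \<le> diag_sum\<^sup>2"
proof -
  have D: "(\<lambda>n. autocorr (n + m)) summable_on UNIV" unfolding summable_on_int_shift by (rule autocorr_summable)
  have le: "cmod (\<omega> m n) \<le> autocorr (n + m)" for n using omega_le[of m n] by (simp add: add.commute)
  show s: "(\<lambda>n. cmod (\<omega> m n)) summable_on UNIV" by (rule summable_on_norm_bound(1)[OF D le])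
  have "(\<Sum>\<^sub>\<infinity>n. cmod (\<omega> m n)) \<le> (\<Sum>\<^sub>\<infinity>n. autocorr (n + m))" by (rule infsum_mono[OF s D le])
  then show "(\<Sum>\<^sub>\<infinity>n. cmod (\<omega> m n)) \<le> diag_sum\<^sup>2" by (simp add: infsum_int_shift infsum_autocorr)
qed

text \<open>
  For fixed \<open>x\<close> the quadratic forms are limits of the nonnegative forms above. The bound
  by the autocorrelation justifies passing to the limit inside the series over \<open>m\<close>.
\<close>

lemma positive_definite_section: "positive_definite (\<lambda>n. \<Sum>\<^sub>\<infinity>m. \<omega> m n * chr_T m x)"
  unfolding positive_definite_def
proof (intro allI)
  fix K t
  have D: "(\<lambda>m. autocorr (m + n)) summable_on UNIV" for n unfolding summable_on_int_shift by (rule autocorr_summable)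
  have "(\<lambda>M. \<Sum>\<^sub>\<infinity>m. square_avg M m n * chr_T m x) \<longlonglongrightarrow> (\<Sum>\<^sub>\<infinity>m. \<omega> m n * chr_T m x)" for n
    by (rule tendsto_infsum_dominated[OF _ _ D[of n]])
       (simp_all add: norm_mult square_avg_le tendsto_mult_right[OF square_avg_tendsto[OF row_avg_tendsto]])
  then have lim: "(\<lambda>M. \<Sum>k=0..<int K. \<Sum>k'=0..<int K.
        (\<Sum>\<^sub>\<infinity>m. square_avg M m (k - k') * chr_T m x) * chr_T (k - k') t) \<longlonglongrightarrow>
      (\<Sum>k=0..<int K. \<Sum>k'=0..<int K. (\<Sum>\<^sub>\<infinity>m. \<omega> m (k - k') * chr_T m x) * chr_T (k - k') t)"
    by (intro tendsto_sum tendsto_mult_right)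
  show "(\<Sum>k=0..<int K. \<Sum>k'=0..<int K. (\<Sum>\<^sub>\<infinity>m. \<omega> m (k - k') * chr_T m x) * chr_T (k - k') t)
      \<in> \<real>\<^sub>\<ge>\<^sub>0"
    by (rule closed_sequentially[OF closed_nonneg_Reals_complex _ lim]) (rule square_form_nonneg)
qed

lemma omega_row_orthonormal:
  assumes "\<And>l l'. row_product l l' 0 = (if l = l' then 1 else 0)"
  shows "\<omega> m 0 = (if m = 0 then 1 else 0)"
proof (rule LIMSEQ_unique[OF row_avg_tendsto])
  show "(\<lambda>M. row_avg M m 0) \<longlonglongrightarrow> (if m = 0 then 1 else 0)"
  proof (rule tendsto_eventually)
    show "eventually (\<lambda>M. row_avg M m 0 = (if m = 0 then 1 else 0)) sequentially"
      using eventually_gt_at_top[of 0]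
      by eventually_elim (simp add: row_avg_def assms)
  qed
qed

text \<open>
  Average each diagonal separately. On the \<open>k\<close>-th one, running over the rows $l < M$ or over the
  columns $j < M$ amounts to a shift by $k$, so the two averages have the same limit. The first ones add up to
  the averages that define \<open>\<omega>\<close>; the second ones add up to averages of inner products of columns.
\<close>

lemma omega_column_orthonormal:
  assumes orth: "\<And>j n. (\<Sum>\<^sub>\<infinity>l. A l j * cnj (A l (j + n))) = (if n = 0 then 1 else 0)"
  shows "\<omega> 0 n = (if n = 0 then 1 else 0)"
proof -
  define g where "g k l = A l (l - k) * cnj (A l (l - k + n))" for k l
  define D where "D k = c k * c (k - n)" for k
  have g_le: "cmod (g k l) \<le> D k" for k l
    using product_le[of l "l - k" l n] by (simp add: g_def D_def algebra_simps)
  have D_sum: "D summable_on UNIV"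
    using autocorr_term_summable[of n, folded summable_on_int_shift[of "\<lambda>k. c (k + n) * c k" "- n"]]
    by (simp add: D_def[abs_def])
  \<comment> \<open>The average of the diagonal \<open>k\<close> over rows, and then over columns.\<close>
  define u where "u M k = (\<Sum>l=0..<int M. g k l) / of_nat M" for M :: nat and k
  define v where "v M k = (\<Sum>l=0..<int M. g k (l + k)) / of_nat M" for M :: nat and k
  have sum_le: "cmod ((\<Sum>l=0..<int M. h l) / of_nat M) \<le> D k" if "\<And>l. cmod (h l) \<le> D k" for M h k
  proof (cases "M = 0")
    case False
    have "cmod (\<Sum>l=0..<int M. h l) \<le> of_nat (card {0..<int M}) * D k"
      using that by (intro sum_norm_bound)
    then show ?thesis using False by (simp add: norm_divide divide_le_eq mult.commute)
  qed (use order_trans[OF norm_ge_zero that] in simp)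
  have u_le: "cmod (u M k) \<le> D k" and v_le: "cmod (v M k) \<le> D k" for M k
    unfolding u_def v_def by (intro sum_le g_le)+
  have "(\<lambda>M. u M k - v M k) \<longlonglongrightarrow> 0" for k
  proof -
    have "cmod (u M k - v M k) \<le> (2 * \<bar>of_int k\<bar> * D k) / real M" for M
      unfolding u_def v_def diff_divide_distrib[symmetric] norm_divide norm_of_nat
      by (intro divide_right_mono sum_shift_difference_le g_le) auto
    then show ?thesis
      by (intro Lim_null_comparison[OF always_eventually const_over_M_tendsto_0]) auto
  qed
  moreover have "cmod (u M k - v M k) \<le> 2 * D k" for M k
    using norm_triangle_ineq4[of "u M k" "v M k"] u_le[of M k] v_le[of M k] by linarith
  ultimately have "(\<lambda>M. \<Sum>\<^sub>\<infinity>k. u M k - v M k) \<longlonglongrightarrow> (\<Sum>\<^sub>\<infinity>k::int. 0)"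
    by (rule tendsto_infsum_dominated) (rule summable_on_cmult_right[OF D_sum])
  moreover have "(\<Sum>\<^sub>\<infinity>k. u M k - v M k) = (\<Sum>\<^sub>\<infinity>k. u M k) - (\<Sum>\<^sub>\<infinity>k. v M k)" for M
  proof -
    have s: "u M summable_on UNIV" "v M summable_on UNIV"
      by (rule summable_on_norm_bound(2)[OF D_sum], rule u_le v_le)+
    then have "(\<lambda>k. - v M k) summable_on UNIV" by (simp add: summable_on_uminus)
    from infsum_add[OF s(1) this] show ?thesis by (simp add: infsum_uminus)
  qed
  ultimately have diff: "(\<lambda>M. (\<Sum>\<^sub>\<infinity>k. u M k) - (\<Sum>\<^sub>\<infinity>k. v M k)) \<longlonglongrightarrow> 0" by simp
  have g_sum: "(\<lambda>k. g k (l k)) summable_on UNIV" for l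
    by (rule summable_on_norm_bound(2)[OF D_sum g_le])
  have u_avg: "(\<Sum>\<^sub>\<infinity>k. u M k) = row_avg M 0 n" for M
  proof -
    have "(\<Sum>\<^sub>\<infinity>k. u M k) = (\<Sum>\<^sub>\<infinity>k. \<Sum>l=0..<int M. g k l) / of_nat M"
      unfolding u_def by (simp add: divide_inverse infsum_cmult_left')
    also have "(\<Sum>\<^sub>\<infinity>k. \<Sum>l=0..<int M. g k l) = (\<Sum>l=0..<int M. \<Sum>\<^sub>\<infinity>k. g k l)"
      by (rule infsum_finite_sum(2)) (auto intro: g_sum)
    also have "\<dots> = (\<Sum>l=0..<int M. row_product (l + 0) l n)"
      unfolding row_product_def g_def
      using infsum_int_reflect[of "\<lambda>j. A l j * cnj (A l (j + n))" l for l] by simp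
    finally show ?thesis by (simp add: row_avg_def)
  qed
  have v_avg: "(\<Sum>\<^sub>\<infinity>k. v M k) = (if n = 0 then 1 else 0)" if "0 < M" for M
  proof -
    have "(\<Sum>\<^sub>\<infinity>k. v M k) = (\<Sum>\<^sub>\<infinity>k. \<Sum>l=0..<int M. g k (l + k)) / of_nat M"
      unfolding v_def by (simp add: divide_inverse infsum_cmult_left')
    also have "(\<Sum>\<^sub>\<infinity>k. \<Sum>l=0..<int M. g k (l + k)) = (\<Sum>l=0..<int M. \<Sum>\<^sub>\<infinity>k. g k (l + k))"
      by (rule infsum_finite_sum(2)) (auto intro: g_sum)
    also have "\<dots> = (\<Sum>l=0..<int M. if n = 0 then 1 else 0)"
    proof (rule sum.cong[OF refl])
      fix l
      have "(\<Sum>\<^sub>\<infinity>k. g k (l + k)) = (\<Sum>\<^sub>\<infinity>k. A (k + l) l * cnj (A (k + l) (l + n)))"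
        by (simp add: g_def add.commute)
      also have "\<dots> = (\<Sum>\<^sub>\<infinity>k. A k l * cnj (A k (l + n)))"
        using infsum_int_shift[of "\<lambda>k. A k l * cnj (A k (l + n))" l] by simp
      finally show "(\<Sum>\<^sub>\<infinity>k. g k (l + k)) = (if n = 0 then 1 else 0)" by (simp add: orth)
    qed
    finally show ?thesis using that by simp
  qed
  have "(\<lambda>M. row_avg M 0 n - (if n = 0 then 1 else 0)) \<longlonglongrightarrow> 0"
  proof (rule Lim_transform_eventually[OF diff])
    show "eventually (\<lambda>M. (\<Sum>\<^sub>\<infinity>k. u M k) - (\<Sum>\<^sub>\<infinity>k. v M k) = row_avg M 0 n - (if n = 0 then 1 else 0)) sequentially"
      using eventually_gt_at_top[of 0] by eventually_elim (simp add: u_avg v_avg)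
  qed
  then have "(\<lambda>M. row_avg M 0 n) \<longlonglongrightarrow> (if n = 0 then 1 else 0)" by (simp add: LIM_zero_iff)
  then show ?thesis by (rule LIMSEQ_unique[OF row_avg_tendsto])
qed

end


section \<open>Regular operators on the circle\<close>

text \<open>
  The positive and the negative part of \<open>r\<close> are densities of measures with the same coefficients.
\<close>

lemma real_Fourier_eq_0:
  fixes r :: "real \<Rightarrow> real"
  assumes r: "integrable measure_T r" and zero: "\<And>n. (\<integral>t. r t *\<^sub>R chr_T n t \<partial>measure_T) = 0"
  shows "AE t in measure_T. r t = 0"
proof -
  have [measurable]: "r \<in> borel_measurable measure_T" using r by simp
  have chr_meas [measurable]: "chr_T n \<in> borel_measurable measure_T" for n
    by (simp add: measurable_measure_T)
  define P where "P s = density measure_T (\<lambda>t. ennreal (max 0 (s * r t)))" for s :: real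
  have int: "integrable measure_T (\<lambda>t. max 0 (s * r t))" for s using r by auto
  have sets_P: "sets (P s) = sets measure_T" for s by (simp add: P_def)
  have fin: "finite_measure (P s)" for s
  proof (rule finite_measureI)
    have "emeasure (P s) (space (P s)) = (\<integral>\<^sup>+t. ennreal (max 0 (s * r t)) \<partial>measure_T)"
      unfolding P_def by (simp add: emeasure_density_space del: space_measure_T)
    also have "\<dots> = ennreal (\<integral>t. max 0 (s * r t) \<partial>measure_T)"
      using int by (intro nn_integral_eq_integral) auto
    finally show "emeasure (P s) (space (P s)) \<noteq> \<infinity>" by simp
  qed
  have coeff: "(\<integral>t. chr_T n t \<partial>P s) = (\<integral>t. max 0 (s * r t) *\<^sub>R chr_T n t \<partial>measure_T)" for n s
    unfolding P_def by (rule integral_density) auto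
  have "P 1 = P (- 1)"
  proof (rule measure_eqI_Fourier[OF fin sets_P fin sets_P])
    fix n
    have i: "integrable measure_T (\<lambda>t. max 0 (s * r t) *\<^sub>R chr_T n t)" for s
      by (rule Bochner_Integration.integrable_bound[OF int[of s]]) auto
    have "(\<integral>t. max 0 (1 * r t) *\<^sub>R chr_T n t \<partial>measure_T) - (\<integral>t. max 0 (- 1 * r t) *\<^sub>R chr_T n t \<partial>measure_T) =
        (\<integral>t. max 0 (1 * r t) *\<^sub>R chr_T n t - max 0 (- 1 * r t) *\<^sub>R chr_T n t \<partial>measure_T)"
      by (rule Bochner_Integration.integral_diff[OF i i, symmetric])
    also have "\<dots> = (\<integral>t. r t *\<^sub>R chr_T n t \<partial>measure_T)"
      by (rule Bochner_Integration.integral_cong) (auto simp: max_def)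
    finally show "(\<integral>t. chr_T n t \<partial>P 1) = (\<integral>t. chr_T n t \<partial>P (- 1))"
      by (simp add: coeff zero)
  qed
  then have "AE t in measure_T. ennreal (max 0 (1 * r t)) = ennreal (max 0 (- 1 * r t))"
    unfolding P_def by (intro T.density_unique) auto
  then show ?thesis by eventually_elim (auto simp: max_def split: if_splits)
qed

lemma Fourier_eq_imp_AE_eq:
  fixes f g :: "real \<Rightarrow> complex"
  assumes f: "integrable measure_T f" and g: "integrable measure_T g"
    and eq: "\<And>n. (\<integral>t. f t * chr_T n t \<partial>measure_T) = (\<integral>t. g t * chr_T n t \<partial>measure_T)"
  shows "AE t in measure_T. f t = g t"
proof -
  have chr_meas [measurable]: "chr_T n \<in> borel_measurable measure_T" for n
    by (simp add: measurable_measure_T)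
  have mult: "integrable measure_T (\<lambda>t. h t * chr_T n t)" if "integrable measure_T h" for h n
    using that by (intro Bochner_Integration.integrable_bound[OF that]) (auto simp: norm_mult)
  define d where "d t = f t - g t" for t
  have d: "integrable measure_T d" unfolding d_def using f g by simp
  have d0: "(\<integral>t. d t * chr_T n t \<partial>measure_T) = 0" for n
    unfolding d_def left_diff_distrib using mult[OF f] mult[OF g] eq by simp
  have cd: "integrable measure_T (\<lambda>t. cnj (d t))" using d by simp
  have cd0: "(\<integral>t. cnj (d t) * chr_T n t \<partial>measure_T) = 0" for n
  proof -
    have "(\<integral>t. cnj (d t) * chr_T n t \<partial>measure_T) = (\<integral>t. cnj (d t * chr_T (- n) t) \<partial>measure_T)"
      by (simp add: cnj_chr_T)
    also have "\<dots> = cnj (\<integral>t. d t * chr_T (- n) t \<partial>measure_T)" by (rule Bochner_Integration.integral_cnj)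
    finally show ?thesis by (simp add: d0)
  qed
  have Im_scale: "Im z *\<^sub>R v = (z * v - cnj z * v) / (2 * \<i>)" for z v
  proof (rule nonzero_eq_divide_eq[THEN iffD2])
    have "z * v - cnj z * v = complex_of_real (2 * Im z) * \<i> * v"
      by (simp only: left_diff_distrib[symmetric] complex_diff_cnj)
    then show "Im z *\<^sub>R v * (2 * \<i>) = z * v - cnj z * v"
      by (simp only: scaleR_conv_of_real of_real_mult of_real_numeral mult_ac)
  qed simp
  have "AE t in measure_T. Re (d t) = 0"
  proof (rule real_Fourier_eq_0)
    fix n
    have "(\<integral>t. Re (d t) *\<^sub>R chr_T n t \<partial>measure_T) =
        (\<integral>t. (d t * chr_T n t + cnj (d t) * chr_T n t) / 2 \<partial>measure_T)"
      by (rule Bochner_Integration.integral_cong) (auto simp: complex_eq_iff field_simps)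
    also have "\<dots> = 0" using mult[OF d] mult[OF cd] by (simp add: d0 cd0)
    finally show "(\<integral>t. Re (d t) *\<^sub>R chr_T n t \<partial>measure_T) = 0" .
  qed (use d in simp)
  moreover have "AE t in measure_T. Im (d t) = 0"
  proof (rule real_Fourier_eq_0)
    fix n
    have "(\<integral>t. Im (d t) *\<^sub>R chr_T n t \<partial>measure_T) =
        (\<integral>t. (d t * chr_T n t - cnj (d t) * chr_T n t) / (2 * \<i>) \<partial>measure_T)"
      by (rule Bochner_Integration.integral_cong[OF refl]) (rule Im_scale)
    also have "\<dots> = 0" using mult[OF d] mult[OF cd] by (simp add: d0 cd0)
    finally show "(\<integral>t. Im (d t) *\<^sub>R chr_T n t \<partial>measure_T) = 0" .
  qed (use d in simp)
  ultimately show ?thesis by eventually_elim (simp add: d_def complex_eq_iff)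
qed

lemma L2_imp_integrable:
  assumes "f \<in> L2 measure_T"
  shows "integrable measure_T f"
proof (rule Bochner_Integration.integrable_bound)
  show "integrable measure_T (\<lambda>t. 1 + (cmod (f t))\<^sup>2)" using assms by (simp add: L2_def)
  show "f \<in> borel_measurable measure_T" using assms by (simp add: L2_def)
  have "cmod (f t) \<le> 1 + (cmod (f t))\<^sup>2" for t
    using sum_power2_ge_zero[of "cmod (f t) - 1/2" 0] by (simp add: power2_eq_square algebra_simps)
  then show "AE t in measure_T. norm (f t) \<le> norm (1 + (cmod (f t))\<^sup>2)" by auto
qed

lemma chr_T_L2: "chr_T n \<in> L2 measure_T"
  by (simp add: L2_def measurable_measure_T)

lemma L2_inner_chr_T: "L2_inner measure_T (chr_T j) (chr_T k) = (if j = k then 1 else 0)"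
  using integral_chr_T[of "j - k"] by (simp add: L2_inner_def cnj_chr_T flip: chr_T_add)

text \<open>
  With absolutely summable coefficients \<open>f\<close> equals its Fourier series almost everywhere, by uniqueness
  of the coefficients in $L^1$, and the series can be integrated term by term. In
  the applications the summability comes from the bound on the diagonals.
\<close>

lemma Parseval_summable:
  assumes f: "f \<in> L2 measure_T" and g: "g \<in> L2 measure_T"
    and sum: "(\<lambda>n. cmod (L2_inner measure_T f (chr_T n))) summable_on UNIV"
  shows "(\<Sum>\<^sub>\<infinity>n. L2_inner measure_T f (chr_T n) * cnj (L2_inner measure_T g (chr_T n))) =
    L2_inner measure_T f g"
proof -
  have chr_meas: "chr_T n \<in> borel_measurable measure_T" for n by (simp add: measurable_measure_T)
  define u where "u n = L2_inner measure_T f (chr_T n)" for n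
  define S where "S t = (\<Sum>\<^sub>\<infinity>n. u n * chr_T n t)" for t
  have u: "(\<lambda>n. cmod (u n)) summable_on UNIV" using sum by (simp add: u_def)
  note series = integral_infsum_mult[where e=chr_T and M=measure_T,
      OF u chr_meas eq_refl[OF cmod_chr_T]]
  have int_S: "integrable measure_T S"
    using series(1)[OF integrable_chr_T, of 0] unfolding S_def by simp
  have "AE t in measure_T. S t = f t"
  proof (rule Fourier_eq_imp_AE_eq[OF int_S L2_imp_integrable[OF f]])
    fix n
    have "(\<integral>t. S t * chr_T n t \<partial>measure_T) = (\<Sum>\<^sub>\<infinity>k. u k * (\<integral>t. chr_T k t * chr_T n t \<partial>measure_T))"
      using series(2)[OF integrable_chr_T] unfolding S_def .
    also have "\<dots> = (\<Sum>\<^sub>\<infinity>k\<in>{- n}. u k * (\<integral>t. chr_T k t * chr_T n t \<partial>measure_T))"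
      by (rule infsum_cong_neutral) (auto simp: integral_chr_T simp flip: chr_T_add)
    also have "\<dots> = (\<integral>t. f t * chr_T n t \<partial>measure_T)"
      by (simp add: integral_chr_T u_def L2_inner_def cnj_chr_T flip: chr_T_add)
    finally show "(\<integral>t. S t * chr_T n t \<partial>measure_T) = (\<integral>t. f t * chr_T n t \<partial>measure_T)" .
  qed
  moreover have [measurable]: "f \<in> borel_measurable measure_T" "g \<in> borel_measurable measure_T"
      "S \<in> borel_measurable measure_T"
    using L2_imp_integrable[OF f] L2_imp_integrable[OF g] int_S by simp_all
  ultimately have "L2_inner measure_T f g = (\<integral>t. S t * cnj (g t) \<partial>measure_T)"
    unfolding L2_inner_def by (intro integral_cong_AE) auto
  also have "\<dots> = (\<Sum>\<^sub>\<infinity>k. u k * (\<integral>t. chr_T k t * cnj (g t) \<partial>measure_T))"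
    unfolding S_def by (rule series(2)) (simp add: L2_imp_integrable[OF g])
  finally have expand: "L2_inner measure_T f g =
      (\<Sum>\<^sub>\<infinity>k. u k * (\<integral>t. chr_T k t * cnj (g t) \<partial>measure_T))" .
  have "(\<integral>t. chr_T k t * cnj (g t) \<partial>measure_T) = cnj (L2_inner measure_T g (chr_T k))" for k
    unfolding L2_inner_def by (subst Bochner_Integration.integral_cnj[symmetric]) (simp add: mult.commute)
  then show ?thesis unfolding expand by (simp add: u_def)
qed

lemma has_sum_finite_fibres:
  fixes f :: "'j \<Rightarrow> 'l \<Rightarrow> complex"
  assumes "finite I" "\<And>l. l \<in> I \<Longrightarrow> (\<lambda>j. f j l) summable_on UNIV"
  shows "((\<lambda>(j, l). f j l) has_sum (\<Sum>l\<in>I. \<Sum>\<^sub>\<infinity>j. f j l)) (UNIV \<times> I)"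
  using assms
proof (induction I rule: finite_induct)
  case (insert l I)
  have "((\<lambda>j. f j l) has_sum (\<Sum>\<^sub>\<infinity>j. f j l)) UNIV"
    using insert.prems by (intro has_sum_infsum) auto
  then have "((\<lambda>(j, l). f j l) has_sum (\<Sum>\<^sub>\<infinity>j. f j l)) ((\<lambda>j. (j, l)) ` UNIV)"
    by (subst has_sum_reindex) (auto simp: inj_on_def o_def)
  moreover have "((\<lambda>(j, l). f j l) has_sum (\<Sum>l\<in>I. \<Sum>\<^sub>\<infinity>j. f j l)) (UNIV \<times> I)"
    using insert by auto
  ultimately have sum: "((\<lambda>(j, l). f j l) has_sum ((\<Sum>\<^sub>\<infinity>j. f j l) + (\<Sum>l\<in>I. \<Sum>\<^sub>\<infinity>j. f j l)))
      ((\<lambda>j. (j, l)) ` UNIV \<union> UNIV \<times> I)"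
    using insert.hyps by (intro has_sum_Un_disjoint) auto
  have "(\<lambda>j. (j, l)) ` UNIV \<union> UNIV \<times> I = UNIV \<times> insert l I" by auto
  from sum[unfolded this] show ?case using insert.hyps by simp
qed simp

text \<open>
  Limits along all long intervals are evaluated along the intervals that start at 0.
\<close>

lemma filterlim_initial_intervals:
  "filterlim (\<lambda>M. {0..<int M}) long_intervals sequentially"
  unfolding long_intervals_def
proof (rule filterlim_inf[THEN iffD2], intro conjI)
  have "filterlim (\<lambda>M. M) at_top sequentially" by (rule filterlim_ident)
  then show "filterlim (\<lambda>M. {0..<int M}) (filtercomap card at_top) sequentially"
    by (simp add: filterlim_filtercomap_iff o_def)
  have "{0..<int M} = {0..int M - 1}" for M by auto
  then show "filterlim (\<lambda>M. {0..<int M}) (principal {I. \<exists>a b. I = {a..b}}) sequentially"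
    by (intro filterlim_principal[THEN iffD2] always_eventually allI) blast
qed

lemma long_intervals_nontrivial: "long_intervals \<noteq> bot"
proof
  assume "long_intervals = bot"
  then have "filterlim (\<lambda>M. {0..<int M}) bot sequentially"
    using filterlim_initial_intervals by simp
  then show False by (simp add: filterlim_def bot_unique filtermap_bot_iff)
qed

lemma integral_bind_complex:
  fixes f :: "'b \<Rightarrow> complex"
  assumes f [measurable]: "f \<in> borel_measurable K" and le: "\<And>x. cmod (f x) \<le> 1"
    and N [measurable]: "N \<in> M \<rightarrow>\<^sub>M subprob_algebra K" and M: "finite_measure M"
    and bind: "finite_measure (M \<bind> N)" and sets_bind: "sets (M \<bind> N) = sets K"
  shows "(\<integral>p. f p \<partial>(M \<bind> N)) = (\<integral>x. (\<integral>p. f p \<partial>N x) \<partial>M)"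
proof -
  have int_bind: "integrable (M \<bind> N) f"
    using le f by (intro finite_measure.integrable_const_bound[OF bind, where B=1])
      (auto simp: measurable_cong_sets[OF sets_bind refl])
  have int_N: "integrable (N x) f" if "x \<in> space M" for x
  proof -
    have "subprob_space (N x)" "sets (N x) = sets K"
      using measurable_space[OF N that] by (simp_all add: space_subprob_algebra)
    then show ?thesis
      using le f by (intro finite_measure.integrable_const_bound[where B=1])
        (auto simp: subprob_space_def measurable_cong_sets[of "N x" K])
  qed
  have int_M: "integrable M (\<lambda>x. \<integral>p. f p \<partial>N x)"
  proof (rule finite_measure.integrable_const_bound[OF M, where B=1])
    show "(\<lambda>x. \<integral>p. f p \<partial>N x) \<in> borel_measurable M" by measurable
    have "cmod (\<integral>p. f p \<partial>N x) \<le> 1" if x: "x \<in> space M" for x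
    proof -
      have s: "subprob_space (N x)"
        using measurable_space[OF N x] by (simp add: space_subprob_algebra)
      have "cmod (\<integral>p. f p \<partial>N x) \<le> (\<integral>p. cmod (f p) \<partial>N x)" by (rule integral_norm_bound)
      also have "\<dots> \<le> (\<integral>p. 1 \<partial>N x)"
        using int_N[OF x] le s
        by (intro integral_mono) (auto simp: subprob_space_def finite_measure.integrable_const)
      also have "\<dots> \<le> 1" using subprob_space.subprob_measure_le_1[OF s] by simp
      finally show ?thesis .
    qed
    then show "AE x in M. cmod (\<integral>p. f p \<partial>N x) \<le> 1" by (rule AE_I2)
  qed
  have bounded: "AE x in M. emeasure (N x) (space (N x)) \<le> ennreal 1"
    using measurable_space[OF N]
    by (intro AE_I2) (auto simp: space_subprob_algebra subprob_space.emeasure_space_le_1)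
  have Re_le: "\<bar>Re (f x)\<bar> \<le> 1" "\<bar>Im (f x)\<bar> \<le> 1" for x
    using abs_Re_le_cmod[of "f x"] abs_Im_le_cmod[of "f x"] le[of x] by linarith+
  show ?thesis
  proof (rule complex_eqI)
    have "Re (\<integral>p. f p \<partial>(M \<bind> N)) = (\<integral>x. (\<integral>p. Re (f p) \<partial>N x) \<partial>M)"
      unfolding integral_Re[OF int_bind, symmetric]
      by (rule integral_bind[OF _ Re_le(1) N M bounded]) simp
    also have "\<dots> = (\<integral>x. Re (\<integral>p. f p \<partial>N x) \<partial>M)"
      using int_N by (intro Bochner_Integration.integral_cong) auto
    finally show "Re (\<integral>p. f p \<partial>(M \<bind> N)) = Re (\<integral>x. (\<integral>p. f p \<partial>N x) \<partial>M)"
      using int_M by simp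
    have "Im (\<integral>p. f p \<partial>(M \<bind> N)) = (\<integral>x. (\<integral>p. Im (f p) \<partial>N x) \<partial>M)"
      unfolding integral_Im[OF int_bind, symmetric]
      by (rule integral_bind[OF _ Re_le(2) N M bounded]) simp
    also have "\<dots> = (\<integral>x. Im (\<integral>p. f p \<partial>N x) \<partial>M)"
      using int_N by (intro Bochner_Integration.integral_cong) auto
    finally show "Im (\<integral>p. f p \<partial>(M \<bind> N)) = Im (\<integral>x. (\<integral>p. f p \<partial>N x) \<partial>M)"
      using int_M by simp
  qed
qed

locale regular_operator_on_circle =
  fixes W :: "(real \<Rightarrow> complex) \<Rightarrow> (real \<Rightarrow> complex)"
  assumes regular: "regular_operator W"
begin

definition diag_sup :: "int \<Rightarrow> real" where
  "diag_sup k = (SUP j. cmod (mat_T W (j + k) j))"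

sublocale dominated_diagonals "mat_T W" diag_sup
proof
  show "cmod (mat_T W (j + k) j) \<le> diag_sup k" for j k
    unfolding diag_sup_def
    using regular by (intro cSUP_upper) (auto simp: regular_operator_def diagonal_type_def)
  show "diag_sup summable_on UNIV"
    using regular by (simp add: diag_sup_def[abs_def] regular_operator_def diagonal_type_def)
qed

lemma diag_sum_eq: "diag_sum = DT_norm_T W"
  unfolding diag_sum_def unfolding DT_norm_T_def diag_sup_def[abs_def] ..

lemma omega_avg_eq: "omega_avg_T W m n {0..<int M} = row_avg M m n"
proof -
  have "(\<Sum>\<^sub>\<infinity>(j, l)\<in>UNIV \<times> {0..<int M}. mat_T W (l + m) j * cnj (mat_T W l (j + n))) =
      (\<Sum>l=0..<int M. row_product (l + m) l n)"
    unfolding row_product_def by (intro infsumI has_sum_finite_fibres row_product_summable) simp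
  then show ?thesis by (simp add: omega_avg_T_def row_avg_def)
qed

sublocale averaged_matrix "mat_T W" diag_sup "omega_T W"
proof
  fix m n
  obtain w where w: "(omega_avg_T W m n \<longlongrightarrow> w) long_intervals"
    using regular by (auto simp: regular_operator_def)
  then have "omega_T W m n = w"
    unfolding omega_T_def by (rule tendsto_Lim[OF long_intervals_nontrivial])
  moreover have "(\<lambda>M. omega_avg_T W m n {0..<int M}) \<longlonglongrightarrow> w"
    by (rule filterlim_compose[OF w filterlim_initial_intervals])
  ultimately show "(\<lambda>M. row_avg M m n) \<longlonglongrightarrow> omega_T W m n" by (simp add: omega_avg_eq)
qed

text \<open>
  The Fourier coefficients, in the second variable, of the section at \<open>x\<close> of the formal density.
\<close>

definition section_coeff :: "real \<Rightarrow> int \<Rightarrow> complex" where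
  "section_coeff x n = (\<Sum>\<^sub>\<infinity>m. omega_T W m n * chr_T m x)"

lemma section_coeff_positive_definite: "positive_definite (section_coeff x)"
  unfolding section_coeff_def[abs_def] by (rule positive_definite_section)

lemma section_coeff_0: "complex_of_real (Re (section_coeff x 0)) = section_coeff x 0" "0 \<le> Re (section_coeff x 0)"
  using positive_definite_0[OF section_coeff_positive_definite[of x]]
  by (auto simp: complex_nonneg_Reals_iff complex_eq_iff)

lemma chr_T_measurable_T [measurable]: "chr_T n \<in> borel_measurable measure_T"
  by (simp add: measurable_measure_T)

lemmas section_coeff_series = integral_infsum_mult[where e=chr_T and M=measure_T,
    OF omega_row_summable chr_T_measurable_T eq_refl[OF cmod_chr_T]]

lemma section_coeff_measurable [measurable]: "(\<lambda>x. section_coeff x n) \<in> borel_measurable measure_T"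
  unfolding section_coeff_def by (rule section_coeff_series(3)[OF integrable_chr_T])

lemma section_coeff_integrable: "integrable measure_T (\<lambda>x. section_coeff x n)"
  using section_coeff_series(1)[OF integrable_chr_T, of n 0] by (simp add: section_coeff_def)

lemma section_coeff_coeff: "(\<integral>x. section_coeff x n * chr_T (- m) x \<partial>measure_T) = omega_T W m n"
proof -
  have "(\<integral>x. section_coeff x n * chr_T (- m) x \<partial>measure_T) =
      (\<Sum>\<^sub>\<infinity>k. omega_T W k n * (\<integral>x. chr_T k x * chr_T (- m) x \<partial>measure_T))"
    unfolding section_coeff_def by (rule section_coeff_series(2)[OF integrable_chr_T])
  also have "\<dots> = (\<Sum>\<^sub>\<infinity>k\<in>{m}. omega_T W k n * (\<integral>x. chr_T k x * chr_T (- m) x \<partial>measure_T))"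
    by (rule infsum_cong_neutral) (auto simp: integral_chr_T simp flip: chr_T_add)
  finally show ?thesis by (simp add: integral_chr_T flip: chr_T_add)
qed

text \<open>
  Dividing by the total mass makes the sections probability measures. Where the mass is 0 the
  constant sequence 1, whose measure is the unit mass at 0, is put in its place.
\<close>

lemma normalized_kernel:
  "\<exists>K. prob_space K \<and> sets K = sets measure_T \<and>
     (\<forall>n. (\<integral>a. chr_T (- n) a \<partial>K) = (if section_coeff x 0 = 0 then 1 else section_coeff x n / section_coeff x 0))"
proof -
  define h where "h n = (if section_coeff x 0 = 0 then 1 else section_coeff x n / section_coeff x 0)" for n
  have "positive_definite h"
    unfolding positive_definite_def
  proof (intro allI)
    fix K t
    show "(\<Sum>j=0..<int K. \<Sum>k=0..<int K. h (j - k) * chr_T (j - k) t) \<in> \<real>\<^sub>\<ge>\<^sub>0"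
    proof (cases "section_coeff x 0 = 0")
      case True
      have "(\<Sum>j=0..<int K. \<Sum>k=0..<int K. h (j - k) * chr_T (j - k) t) =
          (\<Sum>j=0..<int K. \<Sum>k=0..<int K. chr_T j t * cnj (chr_T k t))"
        using True by (simp add: h_def cnj_chr_T flip: chr_T_add)
      then show ?thesis by (simp only: sum_chr_square[OF finite_atLeastLessThan_int]) simp
    next
      case False
      have "(\<Sum>j=0..<int K. \<Sum>k=0..<int K. h (j - k) * chr_T (j - k) t) =
          (\<Sum>j=0..<int K. \<Sum>k=0..<int K. section_coeff x (j - k) * chr_T (j - k) t) / complex_of_real (Re (section_coeff x 0))"
        using False by (simp add: h_def section_coeff_0 sum_divide_distrib)
      moreover have "(\<Sum>j=0..<int K. \<Sum>k=0..<int K. section_coeff x (j - k) * chr_T (j - k) t) \<in> \<real>\<^sub>\<ge>\<^sub>0"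
        using section_coeff_positive_definite by (simp add: positive_definite_def)
      ultimately show ?thesis using section_coeff_0(2)[of x]
        by (simp add: complex_nonneg_Reals_iff)
    qed
  qed
  moreover have "h 0 = 1" by (simp add: h_def)
  ultimately show ?thesis unfolding h_def by (rule Herglotz)
qed

text \<open>
  The measure has the density \<open>section_coeff x 0\<close> in the first variable and the normalised kernel
  as conditional distribution of the second one. Where the mass is 0, the coefficients of the section
  and those of the measure agree because both vanish.
\<close>

lemma exists_mu: "\<exists>N. is_mu_T W N"
proof -
  obtain K where K_all: "\<forall>x. prob_space (K x) \<and> sets (K x) = sets measure_T \<and>
     (\<forall>n. (\<integral>a. chr_T (- n) a \<partial>K x) = (if section_coeff x 0 = 0 then 1 else section_coeff x n / section_coeff x 0))"
    by (rule exE[OF choice[OF allI[OF normalized_kernel]]])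
  have K: "prob_space (K x)" "sets (K x) = sets measure_T" for x using K_all by simp_all
  have K_coeff: "(\<integral>a. chr_T (- n) a \<partial>K x) = (if section_coeff x 0 = 0 then 1 else section_coeff x n / section_coeff x 0)" for x n
    using K_all by simp
  have K_meas [measurable]: "K \<in> measure_T \<rightarrow>\<^sub>M subprob_algebra measure_T"
  proof (rule measurable_subprob_algebra)
    show "subprob_space (K x)" for x by (rule prob_space_imp_subprob_space[OF K(1)])
    show "sets (K x) = sets measure_T" for x by (rule K(2))
    fix A assume A: "A \<in> sets measure_T"
    have "(\<lambda>x. measure (K x) A) \<in> borel_measurable measure_T"
    proof (rule kernel_measurable[OF _ K(2) _ A])
      show "finite_measure (K x)" for x using K(1) by (simp add: prob_space_def)
      fix n
      have "(\<integral>a. chr_T n a \<partial>K x) = (if section_coeff x 0 = 0 then 1 else section_coeff x (- n) / section_coeff x 0)" for x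
        using K_coeff[where n="- n"] by simp
      then show "(\<lambda>x. \<integral>a. chr_T n a \<partial>K x) \<in> borel_measurable measure_T" by simp
    qed
    moreover have "emeasure (K x) A = ennreal (measure (K x) A)" for x
      using K(1) by (intro finite_measure.emeasure_eq_measure) (simp add: prob_space_def)
    ultimately show "(\<lambda>x. emeasure (K x) A) \<in> borel_measurable measure_T" by simp
  qed
  define B where "B = density measure_T (\<lambda>x. ennreal (Re (section_coeff x 0)))"
  have sets_B [simp, measurable_cong]: "sets B = sets measure_T" and [simp]: "space B = space measure_T"
    by (simp_all add: B_def)
  have fin_B: "finite_measure B"
  proof (rule finite_measureI)
    have "emeasure B (space B) = (\<integral>\<^sup>+x. ennreal (Re (section_coeff x 0)) \<partial>measure_T)"
      unfolding B_def by (simp add: emeasure_density_space del: space_measure_T)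
    also have "\<dots> = ennreal (\<integral>x. Re (section_coeff x 0) \<partial>measure_T)"
      using section_coeff_integrable section_coeff_0(2) by (intro nn_integral_eq_integral) auto
    finally show "emeasure B (space B) \<noteq> \<infinity>" by simp
  qed
  define L where "L x = distr (K x) (measure_T \<Otimes>\<^sub>M measure_T) (Pair x)" for x
  have L_meas: "L \<in> B \<rightarrow>\<^sub>M subprob_algebra (measure_T \<Otimes>\<^sub>M measure_T)"
    unfolding L_def by (rule measurable_distr2[where M=measure_T]) measurable
  define N where "N = B \<bind> L"
  have sets_N: "sets N = sets (measure_T \<Otimes>\<^sub>M measure_T)"
    unfolding N_def by (rule sets_bind) (auto simp: L_def)
  have Pair_K: "Pair x \<in> K x \<rightarrow>\<^sub>M measure_T \<Otimes>\<^sub>M measure_T" if "x \<in> space measure_T" for x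
    using that by (subst measurable_cong_sets[OF K(2) refl]) measurable
  have prob_L: "prob_space (L x)" if "x \<in> space measure_T" for x
    unfolding L_def using K(1) Pair_K[OF that] by (rule prob_space.prob_space_distr)
  have fin_N: "finite_measure N"
  proof (rule finite_measureI)
    have "emeasure N (space N) = (\<integral>\<^sup>+p. 1 \<partial>N)" by simp
    also have "\<dots> = (\<integral>\<^sup>+x. \<integral>\<^sup>+p. 1 \<partial>L x \<partial>B)"
      unfolding N_def by (rule nn_integral_bind[OF _ L_meas]) simp
    also have "\<dots> = (\<integral>\<^sup>+x. 1 \<partial>B)"
      using prob_L by (intro nn_integral_cong) (simp add: prob_space.emeasure_space_1)
    also have "\<dots> < \<infinity>" using finite_measure.emeasure_finite[OF fin_B] by (simp add: less_top)
    finally show "emeasure N (space N) \<noteq> \<infinity>" by simp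
  qed
  have "(\<integral>(x, a). cis (- (of_int m * x) - of_int n * a) \<partial>N) = omega_T W m n" for m n
  proof -
    define F where "F p = chr_T (- m) (fst p) * chr_T (- n) (snd p)" for p :: "real \<times> real"
    have F_eq: "(\<lambda>(x, a). cis (- (of_int m * x) - of_int n * a)) = F"
      by (auto simp: F_def chr_T_def cis_mult)
    have F_meas [measurable]: "F \<in> borel_measurable (measure_T \<Otimes>\<^sub>M measure_T)"
      unfolding F_def by measurable
    have "(\<integral>p. F p \<partial>N) = (\<integral>x. (\<integral>p. F p \<partial>L x) \<partial>B)"
      unfolding N_def
      by (rule integral_bind_complex[OF F_meas _ L_meas fin_B fin_N[unfolded N_def] sets_N[unfolded N_def]])
         (simp add: F_def norm_mult)
    also have "\<dots> = (\<integral>x. chr_T (- m) x * (\<integral>a. chr_T (- n) a \<partial>K x) \<partial>B)"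
    proof (rule Bochner_Integration.integral_cong[OF refl])
      fix x assume "x \<in> space B"
      then have "(\<integral>p. F p \<partial>L x) = (\<integral>a. F (x, a) \<partial>K x)"
        unfolding L_def by (intro integral_distr Pair_K F_meas) simp
      then show "(\<integral>p. F p \<partial>L x) = chr_T (- m) x * (\<integral>a. chr_T (- n) a \<partial>K x)" by (simp add: F_def)
    qed
    also have "\<dots> = (\<integral>x. Re (section_coeff x 0) *\<^sub>R (chr_T (- m) x * (\<integral>a. chr_T (- n) a \<partial>K x)) \<partial>measure_T)"
      unfolding B_def using section_coeff_0(2) by (intro integral_density) (auto simp: K_coeff)
    also have "\<dots> = (\<integral>x. section_coeff x n * chr_T (- m) x \<partial>measure_T)"
    proof (rule Bochner_Integration.integral_cong[OF refl])
      fix x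
      have "section_coeff x 0 = 0 \<Longrightarrow> section_coeff x n = 0" by (rule positive_definite_zero[OF section_coeff_positive_definite])
      then show "Re (section_coeff x 0) *\<^sub>R (chr_T (- m) x * (\<integral>a. chr_T (- n) a \<partial>K x)) = section_coeff x n * chr_T (- m) x"
        by (simp add: K_coeff scaleR_conv_of_real section_coeff_0)
    qed
    finally show ?thesis unfolding F_eq by (simp add: section_coeff_coeff)
  qed
  then show ?thesis using sets_N fin_N by (auto simp: is_mu_T_def)
qed

context
  fixes N
  assumes mu: "is_mu_T W N"
begin

lemma sets_mu [measurable_cong]: "sets N = sets (measure_T \<Otimes>\<^sub>M measure_T)"
  and finite_mu: "finite_measure N"
  and coeff_mu: "(\<integral>p. chr_T (- m) (fst p) * chr_T (- n) (snd p) \<partial>N) = omega_T W m n"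
proof -
  show "sets N = sets (measure_T \<Otimes>\<^sub>M measure_T)" "finite_measure N"
    using mu by (auto simp: is_mu_T_def)
  have F_eq: "(\<lambda>(x, a). cis (- (of_int m * x) - of_int n * a)) =
      (\<lambda>p. chr_T (- m) (fst p) * chr_T (- n) (snd p))"
    by (auto simp: chr_T_def cis_mult)
  have "(\<integral>(x, a). cis (- (of_int m * x) - of_int n * a) \<partial>N) = omega_T W m n"
    using mu by (auto simp: is_mu_T_def)
  then show "(\<integral>p. chr_T (- m) (fst p) * chr_T (- n) (snd p) \<partial>N) = omega_T W m n"
    unfolding F_eq .
qed

lemma fst_mu [measurable]: "fst \<in> N \<rightarrow>\<^sub>M measure_T" and snd_mu [measurable]: "snd \<in> N \<rightarrow>\<^sub>M measure_T"
  by measurable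

lemma coeff_fst: "(\<integral>x. chr_T (- m) x \<partial>distr N measure_T fst) = omega_T W m 0"
  using coeff_mu[of m 0] by (subst integral_distr[OF fst_mu]) simp_all

lemma coeff_snd: "(\<integral>a. chr_T (- n) a \<partial>distr N measure_T snd) = omega_T W 0 n"
  using coeff_mu[of 0 n] by (subst integral_distr[OF snd_mu]) simp_all

lemma finite_marginals: "finite_measure (distr N measure_T fst)" "finite_measure (distr N measure_T snd)"
  using finite_measure.finite_measure_distr[OF finite_mu] fst_mu snd_mu by blast+

lemma fst_le: "distr N measure_T fst \<le> scale_measure (ennreal (diag_sum\<^sup>2)) measure_T"
  by (rule le_scale_measure_T[OF finite_marginals(1)])
     (simp_all add: coeff_fst omega_row_summable omega_row_le)

lemma snd_le: "distr N measure_T snd \<le> scale_measure (ennreal (diag_sum\<^sup>2)) measure_T"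
  by (rule le_scale_measure_T[OF finite_marginals(2)])
     (simp_all add: coeff_snd omega_column_summable omega_column_le)

lemma bounded_marginal_mu: "bounded_marginal measure_T N (diag_sum\<^sup>2)"
  by (intro bounded_marginal.intro bounded_marginal_axioms.intro T.finite_measure_axioms finite_mu
      fst_mu snd_mu snd_le) simp

lemma fst_absolutely_continuous: "absolutely_continuous measure_T (distr N measure_T fst)"
  unfolding absolutely_continuous_def
proof
  fix A assume A: "A \<in> null_sets measure_T"
  have "emeasure (distr N measure_T fst) A \<le> emeasure (scale_measure (ennreal (diag_sum\<^sup>2)) measure_T) A"
    using fst_le A by (subst (asm) le_measure) (auto simp: null_sets_def)
  then show "A \<in> null_sets (distr N measure_T fst)" using A by (auto simp: null_sets_def)
qed

end

context
  assumes unitary: "unitary_operator measure_T W"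
begin

lemma W_L2: "f \<in> L2 measure_T \<Longrightarrow> W f \<in> L2 measure_T"
  using unitary by (simp add: unitary_operator_def linear_operator_def)

lemma W_isometry: "f \<in> L2 measure_T \<Longrightarrow> g \<in> L2 measure_T \<Longrightarrow>
    L2_inner measure_T (W f) (W g) = L2_inner measure_T f g"
  using unitary by (simp add: unitary_operator_def)

lemma column_orthonormal:
  "(\<Sum>\<^sub>\<infinity>l. mat_T W l j * cnj (mat_T W l k)) = (if j = k then 1 else 0)"
proof -
  have "(\<Sum>\<^sub>\<infinity>l. mat_T W l j * cnj (mat_T W l k)) = L2_inner measure_T (W (chr_T j)) (W (chr_T k))"
    using entries_column_summable unfolding mat_T_def
    by (intro Parseval_summable W_L2 chr_T_L2)
  then show ?thesis by (simp add: W_isometry chr_T_L2 L2_inner_chr_T)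
qed

text \<open>
  As on the cyclic group, the adjoint enters through preimages $f_k$ of the characters, whose Fourier
  coefficients are the conjugates of the \<open>k\<close>-th row and hence absolutely summable.
\<close>

lemma row_orthonormal: "row_product k l 0 = (if k = l then 1 else 0)"
proof -
  have ex: "\<exists>f. f \<in> L2 measure_T \<and> (AE x in measure_T. W f x = chr_T k x)" for k
    using unitary chr_T_L2 unfolding unitary_operator_def by blast
  obtain f where f_all: "\<forall>k. f k \<in> L2 measure_T \<and> (AE x in measure_T. W (f k) x = chr_T k x)"
    by (rule exE[OF choice[OF allI[OF ex]]])
  then have f: "f k \<in> L2 measure_T" "AE x in measure_T. W (f k) x = chr_T k x" for k by simp_all
  have Wf_meas: "W (f k) \<in> borel_measurable measure_T" for k
    using W_L2[OF f(1)] by (simp add: L2_def)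
  have entry: "mat_T W k j = cnj (L2_inner measure_T (f k) (chr_T j))" for k j
  proof -
    have Wj: "W (chr_T j) \<in> borel_measurable measure_T"
      using W_L2[OF chr_T_L2] by (simp add: L2_def)
    have "AE x in measure_T. W (chr_T j) x * cnj (chr_T k x) = W (chr_T j) x * cnj (W (f k) x)"
      using f(2)[of k] by eventually_elim simp
    then have "mat_T W k j = L2_inner measure_T (W (chr_T j)) (W (f k))"
      unfolding mat_T_def L2_inner_def using Wj Wf_meas
      by (intro integral_cong_AE) (auto intro!: borel_measurable_times borel_measurable_cnj)
    also have "\<dots> = L2_inner measure_T (chr_T j) (f k)" by (intro W_isometry chr_T_L2 f)
    also have "\<dots> = cnj (L2_inner measure_T (f k) (chr_T j))"
      unfolding L2_inner_def by (subst Bochner_Integration.integral_cnj[symmetric]) (simp add: mult.commute)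
    finally show ?thesis .
  qed
  have "(\<lambda>j. cmod (L2_inner measure_T (f k) (chr_T j))) summable_on UNIV"
    using entries_row_summable[of k] by (simp add: entry)
  then have Parseval: "(\<Sum>\<^sub>\<infinity>j. L2_inner measure_T (f k) (chr_T j) * cnj (L2_inner measure_T (f l) (chr_T j))) =
      L2_inner measure_T (f k) (f l)"
    by (intro Parseval_summable f)
  have "row_product k l 0 = cnj (\<Sum>\<^sub>\<infinity>j. L2_inner measure_T (f k) (chr_T j) * cnj (L2_inner measure_T (f l) (chr_T j)))"
    unfolding row_product_def entry by (simp flip: infsum_cnj)
  also have "\<dots> = cnj (L2_inner measure_T (W (f k)) (W (f l)))"
    unfolding Parseval by (simp add: W_isometry f)
  also have "L2_inner measure_T (W (f k)) (W (f l)) = L2_inner measure_T (chr_T k) (chr_T l)"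
  proof -
    have "AE x in measure_T. W (f k) x * cnj (W (f l) x) = chr_T k x * cnj (chr_T l x)"
      using f(2)[of k] f(2)[of l] by eventually_elim simp
    then show ?thesis
      unfolding L2_inner_def using Wf_meas
      by (intro integral_cong_AE) (auto intro!: borel_measurable_times borel_measurable_cnj)
  qed
  finally show ?thesis by (simp add: L2_inner_chr_T)
qed

lemma marginals_unitary:
  assumes mu: "is_mu_T W N"
  shows "distr N measure_T fst = measure_T" "distr N measure_T snd = measure_T"
proof -
  have neg: "(\<integral>t. chr_T n t \<partial>L) = (\<integral>t. chr_T n t \<partial>measure_T)"
    if "\<And>n. (\<integral>t. chr_T (- n) t \<partial>L) = (if n = 0 then 1 else 0)" for L n
    using that[of "- n"] by (simp add: integral_chr_T)
  have "omega_T W m 0 = (if m = 0 then 1 else 0)" for m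
    by (rule omega_row_orthonormal) (rule row_orthonormal)
  then show "distr N measure_T fst = measure_T"
    by (intro measure_eqI_Fourier finite_marginals[OF mu] T.finite_measure_axioms neg)
       (simp_all add: coeff_fst[OF mu])
  have "omega_T W 0 n = (if n = 0 then 1 else 0)" for n
    by (rule omega_column_orthonormal) (simp add: column_orthonormal)
  then show "distr N measure_T snd = measure_T"
    by (intro measure_eqI_Fourier finite_marginals[OF mu] T.finite_measure_axioms neg)
       (simp_all add: coeff_snd[OF mu])
qed

end

theorem regular_case:
  assumes mu: "is_mu_T W N"
  shows "\<exists>T. determines_operator measure_T N T \<and> L1_onorm measure_T T \<le> (DT_norm_T W)\<^sup>2 \<and>
     nonneg_operator measure_T T \<and>
     (unitary_operator measure_T W \<longrightarrow> fixes_one measure_T T \<and> preserves_integral measure_T T)"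
proof -
  obtain T where "determines_operator measure_T N T" "L1_onorm measure_T T \<le> diag_sum\<^sup>2"
    "nonneg_operator measure_T T"
    "distr N measure_T fst = measure_T \<longrightarrow> fixes_one measure_T T"
    "distr N measure_T snd = measure_T \<longrightarrow> preserves_integral measure_T T"
    using bounded_marginal.exists_operator[OF bounded_marginal_mu[OF mu] fst_absolutely_continuous[OF mu]]
    by (elim exE conjE)
  then show ?thesis using marginals_unitary[OF _ mu] unfolding diag_sum_eq by (intro exI[of _ T]) simp
qed

end

theorem lemma7p1:
  "(\<forall>(M :: 'a::topological_space measure) F.
      prob_space M \<and> sets M = sets borel \<and> F \<in> automorphisms M \<and> continuous_on UNIV F \<longrightarrow>
      unitary_operator M (koopman F) \<and>
      (\<exists>T. determines_operator M (mu_koopman M F) T \<and>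
           nonneg_operator M T \<and> fixes_one M T \<and> preserves_integral M T)) \<and>
   (\<forall>(J :: nat) W.
      J \<ge> 1 \<and> linear_operator (measure_Z J) (L2 (measure_Z J)) W \<longrightarrow>
      (\<forall>x\<in>residues_Z J. \<forall>a\<in>residues_Z J. nu_Z J W x a \<in> \<real>\<^sub>\<ge>\<^sub>0) \<and>
      (\<exists>T. determines_operator (measure_Z J) (mu_Z J W) T \<and>
           (\<forall>f\<in>L1 (measure_Z J). \<forall>x\<in>residues_Z J.
              T f x = (\<integral>a. nu_Z J W x a * f a \<partial>measure_Z J)) \<and>
           L1_onorm (measure_Z J) T \<le> (DT_norm_Z J W)\<^sup>2 \<and>
           nonneg_operator (measure_Z J) T \<and>
           (unitary_operator (measure_Z J) W \<longrightarrow>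
              fixes_one (measure_Z J) T \<and> preserves_integral (measure_Z J) T))) \<and>
   (\<forall>W. regular_operator W \<longrightarrow>
      (\<exists>N. is_mu_T W N) \<and>
      (\<forall>N. is_mu_T W N \<longrightarrow>
         (\<exists>T. determines_operator measure_T N T \<and>
              L1_onorm measure_T T \<le> (DT_norm_T W)\<^sup>2 \<and>
              nonneg_operator measure_T T \<and>
              (unitary_operator measure_T W \<longrightarrow>
                 fixes_one measure_T T \<and> preserves_integral measure_T T))))"
proof (intro conjI allI impI)
  fix M :: "'a measure" and F
  assume "prob_space M \<and> sets M = sets borel \<and> F \<in> automorphisms M \<and> continuous_on UNIV F"
  then have asm: "prob_space M" "sets M = sets borel" "F \<in> automorphisms M" "continuous_on UNIV F"
    by simp_all
  show "unitary_operator M (koopman F)" by (rule unitary_operator_koopman[OF asm])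
  have "absolutely_continuous M (distr (mu_koopman M F) M fst)"
    unfolding distr_fst_koopman[OF asm] by (simp add: absolutely_continuous_def)
  from bounded_marginal.exists_operator[OF bounded_marginal_koopman[OF asm] this]
  show "\<exists>T. determines_operator M (mu_koopman M F) T \<and>
           nonneg_operator M T \<and> fixes_one M T \<and> preserves_integral M T"
    unfolding distr_fst_koopman[OF asm] distr_snd_koopman[OF asm] by (elim exE conjE) (intro exI conjI; simp)
next
  fix J :: nat and W
  assume "J \<ge> 1 \<and> linear_operator (measure_Z J) (L2 (measure_Z J)) W"
  then interpret cyclic_operator J W by unfold_locales simp
  show "\<forall>x\<in>residues_Z J. \<forall>a\<in>residues_Z J. nu_Z J W x a \<in> \<real>\<^sub>\<ge>\<^sub>0" by (intro ballI nu_nonneg)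
  show "\<exists>T. determines_operator (measure_Z J) (mu_Z J W) T \<and>
           (\<forall>f\<in>L1 (measure_Z J). \<forall>x\<in>residues_Z J.
              T f x = (\<integral>a. nu_Z J W x a * f a \<partial>measure_Z J)) \<and>
           L1_onorm (measure_Z J) T \<le> (DT_norm_Z J W)\<^sup>2 \<and>
           nonneg_operator (measure_Z J) T \<and>
           (unitary_operator (measure_Z J) W \<longrightarrow>
              fixes_one (measure_Z J) T \<and> preserves_integral (measure_Z J) T)"
    by (rule cyclic_case)
next
  fix W assume "regular_operator W"
  then interpret regular_operator_on_circle W by unfold_locales
  show "\<exists>N. is_mu_T W N" by (rule exists_mu)
  fix N assume "is_mu_T W N"
  then show "\<exists>T. determines_operator measure_T N T \<and>
              L1_onorm measure_T T \<le> (DT_norm_T W)\<^sup>2 \<and>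
              nonneg_operator measure_T T \<and>
              (unitary_operator measure_T W \<longrightarrow>
                 fixes_one measure_T T \<and> preserves_integral measure_T T)"
    by (rule regular_case)
qed

end
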